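(* Let $m\ge 2$ be even and $n\ge 1$, let $\mathcal{A}\in\mathbb{R}^{[n,m]}$ be a real symmetric tensor of order $m$ and dimension $n$, and put $d=n(m-1)^{n-1}$. Suppose that the $d$ eigenvalues of $\mathcal{A}$ (counted with multiplicity) are all real and positive, ordered as $\lambda_1\ge\lambda_2\ge\cdots\ge\lambda_d>0$. Let $k$ be an integer with $1\le k\le d$. Then $$(\lambda_{d-k+1}\cdots\lambda_d)^{1/k}\le(\det(\mathcal{A}))^{1/d}\le(\lambda_1\cdots\lambda_k)^{1/k}\le\frac{\lambda_1+\lambda_2+\cdots+\lambda_k}{k}$$ and $$(\lambda_{d-k+1}\cdots\lambda_d)^{1/k}\le\frac{\lambda_{d-k+1}+\cdots+\lambda_d}{k}\le\frac{(m-1)^{n-1}\operatorname{tr}(\mathcal{A})}{d}\le\frac{\lambda_1+\cdots+\lambda_k}{k}.$$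
   Context: $\mathbb{R}^{[n,m]}$ is the set of real tensors $\mathcal{A}=(a_{i_1\cdots i_m})_{1\le i_1,\dots,i_m\le n}$ of order $m$ and dimension $n$. $\mathcal{A}$ is symmetric if its entries are invariant under every permutation of the indices. For a vector $x$, $\mathcal{A}x^{m-1}$ is the vector with $i$-th component $\sum_{i_2,\dots,i_m=1}^n a_{i i_2\cdots i_m}x_{i_2}\cdots x_{i_m}$. The identity tensor $\mathcal{I}$ has entry $1$ when $i_1=\cdots=i_m$ and $0$ otherwise. The trace $\operatorname{tr}(\mathcal{A})=\sum_{i=1}^n a_{ii\cdots i}$ is the sum of the diagonal entries. The resultant of $n$ homogeneous polynomials $f_1,\dots,f_n$ in $n$ variables of degrees $d_1,\dots,d_n$ is the unique polynomial in their coefficients such that (1) it vanishes if and only if $f_1=\cdots=f_n=0$ has a nonzero (complex) solution; (2) it equals $1$ when $f_i=x_i^{d_i}$ for all $i$; (3) it is irreducible when the coefficients are viewed as independent variables. The determinant $\det(\mathcal{A})$ is the resultant of the ordered system of $n$ homogeneous polynomials of degree $m-1$ given by the components of $\mathcal{A}x^{m-1}$. The eigenvalues of $\mathcal{A}$ are the complex roots of the characteristic polynomial $\phi(\lambda)=\det(\mathcal{A}-\lambda\mathcal{I})$, which has degree $d=n(m-1)^{n-1}$; counted with multiplicity there are $d$ of them. *)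

theory Defs
  imports
    "HOL-Library.Poly_Mapping"
    "HOL-Combinatorics.Permutations"
    "HOL-Computational_Algebra.Computational_Algebra"
    Complex_Main
begin

section \<open>Multivariate polynomials\<close>

text \<open>A monomial is a finitely supported exponent function; a polynomial is a finitely
  supported coefficient function on monomials. The ring structure is that of
  \<open>Poly_Mapping\<close>.\<close>

type_synonym 'v monomial = "'v \<Rightarrow>\<^sub>0 nat"
type_synonym ('v, 'a) mpoly = "'v monomial \<Rightarrow>\<^sub>0 'a"

definition mpoly_const :: "'a::zero \<Rightarrow> ('v, 'a) mpoly" where
  "mpoly_const c = Poly_Mapping.single 0 c"

definition mpoly_var :: "'v \<Rightarrow> ('v, 'a::zero_neq_one) mpoly" where
  "mpoly_var v = Poly_Mapping.single (Poly_Mapping.single v 1) 1"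

definition mpoly_eval :: "('v \<Rightarrow> 'a::comm_semiring_1) \<Rightarrow> ('v, 'a) mpoly \<Rightarrow> 'a" where
  "mpoly_eval x p = (\<Sum>\<alpha>\<in>Poly_Mapping.keys p.
     Poly_Mapping.lookup p \<alpha> *
     (\<Prod>v\<in>Poly_Mapping.keys \<alpha>. x v ^ Poly_Mapping.lookup \<alpha> v))"

definition mpoly_vars :: "('v, 'a::zero) mpoly \<Rightarrow> 'v set" where
  "mpoly_vars p = (\<Union>\<alpha>\<in>Poly_Mapping.keys p. Poly_Mapping.keys \<alpha>)"

definition monomials_of_degree :: "nat \<Rightarrow> nat \<Rightarrow> nat monomial set" where
  "monomials_of_degree n e =
     {\<alpha>. Poly_Mapping.keys \<alpha> \<subseteq> {..<n} \<and>
          (\<Sum>v\<in>Poly_Mapping.keys \<alpha>. Poly_Mapping.lookup \<alpha> v) = e}"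

text \<open>Homogeneous of degree \<open>e\<close> in the variables \<open>x\<^sub>0, \<dots>, x\<^sub>n\<^sub>-\<^sub>1\<close>; this includes \<open>0\<close>.\<close>

definition homogeneous :: "nat \<Rightarrow> nat \<Rightarrow> (nat, 'a::zero) mpoly \<Rightarrow> bool" where
  "homogeneous n e p \<longleftrightarrow> Poly_Mapping.keys p \<subseteq> monomials_of_degree n e"

section \<open>The resultant\<close>

text \<open>The coefficient of the monomial \<open>\<alpha>\<close> in the \<open>i\<close>-th polynomial of a system is the
  indeterminate \<open>(i, \<alpha>)\<close>. The resultant is taken as a polynomial with integer coefficients,
  so that it can be evaluated at systems over any commutative ring.\<close>

type_synonym coeff_poly = "(nat \<times> nat monomial, int) mpoly"

definition coeff_eval ::
    "coeff_poly \<Rightarrow> (nat \<Rightarrow> (nat, 'a::comm_ring_1) mpoly) \<Rightarrow> 'a" where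
  "coeff_eval R f =
     mpoly_eval (\<lambda>(i, \<alpha>). Poly_Mapping.lookup (f i) \<alpha>) (Poly_Mapping.map of_int R)"

definition is_resultant :: "nat \<Rightarrow> (nat \<Rightarrow> nat) \<Rightarrow> coeff_poly \<Rightarrow> bool" where
  "is_resultant n ds R \<longleftrightarrow>
     mpoly_vars R \<subseteq> (SIGMA i:{..<n}. monomials_of_degree n (ds i)) \<and>
     (\<forall>f :: nat \<Rightarrow> (nat, complex) mpoly. (\<forall>i<n. homogeneous n (ds i) (f i)) \<longrightarrow>
        (coeff_eval R f = 0 \<longleftrightarrow>
         (\<exists>x :: nat \<Rightarrow> complex. (\<exists>j<n. x j \<noteq> 0) \<and> (\<forall>i<n. mpoly_eval x (f i) = 0)))) \<and>
     coeff_eval R (\<lambda>i. mpoly_var i ^ ds i :: (nat, complex) mpoly) = 1 \<and>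
     irreducible R"

definition resultant ::
    "nat \<Rightarrow> (nat \<Rightarrow> nat) \<Rightarrow> (nat \<Rightarrow> (nat, 'a::comm_ring_1) mpoly) \<Rightarrow> 'a" where
  "resultant n ds f = coeff_eval (THE R. is_resultant n ds R) f"

section \<open>Tensors\<close>

text \<open>A tensor of order \<open>m\<close> and dimension \<open>n\<close> is a function on index lists; only its values on
  \<open>tensor_indices n m\<close> are meaningful, and indices run from \<open>0\<close> to \<open>n - 1\<close>.\<close>

definition tensor_indices :: "nat \<Rightarrow> nat \<Rightarrow> nat list set" where
  "tensor_indices n m = {is. length is = m \<and> set is \<subseteq> {..<n}}"

definition symmetric_tensor :: "nat \<Rightarrow> nat \<Rightarrow> (nat list \<Rightarrow> 'a) \<Rightarrow> bool" where
  "symmetric_tensor n m A \<longleftrightarrow>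
     (\<forall>is\<in>tensor_indices n m. \<forall>p. p permutes {..<m} \<longrightarrow> A (permute_list p is) = A is)"

definition identity_tensor :: "nat list \<Rightarrow> 'a::zero_neq_one" where
  "identity_tensor is = (if \<forall>i\<in>set is. \<forall>j\<in>set is. i = j then 1 else 0)"

definition tensor_trace :: "nat \<Rightarrow> nat \<Rightarrow> (nat list \<Rightarrow> 'a::comm_monoid_add) \<Rightarrow> 'a" where
  "tensor_trace n m A = (\<Sum>i<n. A (replicate m i))"

text \<open>The vector \<open>A x\<^sup>m\<^sup>-\<^sup>1\<close>.\<close>

definition tensor_apply ::
    "nat \<Rightarrow> nat \<Rightarrow> (nat list \<Rightarrow> 'a::comm_semiring_1) \<Rightarrow> (nat \<Rightarrow> 'a) \<Rightarrow> nat \<Rightarrow> 'a" where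
  "tensor_apply n m A x i =
     (\<Sum>js\<in>tensor_indices n (m - 1). A (i # js) * prod_list (map x js))"

text \<open>The components of \<open>A x\<^sup>m\<^sup>-\<^sup>1\<close> for a vector \<open>x\<close> of indeterminates.\<close>

definition tensor_forms ::
    "nat \<Rightarrow> nat \<Rightarrow> (nat list \<Rightarrow> 'a::comm_semiring_1) \<Rightarrow> nat \<Rightarrow> (nat, 'a) mpoly" where
  "tensor_forms n m A = tensor_apply n m (\<lambda>is. mpoly_const (A is)) mpoly_var"

definition tensor_det :: "nat \<Rightarrow> nat \<Rightarrow> (nat list \<Rightarrow> 'a::comm_ring_1) \<Rightarrow> 'a" where
  "tensor_det n m A = resultant n (\<lambda>_. m - 1) (tensor_forms n m A)"

text \<open>The determinant of \<open>A - \<lambda>I\<close>, computed over the polynomial ring in the indeterminate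
  \<open>\<lambda> = [:0, 1:]\<close>; see \<open>poly_tensor_charpoly\<close> below.\<close>

definition tensor_charpoly :: "nat \<Rightarrow> nat \<Rightarrow> (nat list \<Rightarrow> 'a::comm_ring_1) \<Rightarrow> 'a poly" where
  "tensor_charpoly n m A =
     tensor_det n m (\<lambda>is. [:A is:] - [:0, 1:] * identity_tensor is)"

definition tensor_eigenvalues :: "nat \<Rightarrow> nat \<Rightarrow> (nat list \<Rightarrow> real) \<Rightarrow> complex multiset" where
  "tensor_eigenvalues n m A = proots (tensor_charpoly n m (\<lambda>is. complex_of_real (A is)))"

lemma finite_tensor_indices [simp]: "finite (tensor_indices n m)"
  using finite_lists_length_eq[of "{..<n}" m]
  by (simp add: tensor_indices_def conj_commute)

lemma lookup_tensor_forms: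
  "Poly_Mapping.lookup (tensor_forms n m A i) \<alpha> =
     (\<Sum>js\<in>tensor_indices n (m - 1).
        if sum_list (map (\<lambda>j. Poly_Mapping.single j 1) js) = \<alpha> then A (i # js) else 0)"
proof -
  have *: "prod_list (map mpoly_var js) =
      (Poly_Mapping.single (sum_list (map (\<lambda>j. Poly_Mapping.single j 1) js)) 1
        :: (nat, 'a) mpoly)" for js
    by (induction js) (simp_all add: mpoly_var_def Poly_Mapping.mult_single)
  show ?thesis
    by (simp add: tensor_forms_def tensor_apply_def lookup_sum * mpoly_const_def
        Poly_Mapping.mult_single lookup_single when_def)
qed

lemma coeff_eval_alt:
  "coeff_eval R f = (\<Sum>\<alpha>\<in>Poly_Mapping.keys R. of_int (Poly_Mapping.lookup R \<alpha>) *
     (\<Prod>v\<in>Poly_Mapping.keys \<alpha>.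
        Poly_Mapping.lookup (f (fst v)) (snd v) ^ Poly_Mapping.lookup \<alpha> v))"
proof -
  have "Poly_Mapping.keys (Poly_Mapping.map of_int R) \<subseteq> Poly_Mapping.keys R"
    by (auto simp: in_keys_iff Poly_Mapping.map.rep_eq when_def)
  then show ?thesis
    unfolding coeff_eval_def mpoly_eval_def
    by (intro sum.mono_neutral_cong_left)
       (auto simp: in_keys_iff Poly_Mapping.map.rep_eq when_def case_prod_beta)
qed

lemma poly_tensor_charpoly:
  "poly (tensor_charpoly n m A) z = tensor_det n m (\<lambda>is. A is - z * identity_tensor is)"
proof -
  have "poly (Poly_Mapping.lookup (tensor_forms n m
      (\<lambda>is. [:A is:] - [:0, 1:] * identity_tensor is) i) \<alpha>) z =
    Poly_Mapping.lookup (tensor_forms n m (\<lambda>is. A is - z * identity_tensor is) i) \<alpha>" for i \<alpha>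
    unfolding lookup_tensor_forms poly_sum
    by (intro sum.cong refl) (simp add: identity_tensor_def)
  moreover have "poly (of_int k) z = of_int k" for k
    by (metis of_int_poly poly_const_conv)
  ultimately show ?thesis
    by (simp add: tensor_charpoly_def tensor_det_def resultant_def coeff_eval_alt
        poly_sum poly_prod)
qed

end

theory Submission
  imports
    Defs
    "HOL-Library.Product_Lexorder"
    "HOL-Analysis.Continuum_Not_Denumerable"
    "Jordan_Normal_Form.Determinant"
begin

text \<open>The inequalities follow from \<open>det A = \<Prod> \<lambda>\<^sub>i\<close> and \<open>(m - 1)\<^bsup>n - 1\<^esup> tr A = \<Sum> \<lambda>\<^sub>i\<close> by comparing
  means of a monotone sequence. These identities require the resultant to be pinned down. The
  integer polynomials vanishing on all complex systems with a common zero form a prime ideal,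
  since any two such systems are joined by a polynomial path of such systems. The ideal contains
  no nonzero polynomial avoiding one chosen coefficient, so by Gauss's lemma it is principal. The
  Nullstellensatz and Macaulay determinants show that the zeros of its generator \<open>R\<close> are exactly
  these systems, and the Macaulay determinant that is \<open>1\<close> at \<open>(x\<^sub>i\<^sup>d)\<close> normalises \<open>R\<close>.
  Any other resultant is a multiple of \<open>R\<close>, hence equal to it.

  Univariate restrictions of \<open>R\<close> are determined by their roots: adding to \<open>(x\<^sub>i\<^sup>d)\<close> a
  non-diagonal term creates no common zero, so only diagonal entries contribute to the linear
  term of \<open>R\<close> there, and by symmetry they all contribute with the same factor, which the
  number of eigenvalues fixes to be \<open>(m - 1)\<^bsup>n - 1\<^esup>\<close>.\<close>

hide_const (open) Module.smult

text \<open>The determinant is given by a definite description, so none of its values is accessible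
  before existence and uniqueness of the resultant are settled. Geometrically, the systems with a
  common zero form an irreducible hypersurface: primality of their ideal expresses irreducibility,
  and the absence of nonzero members free of one coefficient expresses codimension at most one.
  Integer coefficients allow one and the same \<open>R\<close> to be evaluated over the reals, over
  the complex numbers and over the polynomial ring in the eigenvalue variable. Their price is that
  contents and the units 1 and -1 have to be controlled; hence factoriality is developed from the
  integers upwards, and one integer value of \<open>R\<close> is computed exactly.\<close>

abbreviation lookup where "lookup \<equiv> Poly_Mapping.lookup"
abbreviation keys where "keys \<equiv> Poly_Mapping.keys"
abbreviation single where "single \<equiv> Poly_Mapping.single"

section \<open>Factorial subrings of an integral domain\<close>

text \<open>Subrings are sets inside one ambient domain because the induction on variables passes
  from \<open>polys_in X\<close> to \<open>polys_in (insert t X)\<close>, and these sets live in a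
  single type. Divisibility and primality are therefore taken relative to \<open>S\<close>.\<close>

locale dom_subring =
  fixes S :: "'a::idom set"
  assumes one_in [simp]: "1 \<in> S"
    and diff_in: "a \<in> S \<Longrightarrow> b \<in> S \<Longrightarrow> a - b \<in> S"
    and mult_in: "a \<in> S \<Longrightarrow> b \<in> S \<Longrightarrow> a * b \<in> S"
begin

lemma zero_in [simp]: "0 \<in> S"
  using diff_in[of 1 1] by simp

lemma uminus_in: "a \<in> S \<Longrightarrow> - a \<in> S"
  using diff_in[of 0 a] by simp

lemma add_in: "a \<in> S \<Longrightarrow> b \<in> S \<Longrightarrow> a + b \<in> S"
  using diff_in[of a "- b"] uminus_in by simp

lemma sum_in: "(\<And>i. i \<in> I \<Longrightarrow> f i \<in> S) \<Longrightarrow> sum f I \<in> S"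
  by (induction I rule: infinite_finite_induct) (auto intro: add_in)

lemma power_in: "a \<in> S \<Longrightarrow> a ^ k \<in> S"
  by (induction k) (auto intro: mult_in)

lemma prod_list_in: "set as \<subseteq> S \<Longrightarrow> prod_list as \<in> S"
  by (induction as) (auto intro: mult_in)

end

definition dvd_in :: "'a::idom set \<Rightarrow> 'a \<Rightarrow> 'a \<Rightarrow> bool" where
  "dvd_in S a b \<longleftrightarrow> (\<exists>k\<in>S. b = a * k)"

definition prime_in :: "'a::idom set \<Rightarrow> 'a \<Rightarrow> bool" where
  "prime_in S p \<longleftrightarrow> p \<in> S \<and> p \<noteq> 0 \<and> \<not> dvd_in S p 1 \<and>
     (\<forall>a\<in>S. \<forall>b\<in>S. dvd_in S p (a * b) \<longrightarrow> dvd_in S p a \<or> dvd_in S p b)"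

text \<open>The factors are prime and not merely irreducible, so existence of a factorization
  already carries its uniqueness.\<close>

locale factorial_subring = dom_subring +
  assumes factorization: "a \<in> S \<Longrightarrow> a \<noteq> 0 \<Longrightarrow>
    \<exists>u ps. u \<in> S \<and> dvd_in S u 1 \<and> (\<forall>p\<in>set ps. prime_in S p) \<and> a = u * prod_list ps"

definition polys_over :: "'a::idom set \<Rightarrow> 'a poly set" where
  "polys_over S = {q. \<forall>i. coeff q i \<in> S}"

text \<open>Content one, expressed through primes so that no gcd of coefficients has to be
  formed.\<close>

definition primitive_over :: "'a::idom set \<Rightarrow> 'a poly \<Rightarrow> bool" where
  "primitive_over S f \<longleftrightarrow> (\<forall>p. prime_in S p \<longrightarrow> \<not> dvd_in (polys_over S) [:p:] f)"

section \<open>Divisibility relative to a subring and Gauss's lemma on primes\<close>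

context dom_subring
begin

abbreviation Sx where "Sx \<equiv> polys_over S"

lemma dvd_in_trans: "dvd_in S a b \<Longrightarrow> dvd_in S b c \<Longrightarrow> dvd_in S a c"
  unfolding dvd_in_def using mult_in by (metis mult.assoc)

lemma dvd_in_refl [simp]: "dvd_in S a a"
  unfolding dvd_in_def by (rule bexI[of _ 1]) auto

lemma dvd_in_mult: "dvd_in S a b \<Longrightarrow> c \<in> S \<Longrightarrow> dvd_in S a (b * c)"
  unfolding dvd_in_def using mult_in by (metis mult.assoc)

lemma dvd_in_mult2: "dvd_in S a b \<Longrightarrow> c \<in> S \<Longrightarrow> dvd_in S a (c * b)"
  using dvd_in_mult by (simp add: mult.commute)

lemma dvd_in_add: "dvd_in S a b \<Longrightarrow> dvd_in S a c \<Longrightarrow> dvd_in S a (b + c)"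
  unfolding dvd_in_def using add_in by (metis distrib_left)

lemma dvd_in_diff: "dvd_in S a b \<Longrightarrow> dvd_in S a c \<Longrightarrow> dvd_in S a (b - c)"
  unfolding dvd_in_def using diff_in by (metis right_diff_distrib)

lemma dvd_in_0 [simp]: "dvd_in S a 0"
  unfolding dvd_in_def by (rule bexI[of _ 0]) auto

lemma dvd_in_sum: "(\<And>i. i \<in> I \<Longrightarrow> dvd_in S a (f i)) \<Longrightarrow> dvd_in S a (sum f I)"
  by (induction I rule: infinite_finite_induct) (auto intro: dvd_in_add)

lemma subring_polys_over: "dom_subring Sx"
proof
  show "a * b \<in> Sx" if "a \<in> Sx" "b \<in> Sx" for a b
    using that by (auto simp: polys_over_def coeff_mult intro!: sum_in mult_in)
qed (auto simp: polys_over_def coeff_1 intro: diff_in)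

interpretation PO: dom_subring Sx
  by (rule subring_polys_over)

lemma const_in_polys_over [simp]: "[:a:] \<in> Sx \<longleftrightarrow> a \<in> S"
  by (auto simp: polys_over_def coeff_pCons split: nat.splits)

lemma monom_in_polys_over [simp]: "monom a i \<in> Sx \<longleftrightarrow> a \<in> S"
  by (auto simp: polys_over_def coeff_monom)

lemma smult_in_polys_over: "a \<in> S \<Longrightarrow> q \<in> Sx \<Longrightarrow> smult a q \<in> Sx"
  by (auto simp: polys_over_def intro: mult_in)

lemma coeff_in: "q \<in> Sx \<Longrightarrow> coeff q i \<in> S"
  by (auto simp: polys_over_def)

lemma const_dvd_in_iff:
  assumes "q \<in> Sx"
  shows "dvd_in Sx [:a:] q \<longleftrightarrow> (\<forall>i. dvd_in S a (coeff q i))"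
proof
  assume "dvd_in Sx [:a:] q"
  then show "\<forall>i. dvd_in S a (coeff q i)"
    by (auto simp: dvd_in_def polys_over_def)
next
  assume "\<forall>i. dvd_in S a (coeff q i)"
  then obtain k where k: "k i \<in> S" "coeff q i = a * k i" for i
    unfolding dvd_in_def by metis
  have "q = (\<Sum>i\<le>degree q. monom (coeff q i) i)"
    by (simp add: poly_as_sum_of_monoms)
  also have "\<dots> = [:a:] * (\<Sum>i\<le>degree q. monom (k i) i)"
    by (simp add: k(2) sum_distrib_left smult_monom)
  finally show "dvd_in Sx [:a:] q"
    unfolding dvd_in_def using k(1) by (intro bexI[of _ "\<Sum>i\<le>degree q. monom (k i) i"])
      (auto intro!: PO.sum_in)
qed

lemma prime_in_polys_over:
  assumes p: "prime_in S p"
  shows "prime_in Sx [:p:]"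
proof -
  have "\<not> dvd_in Sx [:p:] 1"
    using p const_dvd_in_iff[of 1 p] by (auto simp: prime_in_def dest: spec[of _ 0])
  moreover have "dvd_in Sx [:p:] f \<or> dvd_in Sx [:p:] g"
    if f: "f \<in> Sx" and g: "g \<in> Sx"
      and fg: "dvd_in Sx [:p:] (f * g)" for f g
  proof (rule ccontr)
    let ?P = "\<lambda>h i. \<not> dvd_in S p (coeff h i)"
    assume "\<not> ?thesis"
    then have ex: "\<exists>i. ?P f i" "\<exists>i. ?P g i"
      using const_dvd_in_iff f g by blast+
    \<comment> \<open>With \<open>i\<close> and \<open>j\<close> the least indices of coefficients
      not divisible by \<open>p\<close>, every summand of coefficient \<open>i + j\<close> of the
      product except \<open>coeff f i * coeff g j\<close> has a factor of smaller index and is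
      divisible by \<open>p\<close>.\<close>
    define i where "i = (LEAST i. ?P f i)"
    define j where "j = (LEAST j. ?P g j)"
    have i: "?P f i" "\<And>l. l < i \<Longrightarrow> dvd_in S p (coeff f l)"
      unfolding i_def using ex(1) by (rule LeastI_ex, auto dest: not_less_Least)
    have j: "?P g j" "\<And>l. l < j \<Longrightarrow> dvd_in S p (coeff g l)"
      unfolding j_def using ex(2) by (rule LeastI_ex, auto dest: not_less_Least)
    have "dvd_in S p (coeff (f * g) (i + j))"
      using fg const_dvd_in_iff[OF PO.mult_in[OF f g]] by blast
    moreover have "coeff (f * g) (i + j) = coeff f i * coeff g j +
        (\<Sum>l\<in>{..i+j} - {i}. coeff f l * coeff g (i + j - l))"
      by (simp add: coeff_mult sum.remove[of _ i])
    moreover have "dvd_in S p (\<Sum>l\<in>{..i+j} - {i}. coeff f l * coeff g (i + j - l))"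
    proof (rule dvd_in_sum)
      fix l assume l: "l \<in> {..i+j} - {i}"
      show "dvd_in S p (coeff f l * coeff g (i + j - l))"
      proof (cases "l < i")
        case True
        then show ?thesis using i(2) coeff_in[OF g] by (auto intro: dvd_in_mult)
      next
        case False
        then have "i + j - l < j" using l by auto
        then show ?thesis using j(2) coeff_in[OF f] by (auto intro: dvd_in_mult2)
      qed
    qed
    ultimately have "dvd_in S p (coeff f i * coeff g j)"
      using dvd_in_diff by fastforce
    then show False
      using i(1) j(1) p coeff_in[OF f] coeff_in[OF g] by (auto simp: prime_in_def)
  qed
  ultimately show ?thesis
    using p by (auto simp: prime_in_def)
qed

text \<open>Division without inverting the leading coefficient: each cancellation of a top term
  costs one factor \<open>lead_coeff r\<close>.\<close>

lemma pseudo_division: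
  assumes r: "r \<in> Sx" "r \<noteq> 0" and g: "g \<in> Sx"
  shows "\<exists>k. \<exists>q\<in>Sx. \<exists>s\<in>Sx.
    smult (lead_coeff r ^ k) g = q * r + s \<and> (s = 0 \<or> degree s < degree r)"
  using g
proof (induction "degree g" arbitrary: g rule: less_induct)
  case less
  let ?c = "lead_coeff r"
  show ?case
  proof (cases "g = 0 \<or> degree g < degree r")
    case True
    then show ?thesis using less.prems
      by (intro exI[of _ 0] bexI[of _ 0] bexI[of _ g]) auto
  next
    case False
    define m where "m = monom (lead_coeff g) (degree g - degree r)"
    define h where "h = smult ?c g - m * r"
    have m: "m \<in> Sx" and c: "?c \<in> S"
      using less.prems r by (auto simp: m_def coeff_in)
    have h: "h \<in> Sx"
      unfolding h_def using less.prems r m c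
      by (intro PO.diff_in PO.mult_in smult_in_polys_over)
    have dm: "degree (m * r) = degree g"
      using False r by (subst degree_mult_eq) (auto simp: m_def degree_monom_eq)
    have lm: "coeff (m * r) (degree g) = ?c * lead_coeff g"
      using False r dm lead_coeff_mult[of m r] by (simp add: m_def degree_monom_eq lead_coeff_monom)
    have hz: "coeff h (degree g) = 0"
      unfolding h_def using lm by simp
    have hd: "degree h \<le> degree g"
      unfolding h_def by (intro degree_diff_le) (auto simp: dm intro: degree_smult_le)
    show ?thesis
    proof (cases "h = 0")
      case True
      then have "smult (?c ^ 1) g = m * r + 0" by (simp add: h_def)
      then show ?thesis using m by fastforce
    next
      case h0: False
      have "degree h < degree g"
        using hz hd h0 by (metis le_neq_implies_less leading_coeff_0_iff)
      from less.hyps[OF this h] obtain k q s where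
        q: "q \<in> Sx" "s \<in> Sx"
        and eq: "smult (?c ^ k) h = q * r + s" "s = 0 \<or> degree s < degree r"
        by blast
      have "smult (?c ^ Suc k) g = smult (?c ^ k) (h + m * r)"
        by (simp add: h_def mult.commute)
      also have "\<dots> = (q + smult (?c ^ k) m) * r + s"
        by (simp add: smult_add_right eq(1) algebra_simps)
      finally have "smult (?c ^ Suc k) g = (q + smult (?c ^ k) m) * r + s" .
      moreover have "q + smult (?c ^ k) m \<in> Sx"
        using q m c by (intro PO.add_in smult_in_polys_over power_in)
      ultimately show ?thesis using q eq(2) by blast
    qed
  qed
qed

text \<open>A prime divisor of the product divides one of its primes and differs from it by a unit,
  which is absorbed into \<open>w\<close>. The drop in length drives the induction in
  \<open>primitive_part_exists\<close>.\<close>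

lemma prime_in_dvd_prod:
  assumes p: "prime_in S p" and u: "u \<in> S" "dvd_in S u 1"
    and "\<forall>q\<in>set ps. prime_in S q" and "dvd_in S p (u * prod_list ps)"
  shows "\<exists>w qs. w \<in> S \<and> dvd_in S w 1 \<and> (\<forall>q\<in>set qs. prime_in S q) \<and>
    length qs < length ps \<and> u * prod_list ps = p * (w * prod_list qs)"
  using assms(4,5)
proof (induction ps)
  case Nil
  then have "dvd_in S p 1" using u dvd_in_trans by auto
  then show ?case using p by (simp add: prime_in_def)
next
  case (Cons q ps)
  have q: "prime_in S q" "q \<in> S" and ps: "\<forall>q\<in>set ps. prime_in S q"
    using Cons.prems by (auto simp: prime_in_def)
  have psS: "set ps \<subseteq> S" using ps by (auto simp: prime_in_def)
  have "dvd_in S p (q * (u * prod_list ps))"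
    using Cons.prems(2) by (simp add: mult_ac)
  then have "dvd_in S p q \<or> dvd_in S p (u * prod_list ps)"
    using p q(2) u(1) prod_list_in[OF psS] mult_in by (auto simp: prime_in_def)
  then show ?case
  proof
    assume "dvd_in S p q"
    then obtain k where k: "k \<in> S" "q = p * k" by (auto simp: dvd_in_def)
    \<comment> \<open>The prime \<open>q = p * k\<close> divides \<open>p\<close> or
      \<open>k\<close>. In the first case \<open>k\<close> is invertible; in the second
      \<open>p\<close> would be, which primality excludes.\<close>
    have "dvd_in S k 1"
    proof -
      have pS: "p \<in> S" "p \<noteq> 0" using p by (auto simp: prime_in_def)
      have "dvd_in S q (p * k)" using k by simp
      then have "dvd_in S q p \<or> dvd_in S q k" using q(1) k(1) pS by (auto simp: prime_in_def)
      then show ?thesis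
      proof
        assume "dvd_in S q p"
        then obtain l where l: "l \<in> S" "p = p * k * l" using k by (auto simp: dvd_in_def)
        then have "p * 1 = p * (k * l)" by (simp add: mult.assoc)
        then have "1 = k * l" using pS by (metis mult_left_cancel)
        then show ?thesis using l(1) by (auto simp: dvd_in_def)
      next
        assume "dvd_in S q k"
        then obtain l where l: "l \<in> S" "k = p * k * l" using k by (auto simp: dvd_in_def)
        have "k \<noteq> 0" using k(2) q(1) by (auto simp: prime_in_def)
        moreover have "k * 1 = k * (p * l)" using l(2) by (simp add: mult_ac)
        ultimately have "1 = p * l" by (metis mult_left_cancel)
        then have "dvd_in S p 1" using l(1) by (auto simp: dvd_in_def)
        then show ?thesis using p by (simp add: prime_in_def)
      qed
    qed
    then obtain l where l: "l \<in> S" "1 = k * l" by (auto simp: dvd_in_def)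
    obtain v where v: "v \<in> S" "1 = u * v" using u by (auto simp: dvd_in_def)
    have "1 = (u * k) * (v * l)" using l v by (metis (no_types) mult.assoc mult.commute mult_1)
    then have "dvd_in S (u * k) 1" using l v mult_in by (auto simp: dvd_in_def)
    then show ?thesis using k u ps mult_in
      by (intro exI[of _ "u * k"] exI[of _ ps]) (auto simp: mult_ac)
  next
    assume "dvd_in S p (u * prod_list ps)"
    from Cons.IH[OF ps this] obtain w qs where w: "w \<in> S" "dvd_in S w 1"
      "\<forall>q\<in>set qs. prime_in S q" "length qs < length ps"
      "u * prod_list ps = p * (w * prod_list qs)" by blast
    have "u * prod_list (q # ps) = q * (u * prod_list ps)" by (simp add: mult_ac)
    also have "\<dots> = p * (w * prod_list (q # qs))" by (simp add: w(5) mult_ac)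
    finally show ?thesis using w q
      by (intro exI[of _ w] exI[of _ "q # qs"]) auto
  qed
qed

end

section \<open>Gauss's theorem: polynomials over a factorial ring form a factorial ring\<close>

context factorial_subring
begin

interpretation PO: dom_subring Sx
  by (rule subring_polys_over)

text \<open>The primes of \<open>a\<close> are removed one at a time: each divides
  \<open>f * h\<close>, stays prime among polynomials, cannot divide the primitive \<open>f\<close>,
  and so is cancelled from \<open>h\<close>.\<close>

lemma Gauss_cancel:
  assumes a: "a \<in> S" "a \<noteq> 0" and f: "f \<in> Sx" "primitive_over S f"
    and g: "g \<in> Sx" and h: "h \<in> Sx" and eq: "smult a g = f * h"
  shows "dvd_in Sx f g"
proof -
  from factorization[OF a] obtain u ps where u: "u \<in> S" "dvd_in S u 1"
    and ps: "\<forall>p\<in>set ps. prime_in S p" and aeq: "a = u * prod_list ps" by blast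
  obtain v where v: "v \<in> S" "1 = u * v" using u by (auto simp: dvd_in_def)
  have "\<exists>h'\<in>Sx. smult u g = f * h'" using eq ps h unfolding aeq
  proof (induction ps arbitrary: h)
    case Nil
    then show ?case by auto
  next
    case (Cons p ps)
    have p: "prime_in S p" "p \<noteq> 0" "p \<in> S" using Cons.prems by (auto simp: prime_in_def)
    have psS: "set ps \<subseteq> S" using Cons.prems by (auto simp: prime_in_def)
    have "f * h = [:p:] * smult (u * prod_list ps) g"
      using Cons.prems(1) by (simp add: mult_ac)
    moreover have "smult (u * prod_list ps) g \<in> Sx"
      using u g prod_list_in[OF psS] by (intro smult_in_polys_over mult_in)
    ultimately have "dvd_in Sx [:p:] (f * h)"
      unfolding dvd_in_def by blast
    then have "dvd_in Sx [:p:] h"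
      using prime_in_polys_over[OF p(1)] f p(1) Cons.prems(3)
      unfolding prime_in_def primitive_over_def by blast
    then obtain h1 where h1: "h1 \<in> Sx" "h = [:p:] * h1" by (auto simp: dvd_in_def)
    have "[:p:] * smult (u * prod_list ps) g = [:p:] * (f * h1)"
      using Cons.prems(1) h1(2) by (simp add: mult_ac)
    then have "smult (u * prod_list ps) g = f * h1"
      using p(2) by (metis mult_left_cancel pCons_eq_0_iff)
    from Cons.IH[OF this _ h1(1)] Cons.prems show ?case by auto
  qed
  then obtain h' where h': "h' \<in> Sx" "smult u g = f * h'" by blast
  have "g = smult v (smult u g)" using v by (simp add: mult.commute)
  also have "\<dots> = f * smult v h'" by (simp add: h')
  finally show ?thesis
    unfolding dvd_in_def using h'(1) v(1) smult_in_polys_over by blast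
qed

text \<open>A constant prime dividing \<open>f\<close> also divides its leading coefficient, so only
  finitely many can be pulled out; the length of the factorization of that coefficient is the
  measure.\<close>

lemma primitive_part_exists:
  assumes f: "f \<in> Sx" "f \<noteq> 0"
  shows "\<exists>c\<in>S. \<exists>f'\<in>Sx. f = smult c f' \<and> primitive_over S f'"
proof -
  have *: "\<exists>c\<in>S. \<exists>f'\<in>Sx. f = smult c f' \<and> primitive_over S f'"
    if "f \<in> Sx" "f \<noteq> 0" "u \<in> S" "dvd_in S u 1" "\<forall>p\<in>set ps. prime_in S p"
      "lead_coeff f = u * prod_list ps" for f u ps
    using that
  proof (induction "length ps" arbitrary: f u ps rule: less_induct)
    case less
    show ?case
    proof (cases "primitive_over S f")
      case True
      then show ?thesis using less.prems by (intro bexI[of _ 1] bexI[of _ f]) auto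
    next
      case False
      then obtain p f1 where p: "prime_in S p" and f1: "f1 \<in> Sx" "f = [:p:] * f1"
        unfolding primitive_over_def dvd_in_def by blast
      have p0: "p \<noteq> 0" "p \<in> S" using p by (auto simp: prime_in_def)
      have lc: "lead_coeff f = p * lead_coeff f1" using f1 by simp
      then have "dvd_in S p (u * prod_list ps)"
        using less.prems(6) coeff_in[OF f1(1)] by (auto simp: dvd_in_def)
      from prime_in_dvd_prod[OF p less.prems(3,4,5) this] obtain w qs where
        w: "w \<in> S" "dvd_in S w 1" "\<forall>q\<in>set qs. prime_in S q" "length qs < length ps"
        "u * prod_list ps = p * (w * prod_list qs)" by blast
      have "lead_coeff f1 = w * prod_list qs"
        using lc less.prems(6) w(5) p0 by simp
      moreover have "f1 \<noteq> 0" using f1 less.prems by auto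
      ultimately obtain c f' where c: "c \<in> S" "f' \<in> Sx" "f1 = smult c f'"
        "primitive_over S f'" using less.hyps[OF w(4) f1(1) _ w(1-3)] by blast
      then have "f = smult (p * c) f'" using f1 by (simp add: mult.commute)
      then show ?thesis using c p0 mult_in by blast
    qed
  qed
  from factorization[of "lead_coeff f"] obtain u ps where
    "u \<in> S" "dvd_in S u 1" "\<forall>p\<in>set ps. prime_in S p" "lead_coeff f = u * prod_list ps"
    using f coeff_in by auto
  with * f show ?thesis by blast
qed

text \<open>Pseudo-division leaves no remainder by minimality, and the Gauss lemma removes the
  power of the leading coefficient it introduces.\<close>

lemma minimal_generator:
  assumes J: "J \<subseteq> Sx" "\<And>g h. g \<in> J \<Longrightarrow> h \<in> J \<Longrightarrow> g - h \<in> J"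
      "\<And>g h. g \<in> J \<Longrightarrow> h \<in> Sx \<Longrightarrow> h * g \<in> J"
    and r: "r \<in> J" "r \<noteq> 0" "\<And>g. g \<in> J \<Longrightarrow> g \<noteq> 0 \<Longrightarrow> degree r \<le> degree g"
    and r': "r = smult c r'" "c \<in> S" "r' \<in> Sx" "primitive_over S r'"
    and g: "g \<in> J"
  shows "dvd_in Sx r' g"
proof -
  have rS: "r \<in> Sx" and gS: "g \<in> Sx" using J r g by auto
  from pseudo_division[OF rS r(2) gS] obtain k q s where
    q: "q \<in> Sx" "s \<in> Sx"
    and eq: "smult (lead_coeff r ^ k) g = q * r + s" and s: "s = 0 \<or> degree s < degree r"
    by blast
  have lc: "lead_coeff r ^ k \<in> S" "lead_coeff r ^ k \<noteq> 0"
    using rS r(2) by (auto intro!: power_in coeff_in)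
  have "s = [:lead_coeff r ^ k:] * g - q * r" using eq by simp
  also have "\<dots> \<in> J" by (intro J(2) J(3)) (use g q r(1) lc in auto)
  finally have "s = 0" using r(3)[of s] s by force
  then have "smult (lead_coeff r ^ k) g = r' * smult c q" using eq r' by (simp add: mult.commute)
  with Gauss_cancel[OF lc r'(3,4) gS _ this] show ?thesis
    using q r' smult_in_polys_over by blast
qed

text \<open>A constant divisible by no prime is a unit, because its factorization contains no
  prime.\<close>

lemma primitive_degree_0:
  assumes f: "f \<in> Sx" "f \<noteq> 0" "primitive_over S f" "degree f = 0"
  shows "dvd_in Sx f 1"
proof -
  from f(4) obtain a where a: "f = [:a:]" by (rule degree_eq_zeroE)
  with f have aS: "a \<in> S" "a \<noteq> 0" by auto
  from factorization[OF this] obtain u ps where u: "u \<in> S" "dvd_in S u 1"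
    and ps: "\<forall>p\<in>set ps. prime_in S p" and aeq: "a = u * prod_list ps" by blast
  show ?thesis
  proof (cases ps)
    case Nil
    then obtain v where "v \<in> S" "1 = a * v" using u aeq by (auto simp: dvd_in_def)
    then show ?thesis using a by (auto simp: dvd_in_def one_pCons intro!: bexI[of _ "[:v:]"])
  next
    case (Cons p qs)
    have "set qs \<subseteq> S" using ps Cons by (auto simp: prime_in_def)
    then have "u * prod_list qs \<in> S" using u prod_list_in mult_in by auto
    moreover have "f = [:p:] * [:u * prod_list qs:]" using a aeq Cons by simp
    ultimately have "dvd_in Sx [:p:] f" unfolding dvd_in_def by fastforce
    then show ?thesis using f ps Cons by (auto simp: primitive_over_def)
  qed
qed

lemma primitive_factor:
  assumes "g * h = f" "primitive_over S f" "g \<in> Sx" "h \<in> Sx"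
  shows "primitive_over S g"
  using assms PO.dvd_in_mult unfolding primitive_over_def by blast

text \<open>The Bezout argument, carried out up to constants. The ideal of \<open>f\<close> and
  \<open>g\<close> has an element of least degree whose primitive part divides both. If this divisor
  is not constant, it is \<open>f\<close> up to a unit and \<open>f\<close> divides
  \<open>g\<close>; if it is constant, \<open>f\<close> divides \<open>h\<close>.\<close>

lemma indecomposable_prime:
  assumes f: "f \<in> Sx" "primitive_over S f" "degree f > 0"
    and ind: "\<And>g h. g \<in> Sx \<Longrightarrow> h \<in> Sx \<Longrightarrow> f = g * h \<Longrightarrow>
      degree g = 0 \<or> degree h = 0"
  shows "prime_in Sx f"
proof -
  have f0: "f \<noteq> 0" using f by auto
  have nu: "\<not> dvd_in Sx f 1"
  proof
    assume "dvd_in Sx f 1"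
    then obtain k where k: "1 = f * k" by (auto simp: dvd_in_def)
    then have "k \<noteq> 0" by auto
    then have "degree (f * k) = degree f + degree k" using f0 by (simp add: degree_mult_eq)
    then show False using f(3) k by (metis add_is_0 degree_1 neq0_conv)
  qed
  moreover have "dvd_in Sx f g \<or> dvd_in Sx f h"
    if g: "g \<in> Sx" and h: "h \<in> Sx"
      and fgh: "dvd_in Sx f (g * h)" for g h
  proof -
    define J where "J = {u * f + v * g | u v. u \<in> Sx \<and> v \<in> Sx}"
    have memJ: "u * f + v * g \<in> J" if "u \<in> Sx" "v \<in> Sx" for u v
      using that by (auto simp: J_def)
    have J: "J \<subseteq> Sx" "\<And>a b. a \<in> J \<Longrightarrow> b \<in> J \<Longrightarrow> a - b \<in> J"
      "\<And>a b. a \<in> J \<Longrightarrow> b \<in> Sx \<Longrightarrow> b * a \<in> J"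
    proof -
      show "J \<subseteq> Sx"
        unfolding J_def using f g by (auto intro!: PO.add_in PO.mult_in)
    next
      fix a b assume "a \<in> J" "b \<in> J"
      then obtain u v u' v' where *: "u \<in> Sx" "v \<in> Sx"
        "u' \<in> Sx" "v' \<in> Sx" "a = u * f + v * g" "b = u' * f + v' * g"
        unfolding J_def by blast
      then have "a - b = (u - u') * f + (v - v') * g" by (simp add: algebra_simps)
      then show "a - b \<in> J" using memJ PO.diff_in * by simp
    next
      fix a b assume "a \<in> J" "b \<in> Sx"
      then obtain u v where *: "u \<in> Sx" "v \<in> Sx" "a = u * f + v * g"
        unfolding J_def by blast
      then have "b * a = (b * u) * f + (b * v) * g" by (simp add: algebra_simps)
      then show "b * a \<in> J" using memJ PO.mult_in * \<open>b \<in> Sx\<close> by simp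
    qed
    have fJ: "f \<in> J" using memJ[of 1 0] by simp
    have gJ: "g \<in> J" using memJ[of 0 1] by simp
    obtain r where r: "r \<in> J" "r \<noteq> 0" "\<And>a. a \<in> J \<Longrightarrow> a \<noteq> 0 \<Longrightarrow> degree r \<le> degree a"
      using ex_has_least_nat[of "\<lambda>r. r \<in> J \<and> r \<noteq> 0" f degree] fJ f0 by blast
    then obtain c r' where r': "c \<in> S" "r' \<in> Sx" "r = smult c r'" "primitive_over S r'"
      using primitive_part_exists J(1) by blast
    have "dvd_in Sx r' f"
      by (rule minimal_generator[OF J r r'(3,1,2,4) fJ])
    then obtain w where w: "w \<in> Sx" "f = r' * w" by (auto simp: dvd_in_def)
    have r'g: "dvd_in Sx r' g"
      by (rule minimal_generator[OF J r r'(3,1,2,4) gJ])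
    show ?thesis
    proof (cases "degree r' = 0")
      case False
      then have "degree w = 0" using ind[OF r'(2) w] by simp
      moreover have "primitive_over S w"
        using primitive_factor[of w r' f] w r' f by (simp add: mult.commute)
      moreover have "w \<noteq> 0" using w f0 by auto
      ultimately have "dvd_in Sx w 1" using primitive_degree_0 w by blast
      then obtain z where z: "z \<in> Sx" "1 = w * z" by (auto simp: dvd_in_def)
      have "r' = f * z" using w z by (metis mult.assoc mult.right_neutral)
      then have "dvd_in Sx f r'" using z by (auto simp: dvd_in_def)
      then show ?thesis using r'g PO.dvd_in_trans by blast
    next
      case True
      then have "degree r = 0" using r' by simp
      then obtain a where a: "r = [:a:]" by (rule degree_eq_zeroE)
      then have aS: "a \<in> S" "a \<noteq> 0" using r J by auto
      obtain u v where uv: "u \<in> Sx" "v \<in> Sx" "r = u * f + v * g"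
        using r(1) unfolding J_def by blast
      obtain k where k: "k \<in> Sx" "g * h = f * k" using fgh by (auto simp: dvd_in_def)
      \<comment> \<open>The constant \<open>a = u * f + v * g\<close> is multiplied by
        \<open>h\<close>: both summands become multiples of \<open>f\<close>, and primitivity of
        \<open>f\<close> allows \<open>a\<close> to be cancelled.\<close>
      have "smult a h = r * h" using a by simp
      also have "\<dots> = u * f * h + v * (g * h)" using uv by (simp add: algebra_simps)
      also have "\<dots> = f * (u * h + v * k)" using k by (simp add: algebra_simps)
      finally have "smult a h = f * (u * h + v * k)" .
      moreover have "u * h + v * k \<in> Sx"
        using uv h k by (intro PO.add_in PO.mult_in)
      ultimately have "dvd_in Sx f h"
        using Gauss_cancel[OF aS f(1,2) h] by blast
      then show ?thesis ..
    qed
  qed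
  ultimately show ?thesis using f f0 by (auto simp: prime_in_def)
qed

text \<open>Primitivity passes to factors, so splitting by degree leaves no constants other than
  units.\<close>

lemma primitive_factorization:
  assumes "f \<in> Sx" "f \<noteq> 0" "primitive_over S f"
  shows "\<exists>u ps. u \<in> Sx \<and> dvd_in Sx u 1 \<and>
    (\<forall>p\<in>set ps. prime_in Sx p) \<and> f = u * prod_list ps"
  using assms
proof (induction "degree f" arbitrary: f rule: less_induct)
  case less
  consider "degree f = 0" | "prime_in Sx f"
    | g h where "g \<in> Sx" "h \<in> Sx" "f = g * h" "degree g > 0" "degree h > 0"
    using indecomposable_prime[OF less.prems(1,3)] by blast
  then show ?case
  proof cases
    case 1
    then show ?thesis using primitive_degree_0 less.prems
      by (intro exI[of _ f] exI[of _ "[]"]) auto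
  next
    case 2
    then show ?thesis
      by (intro exI[of _ 1] exI[of _ "[f]"]) auto
  next
    case (3 g h)
    have nz: "g \<noteq> 0" "h \<noteq> 0" using 3 less.prems by auto
    then have deg: "degree f = degree g + degree h" using 3 by (simp add: degree_mult_eq)
    have prim: "primitive_over S g" "primitive_over S h"
      using primitive_factor[of g h f] primitive_factor[of h g f] 3 less.prems
      by (auto simp: mult.commute)
    obtain u ps where u: "u \<in> Sx" "dvd_in Sx u 1"
      "\<forall>p\<in>set ps. prime_in Sx p" "g = u * prod_list ps"
      using less.hyps[OF _ 3(1) nz(1) prim(1)] deg 3 by auto
    obtain v qs where v: "v \<in> Sx" "dvd_in Sx v 1"
      "\<forall>p\<in>set qs. prime_in Sx p" "h = v * prod_list qs"
      using less.hyps[OF _ 3(2) nz(2) prim(2)] deg 3 by auto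
    obtain u' v' where inv: "u' \<in> Sx" "1 = u * u'" "v' \<in> Sx" "1 = v * v'"
      using u v by (auto simp: dvd_in_def)
    moreover have "(u * v) * (u' * v') = (u * u') * (v * v')" by (simp only: mult_ac)
    ultimately have "1 = (u * v) * (u' * v')" "u' * v' \<in> Sx"
      using PO.mult_in by (simp_all flip: inv(2,4))
    then have "dvd_in Sx (u * v) 1" by (auto simp: dvd_in_def)
    then show ?thesis using u v PO.mult_in 3
      by (intro exI[of _ "u * v"] exI[of _ "ps @ qs"]) (auto simp: mult_ac)
  qed
qed

theorem factorial_polys_over: "factorial_subring Sx"
proof
  fix f assume f: "f \<in> Sx" "f \<noteq> 0"
  then obtain c f' where c: "c \<in> S" "f' \<in> Sx" "f = smult c f'" "primitive_over S f'"
    using primitive_part_exists by blast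
  then have "c \<noteq> 0" "f' \<noteq> 0" using f by auto
  with c factorization obtain u ps where u: "u \<in> S" "dvd_in S u 1"
    "\<forall>p\<in>set ps. prime_in S p" "c = u * prod_list ps" by metis
  from primitive_factorization[OF c(2) \<open>f' \<noteq> 0\<close> c(4)] obtain v qs where
    v: "v \<in> Sx" "dvd_in Sx v 1"
      "\<forall>p\<in>set qs. prime_in Sx p" "f' = v * prod_list qs" by blast
  obtain u' v' where uv: "u' \<in> S" "1 = u * u'" "v' \<in> Sx" "1 = v * v'"
    using u v by (auto simp: dvd_in_def)
  have "([:u:] * v) * ([:u':] * v') = smult (u * u') (v * v')" by (simp add: mult_ac)
  also have "\<dots> = 1" using uv by simp
  finally have unit: "dvd_in Sx ([:u:] * v) 1"
    unfolding dvd_in_def using uv PO.mult_in[of "[:u':]" v'] by (metis const_in_polys_over)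
  have "[:prod_list ps:] = prod_list (map (\<lambda>p. [:p:]) ps)"
  proof (induction ps)
    case (Cons p ps)
    have "[:prod_list (p # ps):] = [:p:] * [:prod_list ps:]" by simp
    then show ?case unfolding Cons.IH by simp
  qed (simp add: one_pCons)
  then have "[:c:] = [:u:] * prod_list (map (\<lambda>p. [:p:]) ps)"
    using u(4) by (metis mult_to_poly)
  moreover have "f = [:c:] * f'" using c(3) by simp
  ultimately have "f = ([:u:] * prod_list (map (\<lambda>p. [:p:]) ps)) * (v * prod_list qs)"
    using v(4) by (simp only:)
  then have "f = ([:u:] * v) * prod_list (map (\<lambda>p. [:p:]) ps @ qs)"
    by (simp only: mult_ac prod_list.append)
  then show "\<exists>u ps. u \<in> Sx \<and> dvd_in Sx u 1 \<and>
      (\<forall>p\<in>set ps. prime_in Sx p) \<and> f = u * prod_list ps"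
    using unit u v prime_in_polys_over smult_in_polys_over
    by (intro exI[of _ "[:u:] * v"] exI[of _ "map (\<lambda>p. [:p:]) ps @ qs"]) auto
qed

end

text \<open>Injectivity is asked on \<open>S\<close> only: the intended map evaluates a polynomial
  at the variable \<open>t\<close>, which is injective just on polynomials whose coefficients are
  free of \<open>t\<close>.\<close>

lemma factorial_subring_image:
  assumes "factorial_subring S" "comm_ring_hom \<phi>" and inj: "inj_on \<phi> S"
  shows "factorial_subring (\<phi> ` S)"
proof -
  interpret factorial_subring S by fact
  interpret comm_ring_hom \<phi> by fact
  have dvd: "dvd_in (\<phi> ` S) (\<phi> a) (\<phi> b) \<longleftrightarrow> dvd_in S a b" if "a \<in> S" "b \<in> S" for a b
  proof
    assume "dvd_in (\<phi> ` S) (\<phi> a) (\<phi> b)"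
    then obtain k where k: "k \<in> S" "\<phi> b = \<phi> (a * k)" by (auto simp: dvd_in_def hom_mult)
    then have "b = a * k" using inj that mult_in by (auto dest: inj_onD)
    then show "dvd_in S a b" using k by (auto simp: dvd_in_def)
  qed (auto simp: dvd_in_def hom_mult)
  have prime: "prime_in (\<phi> ` S) (\<phi> p)" if p: "prime_in S p" for p
  proof -
    have pS: "p \<in> S" using p by (simp add: prime_in_def)
    have "\<phi> p \<noteq> 0" using p inj_onD[OF inj, of p 0] pS by (auto simp: prime_in_def)
    moreover have "\<not> dvd_in (\<phi> ` S) (\<phi> p) 1"
      using dvd[OF pS one_in] p by (simp add: prime_in_def)
    moreover have "dvd_in (\<phi> ` S) (\<phi> p) (\<phi> a) \<or> dvd_in (\<phi> ` S) (\<phi> p) (\<phi> b)"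
      if "a \<in> S" "b \<in> S" "dvd_in (\<phi> ` S) (\<phi> p) (\<phi> a * \<phi> b)" for a b
      using that p pS dvd[OF pS, of "a * b"] dvd[OF pS, of a] dvd[OF pS, of b] mult_in
      by (auto simp: prime_in_def hom_mult)
    ultimately show ?thesis using pS by (auto simp: prime_in_def)
  qed
  show ?thesis
  proof
    show "1 \<in> \<phi> ` S" using one_in by (metis hom_one imageI)
    show "a - b \<in> \<phi> ` S" if "a \<in> \<phi> ` S" "b \<in> \<phi> ` S" for a b
      using that diff_in by (auto simp: hom_minus[symmetric])
    show "a * b \<in> \<phi> ` S" if "a \<in> \<phi> ` S" "b \<in> \<phi> ` S" for a b
      using that mult_in by (auto simp: hom_mult[symmetric])
    fix a assume "a \<in> \<phi> ` S" "a \<noteq> 0"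
    then obtain b where b: "b \<in> S" "a = \<phi> b" "b \<noteq> 0" by (metis hom_zero imageE)
    with factorization obtain u ps where u: "u \<in> S" "dvd_in S u 1"
      "\<forall>p\<in>set ps. prime_in S p" "b = u * prod_list ps" by metis
    have "\<phi> (prod_list ps) = prod_list (map \<phi> ps)" by (induction ps) (auto simp: hom_mult)
    then show "\<exists>u ps. u \<in> \<phi> ` S \<and> dvd_in (\<phi> ` S) u 1 \<and>
      (\<forall>p\<in>set ps. prime_in (\<phi> ` S) p) \<and> a = u * prod_list ps"
      using u b prime dvd[OF u(1) one_in]
      by (intro exI[of _ "\<phi> u"] exI[of _ "map \<phi> ps"]) (auto simp: hom_mult)
  qed
qed

lemma factorial_subring_int: "factorial_subring (UNIV :: int set)"
proof
  fix a :: int assume a: "a \<noteq> 0"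
  have dvd: "dvd_in UNIV x y \<longleftrightarrow> x dvd y" for x y :: int
    by (auto simp: dvd_in_def dvd_def)
  have prime: "prime_in UNIV p" if "prime p" for p :: int
    using that prime_dvd_mult_iff[of p] by (auto simp: prime_in_def dvd)
  obtain ps where ps: "mset ps = prime_factorization a" using ex_mset by blast
  have "prod_list ps = normalize a"
    using a by (simp add: prod_mset_prod_list[symmetric] ps prod_mset_prime_factorization)
  then have "a = unit_factor a * prod_list ps" by (simp only: unit_factor_mult_normalize)
  moreover have "unit_factor a dvd 1" using a by simp
  moreover have "\<forall>p\<in>set ps. prime_in UNIV p"
    using ps prime by (metis in_prime_factors_imp_prime set_mset_mset)
  ultimately show "\<exists>u ps. u \<in> UNIV \<and> dvd_in UNIV u 1 \<and> (\<forall>p\<in>set ps. prime_in UNIV p) \<and> a = u * prod_list ps"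
    using dvd by blast
qed auto

section \<open>Evaluation of multivariate polynomials\<close>

definition mono_eval :: "('v \<Rightarrow> 'b::comm_ring_1) \<Rightarrow> 'v monomial \<Rightarrow> 'b" where
  "mono_eval x \<alpha> = (\<Prod>v\<in>keys \<alpha>. x v ^ lookup \<alpha> v)"

text \<open>The separate map \<open>h\<close> on coefficients lets integer polynomials be evaluated
  in the complex numbers, in univariate polynomials and in the multivariate polynomial ring
  itself.\<close>

definition insertion ::
    "('a::comm_ring_1 \<Rightarrow> 'b::comm_ring_1) \<Rightarrow> ('v \<Rightarrow> 'b) \<Rightarrow> ('v, 'a) mpoly \<Rightarrow> 'b" where
  "insertion h x p = (\<Sum>\<alpha>\<in>keys p. h (lookup p \<alpha>) * mono_eval x \<alpha>)"

lemma mpoly_eval_conv_insertion: "mpoly_eval x p = insertion (\<lambda>a. a) x p"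
  by (simp add: mpoly_eval_def insertion_def mono_eval_def)

lemma coeff_eval_conv_insertion:
  "coeff_eval R f = insertion of_int (\<lambda>v. lookup (f (fst v)) (snd v)) R"
  by (simp add: coeff_eval_alt insertion_def mono_eval_def)

lemma mono_eval_superset:
  "finite V \<Longrightarrow> keys \<alpha> \<subseteq> V \<Longrightarrow> mono_eval x \<alpha> = (\<Prod>v\<in>V. x v ^ lookup \<alpha> v)"
  unfolding mono_eval_def by (rule prod.mono_neutral_left) (auto simp: in_keys_iff)

lemma mono_eval_0 [simp]: "mono_eval x 0 = 1"
  by (simp add: mono_eval_def)

lemma mono_eval_single [simp]: "mono_eval x (single v k) = x v ^ k"
  by (cases "k = 0") (simp_all add: mono_eval_def)

lemma mono_eval_add: "mono_eval x (\<alpha> + \<beta>) = mono_eval x \<alpha> * mono_eval x \<beta>"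
proof -
  let ?V = "keys \<alpha> \<union> keys \<beta>"
  have "mono_eval x \<gamma> = (\<Prod>v\<in>?V. x v ^ lookup \<gamma> v)"
    if "keys \<gamma> \<subseteq> ?V" for \<gamma>
    using that by (intro mono_eval_superset) auto
  from this[of "\<alpha> + \<beta>"] this[of \<alpha>] this[of \<beta>] show ?thesis
    using keys_add[of \<alpha> \<beta>] by (simp add: lookup_add power_add prod.distrib)
qed

lemma mpoly_as_sum:
  "p = (\<Sum>\<alpha>\<in>keys p. single \<alpha> (lookup p \<alpha>))"
  by (rule poly_mapping_eqI)
     (auto simp: lookup_sum lookup_single when_def in_keys_iff sum.delta)

context comm_ring_hom
begin

lemma insertion_superset:
  "finite M \<Longrightarrow> keys p \<subseteq> M \<Longrightarrow>
    insertion hom x p = (\<Sum>\<alpha>\<in>M. hom (lookup p \<alpha>) * mono_eval x \<alpha>)"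
  unfolding insertion_def by (rule sum.mono_neutral_left) (auto simp: in_keys_iff)

lemma insertion_single: "insertion hom x (single \<alpha> a) = hom a * mono_eval x \<alpha>"
  by (cases "a = 0") (simp_all add: insertion_def)

lemma insertion_add: "insertion hom x (p + q) = insertion hom x p + insertion hom x q"
proof -
  let ?M = "keys p \<union> keys q"
  have "insertion hom x r = (\<Sum>\<alpha>\<in>?M. hom (lookup r \<alpha>) * mono_eval x \<alpha>)"
    if "keys r \<subseteq> ?M" for r
    using that by (intro insertion_superset) auto
  from this[of "p + q"] this[of p] this[of q] show ?thesis
    using keys_add[of p q] by (simp add: lookup_add hom_add distrib_right sum.distrib)
qed

lemma insertion_0 [simp]: "insertion hom x 0 = 0"
  by (simp add: insertion_def)

lemma insertion_sum: "insertion hom x (sum f I) = (\<Sum>i\<in>I. insertion hom x (f i))"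
  by (induction I rule: infinite_finite_induct) (simp_all add: insertion_add)

lemma insertion_mult: "insertion hom x (p * q) = insertion hom x p * insertion hom x q"
proof -
  let ?t = "\<lambda>p \<alpha>. single \<alpha> (lookup p \<alpha>)"
  have "p * q = (\<Sum>\<alpha>\<in>keys p. ?t p \<alpha>) * (\<Sum>\<beta>\<in>keys q. ?t q \<beta>)"
    using mpoly_as_sum[of p] mpoly_as_sum[of q] by simp
  also have "\<dots> = (\<Sum>\<alpha>\<in>keys p. \<Sum>\<beta>\<in>keys q.
      single (\<alpha> + \<beta>) (lookup p \<alpha> * lookup q \<beta>))"
    by (simp add: sum_product Poly_Mapping.mult_single)
  finally show ?thesis
    by (simp add: insertion_sum insertion_single insertion_def[of _ _ p] insertion_def[of _ _ q]
        sum_product hom_mult mono_eval_add mult_ac)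
qed

lemma comm_ring_hom_insertion: "comm_ring_hom (insertion hom x)"
  by unfold_locales
     (simp_all add: insertion_add insertion_mult insertion_single flip: single_one)

lemma insertion_const [simp]: "insertion hom x (mpoly_const a) = hom a"
  by (simp add: mpoly_const_def insertion_single)

lemma insertion_var [simp]: "insertion hom x (mpoly_var v) = x v"
  by (simp add: mpoly_var_def insertion_single)

lemma insertion_cong:
  "(\<And>v. v \<in> mpoly_vars p \<Longrightarrow> x v = y v) \<Longrightarrow> insertion hom x p = insertion hom y p"
  unfolding insertion_def mono_eval_def mpoly_vars_def
  by (intro sum.cong prod.cong arg_cong2[where f = "(*)"] arg_cong2[where f = "(^)"] refl) blast

end

lemma comm_ring_hom_id: "comm_ring_hom (\<lambda>a. a)"
  by unfold_locales auto

lemma hom_mono_eval: "comm_ring_hom g \<Longrightarrow> g (mono_eval x \<alpha>) = mono_eval (\<lambda>v. g (x v)) \<alpha>"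
proof -
  assume "comm_ring_hom g"
  then interpret comm_ring_hom g .
  show ?thesis by (simp add: mono_eval_def hom_prod hom_power)
qed

lemma hom_insertion:
  "comm_ring_hom g \<Longrightarrow> g (insertion h x p) = insertion (\<lambda>a. g (h a)) (\<lambda>v. g (x v)) p"
proof -
  assume g: "comm_ring_hom g"
  then interpret comm_ring_hom g .
  show ?thesis by (simp add: insertion_def hom_sum hom_mult hom_mono_eval[OF g])
qed

lemma comm_ring_hom_of_int: "comm_ring_hom (of_int :: int \<Rightarrow> 'a::comm_ring_1)"
  by unfold_locales auto

interpretation ins_int: comm_ring_hom "insertion (of_int :: int \<Rightarrow> 'a::comm_ring_1) x" for x
  by (rule comm_ring_hom.comm_ring_hom_insertion[OF comm_ring_hom_of_int])

interpretation ins_id: comm_ring_hom "insertion (\<lambda>a::'a::comm_ring_1. a) x" for x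
  by (rule comm_ring_hom.comm_ring_hom_insertion[OF comm_ring_hom_id])

abbreviation ieval :: "('v \<Rightarrow> 'b::comm_ring_1) \<Rightarrow> ('v, int) mpoly \<Rightarrow> 'b" where
  "ieval \<equiv> insertion of_int"

lemmas insertion_of_int_cong = comm_ring_hom.insertion_cong[OF comm_ring_hom_of_int]
lemmas insertion_of_int_const [simp] = comm_ring_hom.insertion_const[OF comm_ring_hom_of_int]
lemmas insertion_of_int_var [simp] = comm_ring_hom.insertion_var[OF comm_ring_hom_of_int]
lemmas insertion_id_const [simp] = comm_ring_hom.insertion_const[OF comm_ring_hom_id]
lemmas insertion_id_var [simp] = comm_ring_hom.insertion_var[OF comm_ring_hom_id]

lemma hom_insertion_of_int:
  assumes g: "comm_ring_hom g"
  shows "g (ieval x p) = ieval (\<lambda>v. g (x v)) p"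
proof -
  interpret comm_ring_hom g by fact
  show ?thesis by (simp add: hom_insertion[OF g] hom_of_int)
qed

lemma comm_ring_hom_const: "comm_ring_hom (mpoly_const :: 'a::comm_ring_1 \<Rightarrow> ('v, 'a) mpoly)"
  by unfold_locales (simp_all add: mpoly_const_def single_add Poly_Mapping.mult_single)

interpretation mconst: comm_ring_hom "mpoly_const :: 'a::comm_ring_1 \<Rightarrow> ('v, 'a) mpoly"
  by (rule comm_ring_hom_const)

lemma mono_eval_var: "mono_eval mpoly_var \<alpha> = (single \<alpha> 1 :: ('v, 'a::comm_ring_1) mpoly)"
proof -
  have pow: "(mpoly_var v :: ('v, 'a) mpoly) ^ k = single (single v k) 1" for v k
    by (induction k) (simp_all add: mpoly_var_def Poly_Mapping.mult_single flip: single_add)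
  have prod: "(\<Prod>v\<in>V. single (g v) 1 :: ('v, 'a) mpoly) = single (\<Sum>v\<in>V. g v) 1"
    if "finite V" for V :: "'v set" and g
    using that by (induction V) (simp_all add: Poly_Mapping.mult_single)
  show ?thesis
    by (simp add: mono_eval_def pow prod flip: mpoly_as_sum)
qed

lemma insertion_const_var [simp]: "insertion mpoly_const mpoly_var p = p"
proof -
  have "insertion mpoly_const mpoly_var p =
      (\<Sum>\<alpha>\<in>keys p. single \<alpha> (lookup p \<alpha>))"
    by (simp add: insertion_def mono_eval_var mpoly_const_def Poly_Mapping.mult_single)
  then show ?thesis by (simp flip: mpoly_as_sum)
qed

section \<open>Polynomials in a given set of variables\<close>

definition polys_in :: "'v set \<Rightarrow> ('v, 'a::zero) mpoly set" where
  "polys_in X = {p. mpoly_vars p \<subseteq> X}"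

lemma const_in_polys_in [simp]: "mpoly_const a \<in> polys_in X"
  by (auto simp: polys_in_def mpoly_vars_def mpoly_const_def)

lemma one_in_polys_in [simp]: "1 \<in> polys_in X"
  by (auto simp: polys_in_def mpoly_vars_def)

lemma var_in_polys_in: "v \<in> X \<Longrightarrow> mpoly_var v \<in> polys_in X"
  by (auto simp: polys_in_def mpoly_vars_def mpoly_var_def)

lemma add_in_polys_in:
  "p \<in> polys_in X \<Longrightarrow> q \<in> polys_in X \<Longrightarrow> p + q \<in> polys_in X" for p q :: "('v, 'a::comm_ring_1) mpoly"
  unfolding polys_in_def mpoly_vars_def using keys_add[of p q] by blast

lemma mult_in_polys_in:
  fixes p q :: "('v, 'a::comm_ring_1) mpoly"
  assumes "p \<in> polys_in X" "q \<in> polys_in X"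
  shows "p * q \<in> polys_in X"
proof -
  have "keys \<gamma> \<subseteq> X" if "\<gamma> \<in> keys (p * q)" for \<gamma>
  proof -
    from that keys_mult[of p q] obtain \<alpha> \<beta> where *: "\<gamma> = \<alpha> + \<beta>" "\<alpha> \<in> keys p"
      "\<beta> \<in> keys q" by blast
    then have "keys \<alpha> \<subseteq> X" "keys \<beta> \<subseteq> X"
      using assms unfolding polys_in_def mpoly_vars_def by blast+
    then show ?thesis using keys_add[of \<alpha> \<beta>] unfolding *(1) by blast
  qed
  then show ?thesis by (auto simp: polys_in_def mpoly_vars_def)
qed

lemma polys_in_mono: "X \<subseteq> Y \<Longrightarrow> polys_in X \<subseteq> polys_in Y"
  by (auto simp: polys_in_def)

lemma polys_in_UNIV [simp]: "polys_in UNIV = UNIV"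
  by (auto simp: polys_in_def)

lemma finite_mpoly_vars [simp]: "finite (mpoly_vars p)"
  by (simp add: mpoly_vars_def)

lemma polys_in_induct [consumes 1, case_names const var add mult]:
  fixes p :: "('v, 'a::comm_ring_1) mpoly"
  assumes "p \<in> polys_in X"
    and const: "\<And>a. P (mpoly_const a)"
    and var: "\<And>v. v \<in> X \<Longrightarrow> P (mpoly_var v)"
    and add: "\<And>p q. P p \<Longrightarrow> P q \<Longrightarrow> P (p + q)"
    and mult: "\<And>p q. P p \<Longrightarrow> P q \<Longrightarrow> P (p * q)"
  shows "P p"
proof -
  have 0: "P 0" and 1: "P 1" using const[of 0] const[of 1] by simp_all
  have sum: "P (sum f I)" if "\<And>i. i \<in> I \<Longrightarrow> P (f i)" for f :: "'v monomial \<Rightarrow> _" and I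
    using that by (induction I rule: infinite_finite_induct) (auto intro: add 0)
  have prod: "P (prod f I)" if "\<And>i. i \<in> I \<Longrightarrow> P (f i)" for f :: "'v \<Rightarrow> _" and I
    using that by (induction I rule: infinite_finite_induct) (auto intro: mult 1)
  have power: "P (q ^ k)" if "P q" for q k
    using that by (induction k) (auto intro: mult 1)
  \<comment> \<open>Substituting each variable for itself reproduces \<open>p\<close>, now visibly
    built by ring operations from constants and variables.\<close>
  have "P (insertion mpoly_const mpoly_var p)"
    unfolding insertion_def mono_eval_def
    using assms(1) by (intro sum mult const prod power var) (auto simp: polys_in_def mpoly_vars_def)
  then show ?thesis by simp
qed

lemma polys_in_empty:
  assumes "p \<in> polys_in {}"
  obtains a where "p = mpoly_const (a::'a::comm_ring_1)"
proof -
  from assms have "\<exists>a. p = mpoly_const a"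
  proof (induction rule: polys_in_induct)
    case (add p q)
    then show ?case by (metis mconst.hom_add)
  next
    case (mult p q)
    then show ?case by (metis mconst.hom_mult)
  qed auto
  with that show ?thesis by blast
qed

lemma dom_subring_polys_in:
  "dom_subring (polys_in X :: ('v::linorder, 'a::idom) mpoly set)"
proof
  show "1 \<in> polys_in X"
    by simp
  show "a - b \<in> polys_in X" if "a \<in> polys_in X" "b \<in> polys_in X" for a b :: "('v, 'a) mpoly"
    using add_in_polys_in[OF that(1) mult_in_polys_in[OF const_in_polys_in[of "- 1"] that(2)]]
    by (simp add: mconst.hom_uminus)
qed (rule mult_in_polys_in)

lemma insertion_in_dom_subring:
  assumes "dom_subring S" "comm_ring_hom h" "\<And>a. h a \<in> S" "\<And>v. v \<in> mpoly_vars p \<Longrightarrow> x v \<in> S"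
  shows "insertion h x p \<in> S"
proof -
  interpret dom_subring S by fact
  interpret comm_ring_hom h by fact
  have "p \<in> polys_in (mpoly_vars p)" by (simp add: polys_in_def)
  then show ?thesis
  proof (induction p rule: polys_in_induct)
  qed (use assms(3,4) in \<open>auto simp: insertion_add insertion_mult intro: add_in mult_in\<close>)
qed

text \<open>The coefficients stay in the same multivariate type and merely lose \<open>t\<close>, so
  evaluation at \<open>mpoly_var t\<close> undoes the passage.\<close>

definition as_poly :: "'v \<Rightarrow> ('v, 'a::comm_ring_1) mpoly \<Rightarrow> ('v, 'a) mpoly poly" where
  "as_poly t = insertion (\<lambda>a. [:mpoly_const a:]) (\<lambda>v. if v = t then [:0, 1:] else [:mpoly_var v:])"

lemma comm_ring_hom_pCons0: "comm_ring_hom (\<lambda>a::'a::comm_ring_1. [:a:])"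
  by unfold_locales (auto simp: one_pCons)

lemma comm_ring_hom_comp: "comm_ring_hom f \<Longrightarrow> comm_ring_hom g \<Longrightarrow> comm_ring_hom (\<lambda>a. f (g a))"
proof -
  assume "comm_ring_hom f" "comm_ring_hom g"
  then interpret f: comm_ring_hom f + g: comm_ring_hom g .
  show ?thesis by unfold_locales (simp_all add: f.hom_add g.hom_add f.hom_mult g.hom_mult)
qed

lemma comm_ring_hom_const_poly:
  "comm_ring_hom (\<lambda>a. [:mpoly_const a :: ('v, 'a::comm_ring_1) mpoly:])"
  by (rule comm_ring_hom_comp[OF comm_ring_hom_pCons0 comm_ring_hom_const])

interpretation as_poly: comm_ring_hom "as_poly t :: ('v, 'a::comm_ring_1) mpoly \<Rightarrow> _" for t
  unfolding as_poly_def by (rule comm_ring_hom.comm_ring_hom_insertion[OF comm_ring_hom_const_poly])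

lemma as_poly_const [simp]: "as_poly t (mpoly_const a) = [:mpoly_const a:]"
  by (simp add: as_poly_def comm_ring_hom.insertion_const[OF comm_ring_hom_const_poly])

lemma as_poly_var [simp]: "as_poly t (mpoly_var v) = (if v = t then [:0, 1:] else [:mpoly_var v:])"
  by (simp add: as_poly_def comm_ring_hom.insertion_var[OF comm_ring_hom_const_poly])

lemma comm_ring_hom_poly: "comm_ring_hom (\<lambda>q. poly q (a::'a::comm_ring_1))"
  by unfold_locales auto

lemma poly_as_poly [simp]: "poly (as_poly t p) (mpoly_var t) = p"
proof -
  have "poly (as_poly t p) (mpoly_var t) = insertion mpoly_const mpoly_var p"
    unfolding as_poly_def hom_insertion[OF comm_ring_hom_poly]
    by (intro arg_cong2[where f = "\<lambda>h x. insertion h x p"] ext) auto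
  then show ?thesis by simp
qed

lemma as_poly_constant:
  assumes "t \<notin> mpoly_vars p"
  shows "as_poly t p = [:p:]"
proof -
  have "as_poly t p = insertion (\<lambda>a. [:mpoly_const a:]) (\<lambda>v. [:mpoly_var v:]) p"
    unfolding as_poly_def using assms
    by (intro comm_ring_hom.insertion_cong[OF comm_ring_hom_const_poly]) auto
  also have "\<dots> = [:p:]"
    by (simp flip: hom_insertion[OF comm_ring_hom_pCons0])
  finally show ?thesis .
qed

lemma as_poly_poly:
  assumes q: "q \<in> polys_over (polys_in X)" and t: "t \<notin> X"
  shows "as_poly t (poly q (mpoly_var t)) = (q :: ('v::linorder, 'a::idom) mpoly poly)"
proof -
  have c: "as_poly t (coeff q i) = [:coeff q i:]" for i
    using q t by (intro as_poly_constant) (auto simp: polys_over_def polys_in_def)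
  have "as_poly t (poly q (mpoly_var t)) = (\<Sum>i\<le>degree q. [:coeff q i:] * [:0, 1:] ^ i)"
    by (simp add: poly_altdef as_poly.hom_sum as_poly.hom_mult as_poly.hom_power c)
  also have "\<dots> = (\<Sum>i\<le>degree q. monom (coeff q i) i)"
    by (simp add: monom_altdef)
  finally show ?thesis by (simp add: poly_as_sum_of_monoms)
qed

lemma as_poly_in:
  assumes "p \<in> polys_in (insert t X)"
  shows "as_poly t p \<in> polys_over (polys_in X :: ('v::linorder, 'a::idom) mpoly set)"
proof -
  interpret dom_subring "polys_in X :: ('v, 'a) mpoly set" by (rule dom_subring_polys_in)
  interpret PO: dom_subring "polys_over (polys_in X :: ('v, 'a) mpoly set)"
    by (rule subring_polys_over)
  have "[:0, 1:] \<in> polys_over (polys_in X :: ('v, 'a) mpoly set)"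
    using monom_in_polys_over[of 1 1] by (simp add: monom_altdef)
  then show ?thesis
    unfolding as_poly_def using assms
    by (intro insertion_in_dom_subring[OF PO.dom_subring_axioms comm_ring_hom_const_poly])
       (auto simp: polys_in_def[of "insert t X"] intro: var_in_polys_in)
qed

lemma poly_var_in:
  assumes "q \<in> polys_over (polys_in X :: ('v::linorder, 'a::idom) mpoly set)"
  shows "poly q (mpoly_var t) \<in> polys_in (insert t X)"
proof -
  interpret dom_subring "polys_in (insert t X) :: ('v, 'a) mpoly set" by (rule dom_subring_polys_in)
  show ?thesis
    unfolding poly_altdef using assms polys_in_mono[of X "insert t X"]
    by (intro sum_in mult_in power_in var_in_polys_in) (auto simp: polys_over_def)
qed

lemma factorial_polys_in_insert:
  assumes "factorial_subring (polys_in X :: ('v::linorder, 'a::idom) mpoly set)" "t \<notin> X"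
  shows "factorial_subring (polys_in (insert t X) :: ('v, 'a) mpoly set)"
proof -
  let ?P = "polys_over (polys_in X :: ('v, 'a) mpoly set)"
  have "(\<lambda>q. poly q (mpoly_var t)) ` ?P = polys_in (insert t X)"
    using as_poly_in poly_var_in poly_as_poly by (auto intro!: image_eqI[where x = "as_poly t _"])
  moreover have "inj_on (\<lambda>q. poly q (mpoly_var t)) ?P"
    by (rule inj_on_inverseI[where g = "as_poly t"]) (rule as_poly_poly[OF _ assms(2)])
  ultimately show ?thesis
    using factorial_subring_image[OF factorial_subring.factorial_polys_over[OF assms(1)] comm_ring_hom_poly]
    by metis
qed

theorem factorial_polys_in:
  assumes "finite X"
  shows "factorial_subring (polys_in X :: ('v::linorder, int) mpoly set)"
  using assms
proof induction
  case empty
  have "range mpoly_const = (polys_in {} :: ('v, int) mpoly set)"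
  proof (intro equalityI subsetI)
    fix p :: "('v, int) mpoly" assume "p \<in> polys_in {}"
    then show "p \<in> range mpoly_const"
      by (rule polys_in_empty) blast
  qed auto
  moreover have "inj (mpoly_const :: int \<Rightarrow> ('v, int) mpoly)"
    unfolding mpoly_const_def by (rule injI) (metis lookup_single_eq)
  ultimately show ?case
    using factorial_subring_image[OF factorial_subring_int comm_ring_hom_const] by metis
qed (rule factorial_polys_in_insert)

text \<open>Degrees in a single variable add over a domain, so a variable missing from a nonzero
  product is missing from each factor.\<close>

lemma factor_vars:
  fixes p q :: "('v::linorder, 'a::idom) mpoly"
  assumes "p * q \<in> polys_in X" "p * q \<noteq> 0"
  shows "p \<in> polys_in X"
proof -
  have "t \<notin> mpoly_vars p" if t: "t \<notin> X" for t
  proof -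
    have "t \<notin> mpoly_vars (p * q)" using assms(1) t by (auto simp: polys_in_def)
    then have eq: "as_poly t p * as_poly t q = [:p * q:]"
      by (simp add: as_poly_constant flip: as_poly.hom_mult)
    then have "degree (as_poly t p * as_poly t q) = 0" by simp
    moreover have "as_poly t p \<noteq> 0" "as_poly t q \<noteq> 0"
      using eq assms(2) by auto
    ultimately have "degree (as_poly t p) = 0" by (simp add: degree_mult_eq)
    then obtain c where c: "as_poly t p = [:c:]" by (rule degree_eq_zeroE)
    have "as_poly t p \<in> polys_over (polys_in (- {t}))"
      by (rule as_poly_in) (auto simp: polys_in_def)
    then have "coeff (as_poly t p) 0 \<in> polys_in (- {t})" unfolding polys_over_def by blast
    moreover have "poly (as_poly t p) (mpoly_var t) = coeff (as_poly t p) 0" by (simp add: c)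
    ultimately have "p \<in> polys_in (- {t})" by simp
    then show ?thesis by (auto simp: polys_in_def)
  qed
  then show ?thesis by (auto simp: polys_in_def)
qed

lemma unit_mpoly_int:
  fixes p :: "('v::linorder, int) mpoly"
  assumes "p dvd 1"
  shows "p = 1 \<or> p = - 1"
proof -
  have const: "\<exists>a. u = mpoly_const a" if u: "u * w = 1" for u w :: "('v, int) mpoly"
  proof -
    have "u \<in> polys_in {}"
      by (rule factor_vars[where q = w]) (simp_all add: u)
    then show ?thesis
      by (rule polys_in_empty) blast
  qed
  from assms obtain q where q: "p * q = 1" by (metis dvd_def)
  then obtain a b where ab: "p = mpoly_const a" "q = mpoly_const b"
    using const[of p q] const[of q p] by (auto simp: mult.commute)
  then have "mpoly_const (a * b) = (mpoly_const 1 :: ('v, int) mpoly)" using q by (simp add: mconst.hom_mult)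
  then have "a * b = 1" unfolding mpoly_const_def by (metis lookup_single_eq)
  then have "a = 1 \<or> a = - 1" by (auto dest: zmult_eq_1_iff[THEN iffD1])
  then show ?thesis using ab by (auto simp: mconst.hom_uminus)
qed

text \<open>Induction on the variables: the leading coefficient in \<open>t\<close> is nonzero at
  some point, and the univariate polynomial obtained there has finitely many roots.\<close>

lemma mpoly_nonvanishing_point:
  fixes p :: "('v::linorder, int) mpoly"
  assumes "p \<noteq> 0"
  shows "\<exists>x :: 'v \<Rightarrow> complex. ieval x p \<noteq> 0"
proof -
  have "\<exists>x :: 'v \<Rightarrow> complex. ieval x p \<noteq> 0"
    if "finite X" "p \<in> polys_in X" "p \<noteq> 0" for X and p :: "('v, int) mpoly"
    using that
  proof (induction X arbitrary: p)
    case empty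
    then obtain a where "p = mpoly_const a" by (blast elim: polys_in_empty)
    with empty show ?case by auto
  next
    case (insert t X)
    define q where "q = as_poly t p"
    have q: "q \<in> polys_over (polys_in X)" "poly q (mpoly_var t) = p"
      using as_poly_in insert by (auto simp: q_def)
    then have "q \<noteq> 0" using insert by auto
    then have "lead_coeff q \<noteq> 0" "lead_coeff q \<in> polys_in X" using q by (auto simp: polys_over_def)
    from insert.IH[OF this(2,1)] obtain x :: "'v \<Rightarrow> complex"
      where x: "ieval x (lead_coeff q) \<noteq> 0" by blast
    define r where "r = map_poly (ieval x) q"
    have r_coeff: "coeff r i = ieval x (coeff q i)" for i
      by (simp add: r_def coeff_map_poly)
    have "coeff r (degree q) \<noteq> 0" using x by (simp add: r_coeff)
    then have "r \<noteq> 0" by auto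
    then have "finite {s. poly r s = 0}" by (rule poly_roots_finite)
    then obtain s where s: "poly r s \<noteq> 0"
      using infinite_UNIV_char_0[where 'a = complex] by (metis (mono_tags) UNIV_I finite_subset mem_Collect_eq subsetI)
    define y where "y = x(t := s)"
    have "ieval y (coeff q i) = ieval x (coeff q i)" for i
      using q(1) insert(2) by (intro insertion_of_int_cong) (auto simp: y_def polys_over_def polys_in_def)
    then have "ieval y p = (\<Sum>i\<le>degree q. ieval x (coeff q i) * s ^ i)"
      by (subst q(2)[symmetric])
         (simp add: poly_altdef ins_int.hom_sum ins_int.hom_mult ins_int.hom_power, simp add: y_def)
    also have "\<dots> = (\<Sum>i\<le>degree r. coeff r i * s ^ i)"
    proof (rule sum.mono_neutral_cong_right)
      have "degree r \<le> degree q"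
        by (rule degree_le) (auto simp: r_coeff coeff_eq_0)
      then show "{..degree r} \<subseteq> {..degree q}" by auto
    qed (auto simp: r_coeff[symmetric] intro: le_degree)
    also have "\<dots> = poly r s" by (simp add: poly_altdef)
    finally show ?case using s by metis
  qed
  from this[of "mpoly_vars p" p] assms show ?thesis by (simp add: polys_in_def)
qed

section \<open>Systems of forms and their common zeros\<close>

lemma sum_keys_lookup:
  fixes \<alpha> :: "'v monomial"
  assumes "finite V" "keys \<alpha> \<subseteq> V"
  shows "(\<Sum>v\<in>keys \<alpha>. lookup \<alpha> v) = (\<Sum>v\<in>V. lookup \<alpha> v)"
  using assms by (intro sum.mono_neutral_left) (auto simp: in_keys_iff)

lemma monomials_of_degree_iff:
  "\<alpha> \<in> monomials_of_degree n e \<longleftrightarrow>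
    keys \<alpha> \<subseteq> {..<n} \<and> (\<Sum>v<n. lookup \<alpha> v) = e"
  using sum_keys_lookup[of "{..<n}" \<alpha>] by (auto simp: monomials_of_degree_def)

lemma finite_monomials_of_degree [simp]: "finite (monomials_of_degree n e)"
proof -
  have "\<alpha> \<in> (\<lambda>g. \<Sum>v<n. single v (g v)) ` PiE {..<n} (\<lambda>_. {..e})"
    if "\<alpha> \<in> monomials_of_degree n e" for \<alpha>
  proof
    let ?g = "restrict (lookup \<alpha>) {..<n}"
    from that have \<alpha>: "keys \<alpha> \<subseteq> {..<n}" "(\<Sum>v<n. lookup \<alpha> v) = e"
      by (auto simp: monomials_of_degree_iff)
    show "\<alpha> = (\<Sum>v<n. single v (?g v))"
      using \<alpha>(1) by (intro poly_mapping_eqI)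
        (auto simp: lookup_sum lookup_single when_def sum.delta not_in_keys_iff_lookup_eq_zero[symmetric])
    show "?g \<in> PiE {..<n} (\<lambda>_. {..e})"
      using \<alpha>(2) member_le_sum[of _ "{..<n}" "lookup \<alpha>"] by auto
  qed
  then have "monomials_of_degree n e \<subseteq> (\<lambda>g. \<Sum>v<n. single v (g v)) ` PiE {..<n} (\<lambda>_. {..e})"
    by blast
  then show ?thesis by (rule finite_subset) (auto intro: finite_PiE)
qed

lemma monomials_of_degree_add:
  "\<alpha> \<in> monomials_of_degree n a \<Longrightarrow> \<beta> \<in> monomials_of_degree n b \<Longrightarrow>
    \<alpha> + \<beta> \<in> monomials_of_degree n (a + b)"
  using keys_add[of \<alpha> \<beta>] by (auto simp: monomials_of_degree_iff lookup_add sum.distrib)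

lemma single_in_monomials_of_degree [simp]:
  "j < n \<Longrightarrow> single j e \<in> monomials_of_degree n e"
  by (cases "e = 0") (simp_all add: monomials_of_degree_def)

lemma mono_eval_scale:
  assumes "\<alpha> \<in> monomials_of_degree n e"
  shows "mono_eval (\<lambda>v. s * x v) \<alpha> = s ^ e * mono_eval x \<alpha>"
proof -
  have "mono_eval (\<lambda>v. s * x v) \<alpha> = (\<Prod>v<n. s ^ lookup \<alpha> v * x v ^ lookup \<alpha> v)"
    using assms by (subst mono_eval_superset[of "{..<n}"])
      (auto simp: monomials_of_degree_iff power_mult_distrib)
  also have "\<dots> = s ^ e * mono_eval x \<alpha>"
    using assms by (subst mono_eval_superset[of "{..<n}"])
      (auto simp: monomials_of_degree_iff prod.distrib power_sum[symmetric])
  finally show ?thesis .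
qed

lemma homogeneous_mult:
  "homogeneous n a p \<Longrightarrow> homogeneous n b q \<Longrightarrow> homogeneous n (a + b) (p * q)"
  using keys_mult[of p q] monomials_of_degree_add by (fastforce simp: homogeneous_def)

lemma homogeneous_power:
  "homogeneous n a p \<Longrightarrow> homogeneous n (a * k) (p ^ k)" for p :: "(nat, 'a::comm_ring_1) mpoly"
proof (induction k)
  case 0
  show ?case by (auto simp: homogeneous_def monomials_of_degree_def)
qed (auto dest: homogeneous_mult simp: algebra_simps)

text \<open>Supplies the coefficients of the power of a linear form, with which the path in
  \<open>vanishing_prime\<close> is corrected.\<close>

lemma linear_form_power:
  fixes a b :: complex
  assumes "j < n" "k < n"
  shows "\<exists>L. \<forall>z. (\<Sum>\<alpha>\<in>monomials_of_degree n e. L \<alpha> * mono_eval z \<alpha>) = (a * z j + b * z k) ^ e"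
proof -
  define q :: "(nat, complex) mpoly" where
    "q = mpoly_const a * mpoly_var j + mpoly_const b * mpoly_var k"
  have "homogeneous n 1 q"
    using assms keys_add[of "mpoly_const a * mpoly_var j" "mpoly_const b * mpoly_var k :: (nat, complex) mpoly"]
    by (fastforce simp: homogeneous_def q_def mpoly_const_def mpoly_var_def Poly_Mapping.mult_single
        split: if_splits)
  then have "homogeneous n e (q ^ e)" using homogeneous_power[of n 1 q e] by simp
  then have *: "keys (q ^ e) \<subseteq> monomials_of_degree n e" by (simp add: homogeneous_def)
  have "(\<Sum>\<alpha>\<in>monomials_of_degree n e. lookup (q ^ e) \<alpha> * mono_eval z \<alpha>) =
      (a * z j + b * z k) ^ e" for z
    unfolding comm_ring_hom.insertion_superset[OF comm_ring_hom_id finite_monomials_of_degree *, symmetric]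
    by (simp add: ins_id.hom_power) (simp add: q_def ins_id.hom_add ins_id.hom_mult)
  then show ?thesis by blast
qed

locale form_system =
  fixes n :: nat and ds :: "nat \<Rightarrow> nat"
  assumes n_pos: "n \<ge> 1" and ds_pos: "\<And>i. i < n \<Longrightarrow> ds i \<ge> 1"
begin

abbreviation mons :: "nat \<Rightarrow> nat monomial set" where
  "mons i \<equiv> monomials_of_degree n (ds i)"

abbreviation homs where "homs \<equiv> monomials_of_degree n"

definition indets :: "(nat \<times> nat monomial) set" where
  "indets = (SIGMA i:{..<n}. mons i)"

definition form :: "(nat \<times> nat monomial \<Rightarrow> 'a) \<Rightarrow> nat \<Rightarrow> (nat \<Rightarrow> 'a) \<Rightarrow> 'a::comm_ring_1" where
  "form c i x = (\<Sum>\<alpha>\<in>mons i. c (i, \<alpha>) * mono_eval x \<alpha>)"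

definition has_zero :: "(nat \<times> nat monomial \<Rightarrow> complex) \<Rightarrow> bool" where
  "has_zero c \<longleftrightarrow> (\<exists>x. (\<exists>j<n. x j \<noteq> 0) \<and> (\<forall>i<n. form c i x = 0))"

definition vanishing :: "coeff_poly \<Rightarrow> bool" where
  "vanishing P \<longleftrightarrow> (\<forall>c. has_zero c \<longrightarrow> ieval c P = 0)"

lemma finite_indets [simp]: "finite indets"
  by (simp add: indets_def)

lemma hom_form: "comm_ring_hom g \<Longrightarrow> g (form c i x) = form (\<lambda>v. g (c v)) i (\<lambda>v. g (x v))"
proof -
  assume g: "comm_ring_hom g"
  then interpret comm_ring_hom g .
  show ?thesis by (simp add: form_def hom_sum hom_mult hom_mono_eval[OF g])
qed

lemma form_scale: "form c i (\<lambda>v. s * x v) = s ^ ds i * form c i x"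
proof -
  have "form c i (\<lambda>v. s * x v) = (\<Sum>\<alpha>\<in>mons i. c (i, \<alpha>) * (s ^ ds i * mono_eval x \<alpha>))"
    unfolding form_def by (intro sum.cong refl) (simp add: mono_eval_scale)
  then show ?thesis by (simp add: form_def sum_distrib_left mult_ac)
qed

text \<open>The variety of systems with a common zero is irreducible: two such systems, with zeros
  \<open>x\<close> and \<open>y\<close> normalised by \<open>l x = l y = 1\<close> for a linear form \<open>l\<close>, are joined by a polynomial
  path inside it. The segment between the systems is corrected by multiples of powers of \<open>l\<close>
  so as to vanish along the segment between \<open>x\<close> and \<open>y\<close>.\<close>

lemma vanishing_prime:
  assumes "vanishing (P * Q)"
  shows "vanishing P \<or> vanishing Q"
proof (rule ccontr)
  assume "\<not> ?thesis"
  then obtain c c' where c: "has_zero c" "ieval c P \<noteq> 0"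
    and c': "has_zero c'" "ieval c' Q \<noteq> 0"
    unfolding vanishing_def by blast
  obtain x0 j where x0: "j < n" "x0 j \<noteq> 0" "\<And>i. i < n \<Longrightarrow> form c i x0 = 0"
    using c(1) unfolding has_zero_def by blast
  obtain y0 k where y0: "k < n" "y0 k \<noteq> 0" "\<And>i. i < n \<Longrightarrow> form c' i y0 = 0"
    using c'(1) unfolding has_zero_def by blast
  \<comment> \<open>One of the linear forms \<open>z k\<close>, \<open>z j\<close> and
    \<open>z j + z k\<close> is nonzero at both points.\<close>
  obtain a b where ab: "a * x0 j + b * x0 k \<noteq> 0" "a * y0 j + b * y0 k \<noteq> 0"
  proof (cases "x0 k = 0")
    case False
    then show ?thesis using that[of 0 1] y0 by simp
  next
    case True
    show ?thesis
    proof (cases "y0 j = 0")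
      case False
      then show ?thesis using that[of 1 0] x0 by simp
    next
      case y: True
      show ?thesis using that[of 1 1] True y x0 y0 by simp
    qed
  qed
  define l where "l z = a * z j + b * z k" for z :: "nat \<Rightarrow> complex"
  define x where "x v = inverse (l x0) * x0 v" for v
  define y where "y v = inverse (l y0) * y0 v" for v
  have l_scale: "l (\<lambda>v. s * z v) = s * l z" for s z by (simp add: l_def algebra_simps)
  have x: "l x = 1" "\<And>i. i < n \<Longrightarrow> form c i x = 0"
    using ab(1) x0(3) unfolding x_def[abs_def] l_scale form_scale by (simp_all add: l_def)
  have y: "l y = 1" "\<And>i. i < n \<Longrightarrow> form c' i y = 0"
    using ab(2) y0(3) unfolding y_def[abs_def] l_scale form_scale by (simp_all add: l_def)
  have "\<forall>i. \<exists>L. \<forall>z. (\<Sum>\<alpha>\<in>mons i. L \<alpha> * mono_eval z \<alpha>) = l z ^ ds i"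
    unfolding l_def using linear_form_power[OF x0(1) y0(1)] by simp
  from choice[OF this] obtain L
    where L: "\<And>i z. (\<Sum>\<alpha>\<in>mons i. L i \<alpha> * mono_eval z \<alpha>) = l z ^ ds i" by auto
  define X where "X v = [:x v, y v - x v:]" for v
  define H where "H v = [:c v, c' v - c v:]" for v
  \<comment> \<open>The correction is zero at both ends, because \<open>x\<close> and
    \<open>y\<close> are zeros of the end systems. Entries with \<open>fst v \<ge> n\<close> belong
    to no form and are left alone, so the ends are exactly \<open>c\<close> and
    \<open>c'\<close>.\<close>
  define F where "F v = H v - (if fst v < n then form H (fst v) X * [:L (fst v) (snd v):] else 0)" for v
  define X' where "X' s = (\<lambda>v. poly (X v) s)" for s
  define H' where "H' s = (\<lambda>v. poly (H v) s)" for s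
  have F: "poly (F (i, \<alpha>)) s = H' s (i, \<alpha>) - form (H' s) i (X' s) * L i \<alpha>" if "i < n" for i \<alpha> s
    using that by (simp add: F_def X'_def H'_def hom_form[OF comm_ring_hom_poly])
  have lX: "l (X' s) = 1" for s
  proof -
    have "l (X' s) = l x + s * (l y - l x)" by (simp add: l_def X'_def X_def algebra_simps)
    then show ?thesis using x y by simp
  qed
  have "has_zero (\<lambda>v. poly (F v) s)" for s
  proof -
    have "X' s j \<noteq> 0 \<or> X' s k \<noteq> 0" using lX[of s] by (auto simp: l_def)
    moreover have "form (\<lambda>v. poly (F v) s) i (X' s) = 0" if i: "i < n" for i
    proof -
      have "form (\<lambda>v. poly (F v) s) i (X' s) =
          form (H' s) i (X' s) - form (H' s) i (X' s) * (\<Sum>\<alpha>\<in>mons i. L i \<alpha> * mono_eval (X' s) \<alpha>)"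
        unfolding form_def[of "\<lambda>v. poly (F v) s"] form_def[of "H' s" i "X' s", symmetric] F[OF i]
        by (simp add: left_diff_distrib sum_subtractf sum_distrib_left mult.assoc)
           (simp add: form_def)
      then show ?thesis by (simp add: L lX)
    qed
    ultimately show ?thesis unfolding has_zero_def using x0(1) y0(1) by blast
  qed
  \<comment> \<open>Along the path the product is a univariate polynomial with every number as a
    root, hence zero, and so one of its two factors is zero.\<close>
  then have "poly (ieval F (P * Q)) s = 0" for s
    using assms by (simp add: hom_insertion_of_int[OF comm_ring_hom_poly] vanishing_def)
  then have "ieval F (P * Q) = 0"
    using poly_all_0_iff_0[of "ieval F (P * Q)"] by blast
  then have "ieval F P * ieval F Q = 0"
    by (simp only: ins_int.hom_mult)
  moreover have "poly (ieval F P) 0 \<noteq> 0"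
  proof -
    have "(\<lambda>v. poly (F v) 0) = c"
    proof
      fix v
      show "poly (F v) 0 = c v"
        using F[of "fst v" "snd v" 0] x(2)[of "fst v"]
        by (cases "fst v < n") (simp_all add: H'_def X'_def H_def X_def F_def)
    qed
    then show ?thesis using c(2) by (simp add: hom_insertion_of_int[OF comm_ring_hom_poly])
  qed
  moreover have "poly (ieval F Q) 1 \<noteq> 0"
  proof -
    have "(\<lambda>v. poly (F v) 1) = c'"
    proof
      fix v
      show "poly (F v) 1 = c' v"
        using F[of "fst v" "snd v" 1] y(2)[of "fst v"]
        by (cases "fst v < n") (simp_all add: H'_def X'_def H_def X_def F_def)
    qed
    then show ?thesis using c'(2) by (simp add: hom_insertion_of_int[OF comm_ring_hom_poly])
  qed
  ultimately show False by auto
qed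

end

text \<open>The bound does not depend on the line \<open>C\<close>; this uniformity gives a top
  degree over all constant terms in \<open>vanishing_not_pivot\<close>.\<close>

lemma insertion_degree_bound:
  "\<exists>B. \<forall>C :: 'v \<Rightarrow> complex poly. (\<forall>v. degree (C v) \<le> 1) \<longrightarrow> degree (ieval C P) \<le> B"
proof -
  have "P \<in> polys_in UNIV" by simp
  then show ?thesis
  proof (induction P rule: polys_in_induct)
    case (add p q)
    then obtain A B where "\<forall>C :: 'v \<Rightarrow> complex poly. (\<forall>v. degree (C v) \<le> 1) \<longrightarrow> degree (ieval C p) \<le> A"
      "\<forall>C :: 'v \<Rightarrow> complex poly. (\<forall>v. degree (C v) \<le> 1) \<longrightarrow> degree (ieval C q) \<le> B" by blast
    then show ?case
      by (intro exI[of _ "max A B"]) (auto simp: ins_int.hom_add intro!: degree_add_le intro: le_max_iff_disj[THEN iffD2])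
  next
    case (mult p q)
    then obtain A B where AB: "\<forall>C :: 'v \<Rightarrow> complex poly. (\<forall>v. degree (C v) \<le> 1) \<longrightarrow> degree (ieval C p) \<le> A"
      "\<forall>C :: 'v \<Rightarrow> complex poly. (\<forall>v. degree (C v) \<le> 1) \<longrightarrow> degree (ieval C q) \<le> B" by blast
    show ?case
    proof (intro exI[of _ "A + B"] allI impI)
      fix C :: "'v \<Rightarrow> complex poly" assume "\<forall>v. degree (C v) \<le> 1"
      with AB have "degree (ieval C p) \<le> A" "degree (ieval C q) \<le> B" by auto
      then show "degree (ieval C (p * q)) \<le> A + B"
        using degree_mult_le[of "ieval C p" "ieval C q"]
        by (simp add: ins_int.hom_mult)
    qed
  next
    case (const a)
    have "degree (of_int a :: complex poly) = 0" by (simp add: of_int_poly)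
    then show ?case by (intro exI[of _ 0]) simp
  qed auto
qed

lemma isCont_coeff_insertion:
  fixes C :: "complex \<Rightarrow> 'v \<Rightarrow> complex poly"
  assumes "\<And>v k. isCont (\<lambda>u. coeff (C u v) k) a"
  shows "isCont (\<lambda>u. coeff (ieval (C u) P) k) a"
proof -
  have "P \<in> polys_in UNIV" by simp
  then have "\<forall>k. isCont (\<lambda>u. coeff (ieval (C u) P) k) a"
  proof (induction P rule: polys_in_induct)
    case (add p q)
    then show ?case by (auto simp: ins_int.hom_add)
  next
    case (mult p q)
    then show ?case by (auto simp: ins_int.hom_mult coeff_mult intro!: continuous_intros)
  qed (use assms in auto)
  then show ?thesis ..
qed

section \<open>No nonzero vanishing polynomial avoids the pivot coefficient\<close>

context form_system
begin

abbreviation lst :: nat where "lst \<equiv> n - 1"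

text \<open>At a point with last coordinate 1 this coefficient enters the last equation with factor
  1, so that equation can be solved for it.\<close>

definition pivot :: "nat \<times> nat monomial" where
  "pivot = (lst, single lst (ds lst))"

text \<open>The monomial that restricts to the single variable \<open>x i\<close> where the last
  coordinate is 1.\<close>

definition lin :: "nat \<Rightarrow> nat monomial" where
  "lin i = single i 1 + single lst (ds i - 1)"

lemma lin_in:
  assumes "i < lst"
  shows "lin i \<in> mons i"
proof -
  have "lin i \<in> homs (1 + (ds i - 1))"
    unfolding lin_def using assms by (intro monomials_of_degree_add) auto
  moreover have "1 + (ds i - 1) = ds i" using ds_pos[of i] assms by linarith
  ultimately show ?thesis by (simp only:)
qed

lemma top_in: "i < n \<Longrightarrow> single lst (ds i) \<in> mons i"
  using n_pos by simp

lemma lin_ne_top: "i < lst \<Longrightarrow> lin i \<noteq> single lst (ds i)"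
  by (metis lin_def lookup_add lookup_single_eq lookup_single_not_eq add_is_0 nat_neq_iff one_neq_zero)

text \<open>The constant terms (at \<open>x\<^sub>n\<^sub>-\<^sub>1 = 1\<close>) of the first \<open>n - 1\<close> forms are determined
  by a prescribed zero \<open>x\<close>; the remaining coefficient at the pivot absorbs the last equation.
  Here the \<open>i\<close>-th linear coefficient is shifted by \<open>1 / u\<close>, the zero is \<open>- u y\<close>, and the
  constant terms tend to \<open>y\<close> as \<open>u\<close> tends to \<open>0\<close>.\<close>

definition zero_at :: "(nat \<Rightarrow> complex) \<Rightarrow> complex \<Rightarrow> nat \<Rightarrow> complex" where
  "zero_at y u = (\<lambda>v. if v = lst then 1 else - u * y v)"

definition const_term where
  "const_term c y u i = y i -
    (\<Sum>\<alpha>\<in>mons i - {single lst (ds i)}. c (i, \<alpha>) * mono_eval (zero_at y u) \<alpha>)"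

definition shifted :: "(nat \<times> nat monomial \<Rightarrow> complex) \<Rightarrow> (nat \<Rightarrow> complex) \<Rightarrow>
    nat \<times> nat monomial \<Rightarrow> complex poly" where
  "shifted c z = (\<lambda>(i, \<alpha>).
     if i < lst \<and> \<alpha> = single lst (ds i) then [:z i:]
     else if i < lst \<and> \<alpha> = lin i then [:c (i, \<alpha>), 1:] else [:c (i, \<alpha>):])"

lemma mono_eval_lin: "i < lst \<Longrightarrow> mono_eval (zero_at y u) (lin i) = - u * y i"
  by (simp add: lin_def mono_eval_add zero_at_def)

lemma has_zero_shifted:
  fixes c y u
  assumes u: "u \<noteq> 0"
  defines "c' \<equiv> \<lambda>v. poly (shifted c (const_term c y u) v) (inverse u)"
  obtains t where "has_zero (c'(pivot := t))"
proof -
  let ?x = "zero_at y u"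
  let ?top = "\<lambda>i. single lst (ds i)"
  have top1: "mono_eval ?x (?top i) = 1" for i by (simp add: zero_at_def)
  define t where "t = - (\<Sum>\<alpha>\<in>mons lst - {?top lst}. c' (lst, \<alpha>) * mono_eval ?x \<alpha>)"
  have "form (c'(pivot := t)) i ?x = 0" if i: "i < n" for i
  proof (cases "i = lst")
    case True
    have "form (c'(pivot := t)) i ?x = t + (\<Sum>\<alpha>\<in>mons lst - {?top lst}. c' (lst, \<alpha>) * mono_eval ?x \<alpha>)"
      unfolding form_def True
      by (subst sum.remove[of _ "?top lst"]) (use n_pos top1[of lst] in \<open>auto simp: pivot_def intro!: sum.cong\<close>)
    then show ?thesis by (simp add: t_def)
  next
    case False
    then have il: "i < lst" using i by linarith
    have "form (c'(pivot := t)) i ?x = (\<Sum>\<alpha>\<in>mons i. c' (i, \<alpha>) * mono_eval ?x \<alpha>)"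
      using False by (simp add: form_def pivot_def)
    also have "\<dots> = const_term c y u i + (\<Sum>\<alpha>\<in>mons i - {?top i}. c' (i, \<alpha>) * mono_eval ?x \<alpha>)"
      by (subst sum.remove[of _ "?top i"]) (use top_in[OF i] il top1[of i] in \<open>simp_all add: c'_def shifted_def\<close>)
    \<comment> \<open>The shift of the linear coefficient contributes
      \<open>(1 / u) * (- u * y i) = - y i\<close>, which cancels the \<open>y i\<close> in the
      constant term.\<close>
    also have "(\<Sum>\<alpha>\<in>mons i - {?top i}. c' (i, \<alpha>) * mono_eval ?x \<alpha>) =
        (\<Sum>\<alpha>\<in>mons i - {?top i}. c (i, \<alpha>) * mono_eval ?x \<alpha> + (if \<alpha> = lin i then - y i else 0))"
      using il u mono_eval_lin[OF il, of y u]
      by (intro sum.cong) (auto simp: c'_def shifted_def algebra_simps)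
    also have "\<dots> = (\<Sum>\<alpha>\<in>mons i - {?top i}. c (i, \<alpha>) * mono_eval ?x \<alpha>) - y i"
      using lin_in[OF il] lin_ne_top[OF il] by (simp add: sum.distrib sum.delta)
    also have "const_term c y u i + \<dots> = 0" by (simp add: const_term_def)
    finally show ?thesis .
  qed
  moreover have "?x lst \<noteq> 0" "lst < n" using n_pos by (auto simp: zero_at_def)
  ultimately have "has_zero (c'(pivot := t))"
    unfolding has_zero_def by (intro exI[of _ ?x]) blast
  then show ?thesis by (rule that)
qed

text \<open>For \<open>u = 0\<close> the prescribed zero is the last unit vector, where only the
  pure power of the last variable is nonzero.\<close>

lemma const_term_0: "i < lst \<Longrightarrow> const_term c y 0 i = y i"
proof -
  assume i: "i < lst"
  have "mono_eval (zero_at y 0) \<alpha> = 0"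
    if \<alpha>: "\<alpha> \<in> mons i" "\<alpha> \<noteq> single lst (ds i)" for \<alpha>
  proof -
    have "\<exists>v\<in>keys \<alpha>. v \<noteq> lst"
    proof (rule ccontr)
      assume "\<not> ?thesis"
      then have *: "keys \<alpha> \<subseteq> {lst}" by auto
      then have "(\<Sum>v\<in>keys \<alpha>. lookup \<alpha> v) = lookup \<alpha> lst"
        using sum_keys_lookup[of "{lst}" \<alpha>] by simp
      then have "\<alpha> = single lst (ds i)" using * \<alpha>(1)
        by (intro poly_mapping_eqI)
           (auto simp: monomials_of_degree_def lookup_single when_def not_in_keys_iff_lookup_eq_zero[symmetric])
      then show False using \<alpha>(2) by simp
    qed
    then show ?thesis by (auto simp: mono_eval_def zero_at_def in_keys_iff)
  qed
  then show ?thesis unfolding const_term_def by (simp add: sum.neutral)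
qed

lemma isCont_const_term: "isCont (\<lambda>u. const_term c y u i) a"
proof -
  have "isCont (\<lambda>u. zero_at y u v) a" for v
    by (cases "v = lst") (auto simp: zero_at_def intro!: continuous_intros)
  then show ?thesis
    unfolding const_term_def mono_eval_def by (intro continuous_intros) auto
qed

text \<open>A suitable pivot gives every system of \<open>has_zero_shifted\<close> a common zero,
  and \<open>P\<close> does not see the pivot, so \<open>P\<close> vanishes there for all
  \<open>u \<noteq> 0\<close>. As a polynomial in the shift \<open>1 / u\<close>, only its top
  coefficient survives the limit \<open>u = 0\<close> after division by the top power, and there the
  constant terms reach an arbitrary \<open>y\<close>. So the top coefficient is zero at every
  \<open>y\<close>, against its choice.\<close>

lemma vanishing_not_pivot:
  assumes P: "vanishing P" "P \<in> polys_in (- {pivot})"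
  shows "P = 0"
proof (rule ccontr)
  assume "P \<noteq> 0"
  then obtain c :: "nat \<times> nat monomial \<Rightarrow> complex" where c: "ieval c P \<noteq> 0"
    using mpoly_nonvanishing_point by blast
  define Q where "Q z = ieval (shifted c z) P" for z
  obtain B where B: "degree (Q z) \<le> B" for z
  proof -
    have "degree (shifted c z v) \<le> 1" for z v
      by (auto simp: shifted_def split: prod.splits)
    then show ?thesis using that insertion_degree_bound[of P] unfolding Q_def by metis
  qed
  let ?z0 = "\<lambda>i. c (i, single lst (ds i))"
  have "(\<lambda>v. poly (shifted c ?z0 v) 0) = c"
    by (auto simp: shifted_def split: prod.splits)
  then have "poly (Q ?z0) 0 \<noteq> 0"
    using c by (simp add: Q_def hom_insertion_of_int[OF comm_ring_hom_poly])
  then have "Q ?z0 \<noteq> 0" by auto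
  then have "\<exists>k y. coeff (Q y) k \<noteq> 0" by (metis leading_coeff_0_iff)
  moreover have "k \<le> B" if "\<exists>y. coeff (Q y) k \<noteq> 0" for k
    using that B le_degree le_trans by blast
  \<comment> \<open>\<open>K\<close> is the top degree over all constant terms, not just one choice
    of them, because the constant terms move with \<open>u\<close>.\<close>
  ultimately obtain K where K: "\<exists>y. coeff (Q y) K \<noteq> 0"
    and max: "\<And>k. \<exists>y. coeff (Q y) k \<noteq> 0 \<Longrightarrow> k \<le> K"
    using Nat.ex_has_greatest_nat[of "\<lambda>k. \<exists>y. coeff (Q y) k \<noteq> 0" _ B] by blast
  obtain y where y: "coeff (Q y) K \<noteq> 0" using K by blast
  \<comment> \<open>\<open>Q\<close> at \<open>1 / u\<close>, multiplied by \<open>u ^ K\<close> to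
    clear denominators. At \<open>u = 0\<close> only the summand \<open>k = K\<close> remains, as
    \<open>0 ^ 0 = 1\<close>.\<close>
  define T where "T u = (\<Sum>k\<le>K. coeff (Q (const_term c y u)) k * u ^ (K - k))" for u
  have T: "T u = 0" if u: "u \<noteq> 0" for u
  proof -
    let ?c' = "\<lambda>v. poly (shifted c (const_term c y u) v) (inverse u)"
    obtain t where "has_zero (?c'(pivot := t))" using has_zero_shifted[OF u] by blast
    then have "ieval (?c'(pivot := t)) P = 0" using P(1) by (simp add: vanishing_def)
    moreover have "ieval (?c'(pivot := t)) P = ieval ?c' P"
      using P(2) by (intro insertion_of_int_cong) (auto simp: polys_in_def)
    ultimately have "poly (Q (const_term c y u)) (inverse u) = 0"
      by (simp add: Q_def hom_insertion_of_int[OF comm_ring_hom_poly])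
    moreover have "poly (Q z) (inverse u) = (\<Sum>k\<le>K. coeff (Q z) k * inverse u ^ k)" for z
      unfolding poly_altdef
      by (rule sum.mono_neutral_cong) (use max in \<open>auto intro: coeff_eq_0\<close>)
    moreover have "u ^ K * inverse u ^ k = u ^ (K - k)" if "k \<le> K" for k
      using u that by (simp add: power_diff field_simps)
    then have "T u = u ^ K * (\<Sum>k\<le>K. coeff (Q (const_term c y u)) k * inverse u ^ k)"
      unfolding T_def sum_distrib_left by (intro sum.cong) (auto simp: mult_ac)
    ultimately show ?thesis by simp
  qed
  have "isCont T 0"
  proof -
    have "isCont (\<lambda>u. coeff (shifted c (const_term c y u) v) k) 0" for v k
    proof (cases "fst v < lst \<and> snd v = single lst (ds (fst v))")
      case True
      then show ?thesis using isCont_const_term[of 0 c y]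
        by (cases k) (simp_all add: shifted_def case_prod_beta)
    next
      case False
      then have "shifted c (const_term c y u) v = shifted c y v" for u
        by (auto simp: shifted_def case_prod_beta)
      then show ?thesis by simp
    qed
    then have "isCont (\<lambda>u. coeff (Q (const_term c y u)) k) 0" for k
      unfolding Q_def by (rule isCont_coeff_insertion)
    then show ?thesis unfolding T_def by (intro continuous_intros)
  qed
  then have "T \<midarrow>0\<rightarrow> T 0" by (simp add: isCont_def)
  moreover have "T \<midarrow>0\<rightarrow> 0"
    by (rule Lim_transform_eventually[OF tendsto_const]) (auto simp: eventually_at_filter T)
  ultimately have "T 0 = 0" by (rule LIM_unique)
  moreover have "T 0 = coeff (Q (const_term c y 0)) K"
    unfolding T_def by (subst sum.remove[of _ K]) (auto intro!: sum.neutral)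
  moreover have "shifted c (const_term c y 0) = shifted c y"
    by (auto simp: shifted_def const_term_0 fun_eq_iff)
  ultimately show False using y by (simp add: Q_def)
qed

section \<open>The ideal of vanishing polynomials is principal\<close>

lemma vanishing_diff: "vanishing P \<Longrightarrow> vanishing Q \<Longrightarrow> vanishing (P - Q)"
  by (simp add: vanishing_def ins_int.hom_minus)

lemma vanishing_mult: "vanishing P \<Longrightarrow> vanishing (Q * P)"
  by (simp add: vanishing_def ins_int.hom_mult)

lemma pivot_in_indets: "pivot \<in> indets"
  using n_pos by (auto simp: pivot_def indets_def)

text \<open>Polynomials are read as univariate in the pivot. The content \<open>c\<close> of a
  member of least degree is free of the pivot, hence not vanishing; primality then makes the
  primitive part vanishing, and \<open>minimal_generator\<close> shows that it divides the whole
  ideal. The given \<open>S\<close> excludes the zero ideal.\<close>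

theorem vanishing_principal:
  assumes "S \<in> polys_in indets" "vanishing S" "S \<noteq> 0"
  obtains R where "R \<in> polys_in indets" "vanishing R" "R \<noteq> 0"
    "\<And>P. P \<in> polys_in indets \<Longrightarrow> vanishing P \<Longrightarrow> R dvd P"
proof -
  let ?X = "indets - {pivot}"
  let ?A = "polys_in ?X :: coeff_poly set"
  let ?v = "mpoly_var pivot :: coeff_poly"
  interpret factorial_subring ?A by (rule factorial_polys_in) simp
  have ins: "insert pivot ?X = indets" using pivot_in_indets by auto
  have A_mono: "?A \<subseteq> polys_in indets" by (rule polys_in_mono) auto
  define J where "J = {q \<in> polys_over ?A. vanishing (poly q ?v)}"
  have in_J: "as_poly pivot P \<in> J" if "P \<in> polys_in indets" "vanishing P" for P
    using that as_poly_in[of P pivot ?X, unfolded ins] by (simp add: J_def)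
  have J: "J \<subseteq> polys_over ?A" by (auto simp: J_def)
  interpret PO: dom_subring "polys_over ?A" by (rule subring_polys_over)
  have Jd: "g - h \<in> J" if "g \<in> J" "h \<in> J" for g h
    using that by (auto simp: J_def intro: PO.diff_in vanishing_diff)
  have Jm: "h * g \<in> J" if "g \<in> J" "h \<in> polys_over ?A" for g h
    using that by (auto simp: J_def intro: PO.mult_in vanishing_mult)
  have "as_poly pivot S \<noteq> 0" using assms(3) by (metis poly_as_poly poly_0)
  then obtain r where r: "r \<in> J" "r \<noteq> 0" "\<And>g. g \<in> J \<Longrightarrow> g \<noteq> 0 \<Longrightarrow> degree r \<le> degree g"
    using ex_has_least_nat[of "\<lambda>r. r \<in> J \<and> r \<noteq> 0" "as_poly pivot S" degree] in_J assms by blast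
  then obtain c r' where r': "c \<in> ?A" "r' \<in> polys_over ?A" "r = smult c r'" "primitive_over ?A r'"
    using primitive_part_exists J by blast
  define R where "R = poly r' ?v"
  have c0: "c \<noteq> 0" using r r' by auto
  have "vanishing (c * R)" using r(1) r'(3) by (simp add: J_def R_def)
  then have "vanishing c \<or> vanishing R" by (rule vanishing_prime)
  moreover have "\<not> vanishing c"
    using vanishing_not_pivot[of c] c0 r'(1) polys_in_mono[of ?X "- {pivot}"] by auto
  ultimately have R: "vanishing R" by blast
  have R_in: "R \<in> polys_in indets" using poly_var_in[OF r'(2), of pivot, unfolded ins] by (simp add: R_def)
  have R0: "R \<noteq> 0"
  proof
    assume "R = 0"
    then have "as_poly pivot (poly r' ?v) = 0" by (simp add: R_def)
    then have "r' = 0" using as_poly_poly[OF r'(2), of pivot] by simp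
    then show False using r r' by simp
  qed
  have "R dvd P" if P: "P \<in> polys_in indets" "vanishing P" for P
  proof -
    have "dvd_in (polys_over ?A) r' (as_poly pivot P)"
      by (rule minimal_generator[OF J Jd Jm r r'(3,1,2,4) in_J[OF P]])
    then obtain k where "as_poly pivot P = r' * k" by (auto simp: dvd_in_def)
    then have "poly (as_poly pivot P) ?v = R * poly k ?v" by (simp add: R_def)
    then show ?thesis by simp
  qed
  with R R_in R0 that show ?thesis by blast
qed

lemma has_zero_0: "has_zero (\<lambda>_. 0)"
  unfolding has_zero_def form_def using n_pos
  by (intro exI[of _ "\<lambda>_. 1"] conjI exI[of _ 0]) auto

lemma vanishing_not_unit: "vanishing R \<Longrightarrow> \<not> R dvd 1"
proof
  assume R: "vanishing R" "R dvd 1"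
  then have "R = 1 \<or> R = - 1" by (intro unit_mpoly_int)
  then have "ieval (\<lambda>_. 0 :: complex) R \<noteq> 0" by (auto simp: ins_int.hom_uminus)
  then show False using R(1) has_zero_0 by (auto simp: vanishing_def)
qed

text \<open>By primality one factor is vanishing, hence a multiple of the generator, so the other
  factor is a unit.\<close>

lemma generator_irreducible:
  assumes R: "R \<in> polys_in indets" "vanishing R" "R \<noteq> 0"
    and gen: "\<And>P. P \<in> polys_in indets \<Longrightarrow> vanishing P \<Longrightarrow> R dvd P"
  shows "irreducible R"
proof (rule irreducibleI)
  fix a b assume ab: "R = a * b"
  have unit: "y dvd 1" if eq: "R = x * y" and x: "vanishing x" for x y
  proof -
    have "x \<in> polys_in indets" by (rule factor_vars[of x y]) (use eq R in auto)
    then obtain k where "x = R * k" using gen x by (metis dvdE)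
    then have "R * (k * y) = R * 1" by (metis eq mult.assoc mult_1_right)
    then have "1 = y * k" using R(3) by (metis mult.commute mult_left_cancel)
    then show ?thesis by (metis dvd_triv_left)
  qed
  have "vanishing a \<or> vanishing b" using vanishing_prime R(2) ab by simp
  then show "a dvd 1 \<or> b dvd 1" using unit[of a b] unit[of b a] ab by (auto simp: mult.commute)
qed (use R vanishing_not_unit in auto)

end

section \<open>A Nullstellensatz over the complex numbers\<close>

text \<open>Gaussian elimination on the coordinates: one vector with nonzero coordinate
  \<open>f\<close> clears this coordinate in all the others and is then set aside.\<close>

lemma linear_dependence:
  fixes g :: "'b \<Rightarrow> 'f \<Rightarrow> 'a::field"
  assumes "finite F" "finite B" "card F < card B"
  shows "\<exists>b. (\<exists>a\<in>B. b a \<noteq> 0) \<and> (\<forall>f\<in>F. (\<Sum>a\<in>B. b a * g a f) = 0)"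
  using assms
proof (induction F arbitrary: B g rule: finite_induct)
  case empty
  then have "B \<noteq> {}" by auto
  then show ?case by (intro exI[of _ "\<lambda>_. 1"]) auto
next
  case (insert f F)
  show ?case
  proof (cases "\<forall>a\<in>B. g a f = 0")
    case True
    have "card F < card B" using insert by simp
    from insert.IH[OF insert.prems(1) this, of g] True show ?thesis by auto
  next
    case False
    then obtain a0 where a0: "a0 \<in> B" "g a0 f \<noteq> 0" by blast
    let ?B = "B - {a0}"
    let ?k = "\<lambda>a. g a f / g a0 f"
    have "card F < card ?B" using insert a0 by simp
    from insert.IH[OF _ this, of "\<lambda>a f'. g a f' - ?k a * g a0 f'"] insert.prems(1)
    obtain b where b: "\<exists>a\<in>?B. b a \<noteq> 0"
      "\<And>f'. f' \<in> F \<Longrightarrow> (\<Sum>a\<in>?B. b a * (g a f' - ?k a * g a0 f')) = 0" by auto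
    \<comment> \<open>The coefficient of \<open>a0\<close> collects the multiples of
      \<open>g a0\<close> that were subtracted from the other vectors.\<close>
    define b' where "b' = b(a0 := - (\<Sum>a\<in>?B. b a * ?k a))"
    have "(\<Sum>a\<in>B. b' a * g a f') = (\<Sum>a\<in>?B. b a * (g a f' - ?k a * g a0 f'))" for f'
    proof -
      have "(\<Sum>a\<in>B. b' a * g a f') = b' a0 * g a0 f' + (\<Sum>a\<in>?B. b' a * g a f')"
        using insert.prems a0 by (intro sum.remove) auto
      also have "(\<Sum>a\<in>?B. b' a * g a f') = (\<Sum>a\<in>?B. b a * g a f')"
        by (intro sum.cong) (auto simp: b'_def)
      also have "b' a0 * g a0 f' = - (\<Sum>a\<in>?B. b a * ?k a * g a0 f')"
        by (simp add: b'_def sum_distrib_right)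
      finally show ?thesis by (simp add: right_diff_distrib sum_subtractf mult.assoc)
    qed
    moreover have "(\<Sum>a\<in>?B. b a * (g a f - ?k a * g a0 f)) = 0" using a0 by simp
    moreover have "\<exists>a\<in>B. b' a \<noteq> 0" using b(1) by (auto simp: b'_def)
    ultimately show ?thesis using b(2) by (intro exI[of _ b']) auto
  qed
qed

definition is_ideal :: "'a::comm_ring_1 set \<Rightarrow> bool" where
  "is_ideal I \<longleftrightarrow> 0 \<in> I \<and> (\<forall>p\<in>I. \<forall>q\<in>I. p + q \<in> I) \<and> (\<forall>p\<in>I. \<forall>r. r * p \<in> I)"

lemma is_ideal_0: "is_ideal I \<Longrightarrow> 0 \<in> I"
  and is_ideal_add: "is_ideal I \<Longrightarrow> p \<in> I \<Longrightarrow> q \<in> I \<Longrightarrow> p + q \<in> I"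
  and is_ideal_mult: "is_ideal I \<Longrightarrow> p \<in> I \<Longrightarrow> r * p \<in> I"
  by (auto simp: is_ideal_def)

lemma is_ideal_sum: "is_ideal I \<Longrightarrow> (\<And>i. i \<in> A \<Longrightarrow> f i \<in> I) \<Longrightarrow> sum f A \<in> I"
  by (induction A rule: infinite_finite_induct) (auto intro: is_ideal_0 is_ideal_add)

lemma is_ideal_diff: "is_ideal I \<Longrightarrow> p \<in> I \<Longrightarrow> q \<in> I \<Longrightarrow> p - q \<in> I"
  using is_ideal_add[of I p "- q"] is_ideal_mult[of I q "- 1"] by simp

text \<open>Zorn's lemma. Maximality is expressed as invertibility modulo \<open>M\<close>, since
  the inverses are what the later counting argument works with.\<close>

lemma maximal_ideal_exists:
  assumes "is_ideal I" "1 \<notin> I"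
  shows "\<exists>M. is_ideal M \<and> 1 \<notin> M \<and> I \<subseteq> M \<and> (\<forall>p. p \<notin> M \<longrightarrow> (\<exists>q. 1 - q * p \<in> M))"
proof -
  define A where "A = {J. is_ideal J \<and> 1 \<notin> J \<and> I \<subseteq> J}"
  have "\<Union>C \<in> A" if C: "C \<noteq> {}" "subset.chain A C" for C
  proof -
    have CA: "J \<in> A" if "J \<in> C" for J using C(2) that by (auto simp: subset.chain_def)
    obtain J0 where J0: "J0 \<in> C" using C(1) by blast
    have "p + q \<in> \<Union>C" if pq: "p \<in> \<Union>C" "q \<in> \<Union>C" for p q
    proof -
      obtain J K where JK: "J \<in> C" "p \<in> J" "K \<in> C" "q \<in> K" using pq by blast
      then have "J \<subseteq> K \<or> K \<subseteq> J" using C(2) unfolding subset.chain_def by blast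
      then obtain L where "L \<in> C" "p \<in> L" "q \<in> L" using JK by blast
      then show ?thesis using CA[of L] is_ideal_add[of L p q] by (auto simp: A_def)
    qed
    moreover have "0 \<in> \<Union>C" "I \<subseteq> \<Union>C"
      using CA[OF J0] J0 is_ideal_0 by (auto simp: A_def)
    moreover have "r * p \<in> \<Union>C" if "p \<in> \<Union>C" for p r
    proof -
      from that obtain J where "J \<in> C" "p \<in> J" by blast
      then show ?thesis using CA[of J] is_ideal_mult[of J p r] by (auto simp: A_def)
    qed
    moreover have "1 \<notin> \<Union>C" using CA by (auto simp: A_def)
    ultimately show ?thesis by (auto simp: A_def is_ideal_def)
  qed
  moreover have "A \<noteq> {}" using assms by (auto simp: A_def)
  ultimately obtain M where M: "M \<in> A" "\<And>X. X \<in> A \<Longrightarrow> M \<subseteq> X \<Longrightarrow> X = M"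
    using subset_Zorn_nonempty[of A] by blast
  have Mi: "is_ideal M" using M by (simp add: A_def)
  have "\<exists>q. 1 - q * p \<in> M" if p: "p \<notin> M" for p
  proof (rule ccontr)
    assume no: "\<not> ?thesis"
    define X where "X = {x + q * p | x q. x \<in> M}"
    have X: "x + q * p \<in> X" if "x \<in> M" for x q using that by (auto simp: X_def)
    have MX: "M \<subseteq> X" using X[of _ 0] by auto
    have pX: "p \<in> X" using X[OF is_ideal_0[OF Mi], of 1] by simp
    have "is_ideal X"
      unfolding is_ideal_def
    proof (intro conjI ballI allI)
      show "0 \<in> X" using MX is_ideal_0[OF Mi] by blast
      fix a b assume "a \<in> X" "b \<in> X"
      then obtain x q y r where *: "x \<in> M" "y \<in> M" "a = x + q * p" "b = y + r * p"
        by (auto simp: X_def)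
      then have "a + b = (x + y) + (q + r) * p" by (simp add: algebra_simps)
      then show "a + b \<in> X" using X[OF is_ideal_add[OF Mi *(1,2)], of "q + r"] by (simp only:)
    next
      fix a s assume "a \<in> X"
      then obtain x q where *: "x \<in> M" "a = x + q * p" by (auto simp: X_def)
      then have "s * a = s * x + (s * q) * p" by (simp add: algebra_simps)
      then show "s * a \<in> X" using X[OF is_ideal_mult[OF Mi *(1), of s], of "s * q"] by (simp only:)
    qed
    moreover have "1 \<notin> X"
    proof
      assume "1 \<in> X"
      then obtain x q where "x \<in> M" "1 = x + q * p" by (auto simp: X_def)
      then have "1 - q * p \<in> M" by (metis add_diff_cancel_right')
      then show False using no by blast
    qed
    ultimately have "X \<in> A" using MX M(1) by (auto simp: A_def)
    then show False using M(2) MX pX p by blast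
  qed
  then show ?thesis using M(1) by (auto simp: A_def)
qed

text \<open>An exponent function is determined by its graph over the support, a finite set of pairs
  of naturals. Countability is set against the uncountably many scalars.\<close>

lemma countable_monomials: "countable (UNIV :: nat monomial set)"
proof -
  let ?g = "\<lambda>\<alpha> :: nat monomial. (\<lambda>v. (v, lookup \<alpha> v)) ` keys \<alpha>"
  have "inj ?g"
  proof (rule injI, rule poly_mapping_eqI)
    fix \<alpha> \<beta> :: "nat monomial" and v
    assume eq: "?g \<alpha> = ?g \<beta>"
    have "(v, k) \<in> ?g \<gamma> \<longleftrightarrow> lookup \<gamma> v = k \<and> k \<noteq> 0" for \<gamma> k
      by (auto simp: in_keys_iff)
    then have "lookup \<alpha> v = k \<and> k \<noteq> 0 \<longleftrightarrow> lookup \<beta> v = k \<and> k \<noteq> 0" for k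
      using eq by metis
    then show "lookup \<alpha> v = lookup \<beta> v" by metis
  qed
  moreover have "countable (range ?g)"
    by (rule countable_subset[OF _ countable_Collect_finite]) auto
  ultimately show ?thesis by (rule countable_image_inj_on[rotated])
qed

text \<open>If no \<open>v - a\<close> lay in the maximal ideal, its inverses \<open>q\<^sub>a\<close> modulo the ideal would be
  an uncountable family in a space of countable dimension; a linear relation between them,
  multiplied by the product of the \<open>v - a\<close>, is a polynomial in \<open>v\<close> alone.\<close>

lemma maximal_ideal_variable:
  fixes M :: "(nat, complex) mpoly set"
  assumes M: "is_ideal M" "1 \<notin> M" and max: "\<And>p. p \<notin> M \<Longrightarrow> \<exists>q. 1 - q * p \<in> M"
  shows "\<exists>a. mpoly_var v - mpoly_const a \<in> M"
proof (rule ccontr)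
  assume no: "\<not> ?thesis"
  let ?f = "\<lambda>a. mpoly_var v - mpoly_const a"
  define ev :: "complex poly \<Rightarrow> (nat, complex) mpoly"
    where "ev H = poly (map_poly mpoly_const H) (mpoly_var v)" for H
  have ev_pCons: "ev (pCons a H) = mpoly_const a + mpoly_var v * ev H" for a H
    by (simp add: ev_def map_poly_pCons)
  have ev_0 [simp]: "ev 0 = 0" by (simp add: ev_def)
  have ev_1 [simp]: "ev 1 = 1" by (simp add: one_pCons ev_pCons)
  have ev_add: "ev (H + G) = ev H + ev G" for H G
  proof -
    have "map_poly mpoly_const (H + G) =
        (map_poly mpoly_const H + map_poly mpoly_const G :: (nat, complex) mpoly poly)"
      by (rule poly_eqI) (simp add: coeff_map_poly mconst.hom_add)
    then show ?thesis by (simp add: ev_def)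
  qed
  have ev_smult: "ev (smult a H) = mpoly_const a * ev H" for a H
  proof -
    have "map_poly mpoly_const (smult a H) =
        (smult (mpoly_const a) (map_poly mpoly_const H) :: (nat, complex) mpoly poly)"
      by (rule poly_eqI) (simp add: coeff_map_poly mconst.hom_mult)
    then show ?thesis by (simp add: ev_def)
  qed
  have ev_mult: "ev (H * G) = ev H * ev G" for H G
    by (induction H) (simp_all add: mult_pCons_left ev_add ev_smult ev_pCons algebra_simps)
  have ev_sum: "ev (sum f A) = (\<Sum>i\<in>A. ev (f i))" for f and A :: "complex set"
    by (induction A rule: infinite_finite_induct) (simp_all add: ev_add)
  have ev_prod: "ev (prod f A) = (\<Prod>i\<in>A. ev (f i))" for f and A :: "complex set"
    by (induction A rule: infinite_finite_induct) (simp_all add: ev_mult)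
  have ev_lin: "ev [:- a, 1:] = ?f a" for a
    by (simp add: ev_pCons mconst.hom_uminus)
  have prime: "q \<in> M" if "p * q \<in> M" "p \<notin> M" for p q
  proof -
    obtain r where r: "1 - r * p \<in> M" using max \<open>p \<notin> M\<close> by blast
    have "q * (1 - r * p) + r * (p * q) \<in> M"
      by (rule is_ideal_add[OF M(1) is_ideal_mult[OF M(1) r] is_ideal_mult[OF M(1) that(1)]])
    then show ?thesis by (simp add: algebra_simps)
  qed
  have const: "a = 0" if a: "mpoly_const a \<in> M" for a
  proof (rule ccontr)
    assume "a \<noteq> 0"
    then have "mpoly_const (inverse a) * mpoly_const a = (1 :: (nat, complex) mpoly)"
      by (simp flip: mconst.hom_mult)
    then show False using is_ideal_mult[OF M(1) a] M(2) by metis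
  qed
  \<comment> \<open>A nonzero polynomial in \<open>v\<close> splits into linear factors; none of
    them lies in \<open>M\<close> by assumption, and \<open>M\<close> is prime.\<close>
  have ev_notin: "ev H \<notin> M" if "H \<noteq> 0" for H
    using that
  proof (induction "degree H" arbitrary: H rule: less_induct)
    case less
    show ?case
    proof (cases "degree H = 0")
      case True
      then obtain a where "H = [:a:]" by (rule degree_eq_zeroE)
      then show ?thesis using const[of a] less.prems by (auto simp: ev_pCons)
    next
      case False
      then obtain z where "poly H z = 0"
        using fundamental_theorem_of_algebra[of H] constant_degree[of H] by auto
      then obtain G where G: "H = [:- z, 1:] * G" by (metis dvdE poly_eq_0_iff_dvd)
      then have G0: "G \<noteq> 0" using less.prems by auto
      then have "degree H = 1 + degree G" unfolding G by (subst degree_mult_eq) auto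
      then have "ev G \<notin> M" using less.hyps[of G] G0 by simp
      then show ?thesis using prime[of "?f z" "ev G"] no G ev_mult ev_lin by metis
    qed
  qed
  have "\<forall>a. \<exists>q. 1 - q * ?f a \<in> M" using max no by blast
  from choice[OF this] obtain q where q: "\<And>a. 1 - q a * ?f a \<in> M" by blast
  \<comment> \<open>Pigeonhole: there are uncountably many real \<open>a\<close> but only countably
    many finite supports, so infinitely many inverses share one support \<open>F\<close> and span a
    space of dimension at most \<open>card F\<close>.\<close>
  have "\<exists>F. infinite {a::real. keys (q (complex_of_real a)) = F}"
  proof (rule ccontr)
    assume "\<not> ?thesis"
    then have fin: "finite {a::real. keys (q (complex_of_real a)) = F}" for F by blast
    let ?U = "\<Union>F\<in>{F. finite F}. {a::real. keys (q (complex_of_real a)) = F}"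
    have "countable {F :: nat monomial set. finite F}"
      using countable_Collect_finite_subset[OF countable_monomials] by simp
    then have "countable ?U"
      by (rule countable_UN) (rule countable_finite[OF fin])
    moreover have "a \<in> ?U" for a :: real
      by (rule UN_I[of "keys (q (complex_of_real a))"]) simp_all
    then have "?U = UNIV" by blast
    ultimately show False using uncountable_UNIV_real by metis
  qed
  then obtain F where F: "infinite {a::real. keys (q (complex_of_real a)) = F}" by blast
  from infinite_arbitrarily_large[OF F, of "Suc (card F)"] obtain B0
    where B0: "B0 \<subseteq> {a::real. keys (q (complex_of_real a)) = F}"
    "finite B0" "card B0 = Suc (card F)" by (elim exE conjE)
  define B where "B = complex_of_real ` B0"
  have B: "finite B" "card B = Suc (card F)" "\<And>a. a \<in> B \<Longrightarrow> keys (q a) = F"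
    using B0 by (auto simp: B_def card_image inj_on_def)
  then obtain a1 where "a1 \<in> B" by fastforce
  then have "finite F" using B(3)[of a1] by (metis finite_keys)
  from linear_dependence[OF this B(1), of "\<lambda>a. lookup (q a)"] B(2)
  obtain b a0 where a0: "a0 \<in> B" "b a0 \<noteq> 0"
    and b: "\<And>f. f \<in> F \<Longrightarrow> (\<Sum>a\<in>B. b a * lookup (q a) f) = 0" by auto
  have b0: "(\<Sum>a\<in>B. mpoly_const (b a) * q a) = 0"
  proof (rule poly_mapping_eqI)
    fix f
    have "lookup (mpoly_const (b a) * q a) f = b a * lookup (q a) f" for a
      by (simp add: mpoly_const_def mult_map_scale_conv_mult[symmetric] Poly_Mapping.map.rep_eq when_def)
    then have "lookup (\<Sum>a\<in>B. mpoly_const (b a) * q a) f =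
        (\<Sum>a\<in>B. b a * lookup (q a) f)" by (simp add: lookup_sum)
    also have "\<dots> = 0"
    proof (cases "f \<in> F")
      case False
      then have "lookup (q a) f = 0" if "a \<in> B" for a
        using B(3)[OF that] by (simp flip: not_in_keys_iff_lookup_eq_zero)
      then show ?thesis by simp
    qed (rule b)
    finally show "lookup (\<Sum>a\<in>B. mpoly_const (b a) * q a) f = lookup 0 f"
      by simp
  qed
  \<comment> \<open>This is what remains of the relation times the product of all
    \<open>v - a\<close> once each \<open>q a * (v - a)\<close> is replaced by 1. At
    \<open>a0\<close> every summand but one is zero, so \<open>H \<noteq> 0\<close>.\<close>
  define H where "H = (\<Sum>a\<in>B. [:b a:] * (\<Prod>a'\<in>B - {a}. [:- a', 1:]))"
  have "poly H a0 = (\<Sum>a\<in>B. b a * (\<Prod>a'\<in>B - {a}. a0 - a'))"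
    by (simp add: H_def poly_sum poly_prod)
  also have "\<dots> = b a0 * (\<Prod>a'\<in>B - {a0}. a0 - a')"
  proof -
    have "b a * (\<Prod>a'\<in>B - {a}. a0 - a') = 0" if "a \<in> B - {a0}" for a
      using that a0 B(1) by (auto simp: prod_zero_iff)
    then show ?thesis using a0 B(1) by (subst sum.remove[of _ a0]) (auto intro: sum.neutral)
  qed
  also have "\<dots> \<noteq> 0" using a0 B(1) by auto
  finally have "H \<noteq> 0" by auto
  then have "ev H \<notin> M" by (rule ev_notin)
  moreover have "ev H \<in> M"
  proof -
    let ?P = "\<lambda>a. \<Prod>a'\<in>B - {a}. ?f a'"
    have evH: "ev H = (\<Sum>a\<in>B. mpoly_const (b a) * ?P a)"
      by (simp add: H_def ev_sum ev_mult ev_prod ev_lin del: mult_pCons_left) (simp add: ev_pCons)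
    have "?P a * (q a * ?f a) = q a * prod ?f B" if "a \<in> B" for a
      using prod.remove[OF B(1) that, of ?f] by (simp add: mult_ac)
    then have "(\<Sum>a\<in>B. mpoly_const (b a) * ?P a * (q a * ?f a)) =
        (\<Sum>a\<in>B. mpoly_const (b a) * q a) * prod ?f B"
      unfolding sum_distrib_right by (intro sum.cong) (auto simp: mult.assoc)
    also have "\<dots> = 0" by (simp add: b0)
    finally have "ev H = (\<Sum>a\<in>B. mpoly_const (b a) * ?P a * (1 - q a * ?f a))"
      unfolding evH by (simp add: right_diff_distrib sum_subtractf)
    then show ?thesis using is_ideal_sum[OF M(1) is_ideal_mult[OF M(1) q]] by simp
  qed
  ultimately show False by blast
qed

text \<open>Modulo the maximal ideal each variable is a number, so each polynomial is congruent to
  its value at that point; a nonzero value of a member of \<open>I\<close> would be a unit inside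
  the ideal.\<close>

theorem weak_nullstellensatz:
  fixes I :: "(nat, complex) mpoly set"
  assumes "is_ideal I" "1 \<notin> I"
  shows "\<exists>a. \<forall>p\<in>I. mpoly_eval a p = 0"
proof -
  obtain M where M: "is_ideal M" "1 \<notin> M" "I \<subseteq> M" "\<And>p. p \<notin> M \<Longrightarrow> \<exists>q. 1 - q * p \<in> M"
    using maximal_ideal_exists[OF assms] by blast
  have "\<forall>v. \<exists>a. mpoly_var v - mpoly_const a \<in> M"
    using maximal_ideal_variable[OF M(1,2,4)] by blast
  from choice[OF this] obtain a where a: "\<And>v. mpoly_var v - mpoly_const (a v) \<in> M" by blast
  have mod: "p - mpoly_const (mpoly_eval a p) \<in> M" for p
  proof -
    have "p \<in> polys_in UNIV" by simp
    then show ?thesis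
      unfolding mpoly_eval_conv_insertion
    proof (induction p rule: polys_in_induct)
      case (add p q)
      from is_ideal_add[OF M(1) this] show ?case
        by (simp add: ins_id.hom_add mconst.hom_add algebra_simps)
    next
      case (mult p q)
      let ?c = "\<lambda>p. mpoly_const (insertion (\<lambda>a. a) a p) :: (nat, complex) mpoly"
      have "q * (p - ?c p) + ?c p * (q - ?c q) \<in> M"
        using mult M(1) by (intro is_ideal_add is_ideal_mult)
      then show ?case by (simp add: ins_id.hom_mult mconst.hom_mult algebra_simps)
    qed (use a is_ideal_0[OF M(1)] in auto)
  qed
  have "mpoly_eval a p = 0" if p: "p \<in> I" for p
  proof (rule ccontr)
    let ?c = "mpoly_eval a p"
    assume nz: "?c \<noteq> 0"
    have "p - (p - mpoly_const ?c) \<in> M" using is_ideal_diff[OF M(1) _ mod] p M(3) by blast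
    then have "mpoly_const ?c \<in> M" by simp
    then have "mpoly_const (inverse ?c) * mpoly_const ?c \<in> M" by (rule is_ideal_mult[OF M(1)])
    then have "mpoly_const (inverse ?c * ?c) \<in> M" by (simp only: mconst.hom_mult)
    then show False using nz M(2) by simp
  qed
  then show ?thesis by blast
qed

section \<open>Forms without a common zero generate all monomials of some degree\<close>

context form_system
begin

definition form_poly :: "(nat \<times> nat monomial \<Rightarrow> complex) \<Rightarrow> nat \<Rightarrow> (nat, complex) mpoly" where
  "form_poly c i = (\<Sum>\<alpha>\<in>mons i. single \<alpha> (c (i, \<alpha>)))"

definition form_ideal :: "(nat \<times> nat monomial \<Rightarrow> complex) \<Rightarrow> (nat, complex) mpoly set" where
  "form_ideal c = {\<Sum>i<n. g i * form_poly c i | g. True}"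

lemma mpoly_eval_form_poly: "mpoly_eval x (form_poly c i) = form c i x"
  by (simp add: mpoly_eval_conv_insertion form_poly_def form_def ins_id.hom_sum
      comm_ring_hom.insertion_single[OF comm_ring_hom_id])

lemma sum_in_form_ideal: "(\<Sum>i<n. g i * form_poly c i) \<in> form_ideal c"
  by (auto simp: form_ideal_def)

lemma is_ideal_form_ideal: "is_ideal (form_ideal c)"
  unfolding is_ideal_def
proof (intro conjI ballI allI)
  show "0 \<in> form_ideal c" using sum_in_form_ideal[of "\<lambda>_. 0"] by simp
  fix p assume "p \<in> form_ideal c"
  then obtain g where g: "p = (\<Sum>i<n. g i * form_poly c i)" by (auto simp: form_ideal_def)
  show "r * p \<in> form_ideal c" for r
    using sum_in_form_ideal[of "\<lambda>i. r * g i"] by (simp add: g sum_distrib_left mult.assoc)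
  fix q assume "q \<in> form_ideal c"
  then obtain h where h: "q = (\<Sum>i<n. h i * form_poly c i)" by (auto simp: form_ideal_def)
  show "p + q \<in> form_ideal c"
    using sum_in_form_ideal[of "\<lambda>i. g i + h i"] by (simp add: g h sum.distrib distrib_right)
qed

lemma form_poly_in_ideal: "i < n \<Longrightarrow> form_poly c i \<in> form_ideal c"
  using sum_in_form_ideal[of "\<lambda>k. if k = i then 1 else 0" c] by (simp add: if_distrib[of "\<lambda>x. x * _"] cong: if_cong)

text \<open>The coefficients of \<open>grade h\<close> are the homogeneous components of \<open>h\<close>.\<close>

definition grade :: "(nat, complex) mpoly \<Rightarrow> (nat, complex) mpoly poly" where
  "grade = insertion (\<lambda>a. [:mpoly_const a:]) (\<lambda>v. monom (mpoly_var v) 1)"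

lemma comm_ring_hom_grade: "comm_ring_hom grade"
  unfolding grade_def by (rule comm_ring_hom.comm_ring_hom_insertion[OF comm_ring_hom_const_poly])

lemma grade_form_poly: "grade (form_poly c i) = monom (form_poly c i) (ds i)"
proof -
  interpret comm_ring_hom grade by (rule comm_ring_hom_grade)
  have "grade (single \<alpha> a) = monom (single \<alpha> a) (ds i)"
    if \<alpha>: "\<alpha> \<in> mons i" for \<alpha> a
  proof -
    have "mono_eval (\<lambda>v. monom (mpoly_var v :: (nat, complex) mpoly) 1) \<alpha> =
        (\<Prod>v\<in>keys \<alpha>. monom 1 (lookup \<alpha> v) * [:mpoly_var v ^ lookup \<alpha> v:])"
      unfolding mono_eval_def by (intro prod.cong) (simp_all add: monom_power smult_monom)
    also have "\<dots> = monom 1 (\<Sum>v\<in>keys \<alpha>. lookup \<alpha> v) * [:mono_eval mpoly_var \<alpha>:]"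
    proof -
      have "(\<Prod>v\<in>V. monom 1 (k v) * [:b v:]) = monom 1 (\<Sum>v\<in>V. k v) * [:\<Prod>v\<in>V. b v:]"
        if "finite V" for V k and b :: "nat \<Rightarrow> (nat, complex) mpoly"
        using that by (induction V) (simp_all add: smult_monom mult_monom one_pCons[symmetric])
      then show ?thesis by (simp add: mono_eval_def)
    qed
    also have "\<dots> = monom (single \<alpha> 1) (ds i)"
      using \<alpha> by (simp add: mono_eval_var monomials_of_degree_def smult_monom)
    finally show ?thesis
      unfolding grade_def comm_ring_hom.insertion_single[OF comm_ring_hom_const_poly]
      by (simp add: smult_monom mpoly_const_def Poly_Mapping.mult_single)
  qed
  then have "grade (form_poly c i) = (\<Sum>\<alpha>\<in>mons i. monom (single \<alpha> (c (i, \<alpha>))) (ds i))"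
    by (simp add: form_poly_def hom_sum)
  then show ?thesis
    unfolding form_poly_def by (simp add: poly_eq_iff coeff_sum coeff_monom)
qed

text \<open>Setting the variable equal to 1 leaves no common zero, so 1 is a combination of the
  forms and \<open>x - 1\<close>. The homogeneous components of this identity turn it into a power
  of the variable inside the ideal.\<close>

lemma variable_power_in_ideal:
  assumes c: "\<not> has_zero c" and j: "j < n"
  shows "\<exists>k. mpoly_var j ^ k \<in> form_ideal c"
proof -
  let ?x = "mpoly_var j :: (nat, complex) mpoly"
  define I where "I = {p + h * (?x - 1) | p h. p \<in> form_ideal c}"
  have I: "p + h * (?x - 1) \<in> I" if "p \<in> form_ideal c" for p h
    using that by (auto simp: I_def)
  note ideal = is_ideal_form_ideal[of c]
  have "is_ideal I"
    unfolding is_ideal_def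
  proof (intro conjI ballI allI)
    show "0 \<in> I" using I[OF is_ideal_0[OF ideal], of 0] by simp
    fix p assume "p \<in> I"
    then obtain p' h where p: "p' \<in> form_ideal c" "p = p' + h * (?x - 1)" by (auto simp: I_def)
    show "r * p \<in> I" for r
      using I[OF is_ideal_mult[OF ideal p(1)], of r "r * h"] by (simp add: p(2) algebra_simps)
    fix q assume "q \<in> I"
    then obtain q' h' where q: "q' \<in> form_ideal c" "q = q' + h' * (?x - 1)" by (auto simp: I_def)
    show "p + q \<in> I"
      using I[OF is_ideal_add[OF ideal p(1) q(1)], of "h + h'"] by (simp add: p(2) q(2) algebra_simps)
  qed
  moreover have "\<not> (\<exists>a. \<forall>p\<in>I. mpoly_eval a p = 0)"
  proof
    assume "\<exists>a. \<forall>p\<in>I. mpoly_eval a p = 0"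
    then obtain a where a: "\<And>p. p \<in> I \<Longrightarrow> mpoly_eval a p = 0" by blast
    have "form c i a = 0" if "i < n" for i
      using a[of "form_poly c i"] I[OF form_poly_in_ideal[OF that], of 0]
      by (simp add: mpoly_eval_form_poly)
    moreover have "a j = 1"
      using a[of "?x - 1"] I[OF is_ideal_0[OF ideal], of 1]
      by (simp add: mpoly_eval_conv_insertion ins_id.hom_minus)
    ultimately show False using c j unfolding has_zero_def by (metis zero_neq_one)
  qed
  ultimately have "1 \<in> I" using weak_nullstellensatz by blast
  then obtain g h where gh: "1 = (\<Sum>i<n. g i * form_poly c i) + h * (?x - 1)"
    by (auto simp: I_def form_ideal_def)
  interpret G: comm_ring_hom grade by (rule comm_ring_hom_grade)
  define E where "E = (\<Sum>i<n. monom (form_poly c i) (ds i) * grade (g i))"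
  have "grade ?x = monom ?x 1"
    by (simp add: grade_def comm_ring_hom.insertion_var[OF comm_ring_hom_const_poly])
  then have "1 = E + grade h * (monom ?x 1 - 1)"
    using arg_cong[OF gh, of grade]
    by (simp add: G.hom_add G.hom_sum G.hom_mult G.hom_minus grade_form_poly E_def mult.commute)
  then have eq: "E = 1 - monom ?x 1 * grade h + grade h" by (simp add: algebra_simps)
  have E: "coeff E k \<in> form_ideal c" for k
    unfolding E_def coeff_sum
  proof (rule is_ideal_sum[OF ideal])
    fix i assume "i \<in> {..<n}"
    then have "coeff (grade (g i)) (k - ds i) * form_poly c i \<in> form_ideal c"
      by (intro is_ideal_mult[OF ideal] form_poly_in_ideal) simp
    then have "form_poly c i * coeff (grade (g i)) (k - ds i) \<in> form_ideal c"
      by (simp add: mult.commute)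
    then show "coeff (monom (form_poly c i) (ds i) * grade (g i)) k \<in> form_ideal c"
      using is_ideal_0[OF ideal] by (auto simp: coeff_monom_mult)
  qed
  \<comment> \<open>Telescoping: in degree \<open>k + 1\<close> the identity says that
    \<open>h_(k+1) - x * h_k\<close> lies in the ideal, where \<open>h_k\<close> is the component of
    \<open>h\<close>. Beyond the degree of \<open>grade h\<close> only the power of \<open>x\<close>
    is left.\<close>
  have "?x ^ k + coeff (grade h) k \<in> form_ideal c" for k
  proof (induction k)
    case 0
    have "coeff E 0 = 1 + coeff (grade h) 0" by (simp add: eq coeff_monom_mult)
    then show ?case using E[of 0] by simp
  next
    case (Suc k)
    have "coeff E (Suc k) = coeff (grade h) (Suc k) - ?x * coeff (grade h) k"
      by (simp add: eq coeff_monom_mult coeff_1)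
    then have "?x ^ Suc k + coeff (grade h) (Suc k) = ?x * (?x ^ k + coeff (grade h) k) + coeff E (Suc k)"
      by (simp add: algebra_simps)
    then show ?case using is_ideal_add[OF ideal is_ideal_mult[OF ideal Suc, of ?x] E[of "Suc k"]] by simp
  qed
  from this[of "Suc (degree (grade h))"] have "?x ^ Suc (degree (grade h)) \<in> form_ideal c"
    by (simp add: coeff_eq_0 del: power_Suc)
  then show ?thesis by blast
qed

text \<open>A linear functional \<open>v\<close> on forms of degree \<open>N\<close>, given by its values on monomials, kills
  the multiples of the forms of the system.\<close>

definition annihilates :: "(nat \<times> nat monomial \<Rightarrow> complex) \<Rightarrow> (nat monomial \<Rightarrow> complex) \<Rightarrow>
    nat \<Rightarrow> nat monomial \<Rightarrow> bool" where
  "annihilates c v i \<beta> \<longleftrightarrow> (\<Sum>\<alpha>\<in>mons i. c (i, \<alpha>) * v (\<beta> + \<alpha>)) = 0"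

definition row_index :: "nat \<Rightarrow> (nat \<times> nat monomial) set" where
  "row_index N = (SIGMA i:{..<n}. homs (N - ds i))"

lemma finite_row_index [simp]: "finite (row_index N)"
  by (simp add: row_index_def)

lemma monomial_quotient:
  assumes "\<alpha> \<in> homs d" "\<beta> + \<alpha> \<in> homs N"
  shows "\<beta> \<in> homs (N - d)"
proof -
  have "keys \<beta> \<subseteq> keys (\<beta> + \<alpha>)"
    by (auto simp: in_keys_iff lookup_add)
  then show ?thesis using assms by (auto simp: monomials_of_degree_iff lookup_add sum.distrib)
qed

text \<open>Dual form of the statement that the ideal contains every monomial of degree
  \<open>N\<close>: each is divisible by one of the variable powers in the ideal, and a functional
  killing all multiples of the forms kills the ideal.\<close>

lemma annihilator_trivial:
  assumes c: "\<not> has_zero c"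
  shows "\<exists>N. (\<forall>i<n. ds i \<le> N) \<and>
    (\<forall>v. (\<forall>(i, \<beta>)\<in>row_index N. annihilates c v i \<beta>) \<longrightarrow> (\<forall>\<gamma>\<in>homs N. v \<gamma> = 0))"
proof -
  note ideal = is_ideal_form_ideal[of c]
  have "\<forall>j. \<exists>k. j < n \<longrightarrow> mpoly_var j ^ k \<in> form_ideal c"
    using variable_power_in_ideal[OF c] by blast
  from choice[OF this] obtain k where k: "\<And>j. j < n \<Longrightarrow> mpoly_var j ^ k j \<in> form_ideal c" by blast
  \<comment> \<open>\<open>K\<close> exceeds every exponent \<open>k j\<close>. The summand
    \<open>n * K\<close> of \<open>N\<close> forces some exponent of each monomial of degree
    \<open>N\<close> to reach \<open>K\<close>; the other summand ensures
    \<open>ds i \<le> N\<close>.\<close>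
  define K where "K = Suc (\<Sum>j<n. k j)"
  define N where "N = n * K + (\<Sum>i<n. ds i)"
  have ds_le: "ds i \<le> N" if "i < n" for i
    using that member_le_sum[of i "{..<n}" ds] by (simp add: N_def)
  have "v \<gamma> = 0"
    if ann: "\<forall>(i, \<beta>)\<in>row_index N. annihilates c v i \<beta>" and \<gamma>: "\<gamma> \<in> homs N" for v \<gamma>
  proof -
    \<comment> \<open>The functional reads only terms of degree \<open>N\<close>, so homogeneous
      multiples of the forms in any other degree are killed at once.\<close>
    define l where "l p = (\<Sum>\<gamma>\<in>homs N. v \<gamma> * lookup p \<gamma>)" for p
    have l_add: "l (p + q) = l p + l q" for p q
      by (simp add: l_def lookup_add distrib_left sum.distrib)
    have l_0: "l 0 = 0" by (simp add: l_def)
    have l_sum: "l (sum f A) = (\<Sum>a\<in>A. l (f a))" for f :: "'x \<Rightarrow> _" and A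
      by (induction A rule: infinite_finite_induct) (simp_all add: l_add l_0)
    have l_single: "l (single \<delta> b) = (if \<delta> \<in> homs N then v \<delta> * b else 0)" for \<delta> b
      by (simp add: l_def lookup_single when_def if_distrib[of "(*) _"] sum.delta cong: if_cong)
    have term_0: "l (single \<beta> b * form_poly c i) = 0" if i: "i < n" for \<beta> b i
    proof (cases "\<beta> \<in> homs (N - ds i)")
      case True
      have "\<beta> + \<alpha> \<in> homs N" if "\<alpha> \<in> mons i" for \<alpha>
        using monomials_of_degree_add[OF True that] ds_le[OF i] by simp
      then have "l (single \<beta> b * form_poly c i) = b * (\<Sum>\<alpha>\<in>mons i. c (i, \<alpha>) * v (\<beta> + \<alpha>))"
        by (simp add: form_poly_def sum_distrib_left Poly_Mapping.mult_single l_sum l_single mult_ac)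
      also have "(\<Sum>\<alpha>\<in>mons i. c (i, \<alpha>) * v (\<beta> + \<alpha>)) = 0"
        using ann i True by (auto simp: row_index_def annihilates_def)
      finally show ?thesis by simp
    next
      case False
      then have "\<beta> + \<alpha> \<notin> homs N" if "\<alpha> \<in> mons i" for \<alpha>
        using monomial_quotient that by blast
      then show ?thesis
        by (simp add: form_poly_def sum_distrib_left Poly_Mapping.mult_single l_sum l_single)
    qed
    have "l (g * form_poly c i) = 0" if "i < n" for g i
    proof -
      have "g * form_poly c i = (\<Sum>\<beta>\<in>keys g.
          single \<beta> (lookup g \<beta>) * form_poly c i)"
        unfolding sum_distrib_right[symmetric] by (simp flip: mpoly_as_sum)
      then show ?thesis using term_0[OF that] by (simp add: l_sum)
    qed
    then have l_ideal: "l p = 0" if "p \<in> form_ideal c" for p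
      using that by (auto simp: form_ideal_def l_sum)
    have "\<exists>j<n. K \<le> lookup \<gamma> j"
    proof (rule ccontr)
      assume "\<not> ?thesis"
      then have "(\<Sum>j<n. lookup \<gamma> j) < (\<Sum>j<n. K)"
        using n_pos by (intro sum_strict_mono) (auto simp: not_le lessThan_empty_iff)
      then show False using \<gamma> by (simp add: monomials_of_degree_iff N_def)
    qed
    then obtain j where j: "j < n" "K \<le> lookup \<gamma> j" by blast
    moreover have "k j \<le> K" using j member_le_sum[of j "{..<n}" k] by (simp add: K_def)
    ultimately have kj: "k j \<le> lookup \<gamma> j" by simp
    define \<delta> where "\<delta> = \<gamma> - single j (k j)"
    have "\<gamma> = \<delta> + single j (k j)"
      using kj by (intro poly_mapping_eqI) (auto simp: \<delta>_def lookup_add lookup_minus lookup_single when_def)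
    moreover have "mpoly_var j ^ k j = (single (single j (k j)) 1 :: (nat, complex) mpoly)"
      using mono_eval_var[of "single j (k j)"] by simp
    ultimately have "single \<gamma> (1 :: complex) = single \<delta> 1 * mpoly_var j ^ k j"
      by (simp add: Poly_Mapping.mult_single)
    also have "\<dots> \<in> form_ideal c" using k[OF j(1)] by (rule is_ideal_mult[OF ideal])
    finally have "l (single \<gamma> 1) = 0" by (rule l_ideal)
    then show ?thesis using \<gamma> by (simp add: l_single)
  qed
  with ds_le show ?thesis by blast
qed

end

text \<open>A minimal subfamily forcing \<open>v = 0\<close> is linearly independent.\<close>

lemma select_conditions:
  fixes g :: "'w \<Rightarrow> 'f \<Rightarrow> 'a::field"
  assumes "finite F" "finite W"
    and W: "\<And>v. (\<forall>w\<in>W. (\<Sum>f\<in>F. g w f * v f) = 0) \<Longrightarrow> \<forall>f\<in>F. v f = 0"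
  shows "\<exists>W'\<subseteq>W. card W' \<le> card F \<and> (\<forall>v. (\<forall>w\<in>W'. (\<Sum>f\<in>F. g w f * v f) = 0) \<longrightarrow> (\<forall>f\<in>F. v f = 0))"
proof -
  let ?triv = "\<lambda>W'. \<forall>v. (\<forall>w\<in>W'. (\<Sum>f\<in>F. g w f * v f) = 0) \<longrightarrow> (\<forall>f\<in>F. v f = 0)"
  obtain W' where W': "W' \<subseteq> W" "?triv W'"
    and min: "\<And>V. V \<subseteq> W \<Longrightarrow> ?triv V \<Longrightarrow> card W' \<le> card V"
    using ex_has_least_nat[of "\<lambda>V. V \<subseteq> W \<and> ?triv V" W card] W by auto
  have fin: "finite W'" using W'(1) assms(2) finite_subset by blast
  have "card W' \<le> card F"
  proof (rule ccontr)
    assume "\<not> ?thesis"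
    then obtain b w0 where w0: "w0 \<in> W'" "b w0 \<noteq> 0"
      and b: "\<And>f. f \<in> F \<Longrightarrow> (\<Sum>w\<in>W'. b w * g w f) = 0"
      using linear_dependence[OF assms(1) fin, of g] by auto
    \<comment> \<open>The relation expresses condition \<open>w0\<close> through the others, so
      dropping it contradicts minimality.\<close>
    have "?triv (W' - {w0})"
    proof (intro allI impI)
      fix v assume v: "\<forall>w\<in>W' - {w0}. (\<Sum>f\<in>F. g w f * v f) = 0"
      have "(\<Sum>w\<in>W'. b w * (\<Sum>f\<in>F. g w f * v f)) = (\<Sum>f\<in>F. (\<Sum>w\<in>W'. b w * g w f) * v f)"
        unfolding sum_distrib_left sum_distrib_right
        by (subst sum.swap) (simp add: mult.assoc)
      also have "\<dots> = 0" using b by simp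
      also have "(\<Sum>w\<in>W'. b w * (\<Sum>f\<in>F. g w f * v f)) = b w0 * (\<Sum>f\<in>F. g w0 f * v f)"
        using v w0 fin by (subst sum.remove[of _ w0]) (auto intro: sum.neutral)
      finally have "(\<Sum>f\<in>F. g w0 f * v f) = 0" using w0 by simp
      then show "\<forall>f\<in>F. v f = 0" using W'(2) v by blast
    qed
    then have "card W' \<le> card (W' - {w0})" using min W'(1) by blast
    then show False using w0 fin by (metis card_Diff1_less leD)
  qed
  then show ?thesis using W' by blast
qed

section \<open>Macaulay determinants\<close>

context form_system
begin

text \<open>The columns correspond via \<open>e\<close> to the monomials of degree \<open>N\<close>; the row \<open>(i, \<beta>) = r a\<close>
  lists the coefficients of \<open>x\<^sup>\<beta> f\<^sub>i\<close>.\<close>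

definition macaulay_matrix ::
    "(nat \<Rightarrow> nat \<times> nat monomial) \<Rightarrow> (nat \<Rightarrow> nat monomial) \<Rightarrow> nat \<Rightarrow> coeff_poly mat" where
  "macaulay_matrix r e m = mat m m (\<lambda>(a, b).
     \<Sum>\<alpha>\<in>mons (fst (r a)). if e b = snd (r a) + \<alpha> then mpoly_var (fst (r a), \<alpha>) else 0)"

lemma macaulay_carrier [simp]: "macaulay_matrix r e m \<in> carrier_mat m m"
  by (simp add: macaulay_matrix_def)

lemma insertion_macaulay:
  "ieval c (det (macaulay_matrix r e m)) = det (mat m m (\<lambda>(a, b).
     \<Sum>\<alpha>\<in>mons (fst (r a)). if e b = snd (r a) + \<alpha> then c (fst (r a), \<alpha>) else 0))"
proof -
  have "map_mat (ieval c) (macaulay_matrix r e m) = mat m m (\<lambda>(a, b).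
     \<Sum>\<alpha>\<in>mons (fst (r a)). if e b = snd (r a) + \<alpha> then c (fst (r a), \<alpha>) else 0)"
    unfolding macaulay_matrix_def
    by (rule eq_matI) (auto simp: ins_int.hom_sum if_distrib[of "ieval c"] intro!: sum.cong)
  then show ?thesis
    using ins_int.hom_det[of c "macaulay_matrix r e m"] by simp
qed

lemma indetsI: "i < n \<Longrightarrow> \<alpha> \<in> mons i \<Longrightarrow> (i, \<alpha>) \<in> indets"
  by (simp add: indets_def)

lemma row_index_fst: "w \<in> row_index N \<Longrightarrow> fst w < n"
  by (auto simp: row_index_def)

lemma macaulay_in:
  assumes "\<And>a. a < m \<Longrightarrow> fst (r a) < n"
  shows "det (macaulay_matrix r e m) \<in> polys_in indets"
proof -
  interpret dom_subring "polys_in indets :: coeff_poly set" by (rule dom_subring_polys_in)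
  have entry: "macaulay_matrix r e m $$ (a, b) \<in> polys_in indets" if "a < m" "b < m" for a b
    using that assms[of a]
    by (auto simp: macaulay_matrix_def intro!: sum_in var_in_polys_in indetsI)
  have sign: "signof p \<in> (polys_in indets :: coeff_poly set)" for p
    using uminus_in[OF one_in] by (simp add: sign_def)
  have prod: "prod f A \<in> polys_in indets" if "\<And>a. a \<in> A \<Longrightarrow> f a \<in> polys_in indets"
    for f :: "nat \<Rightarrow> coeff_poly" and A
    using that by (induction A rule: infinite_finite_induct) (auto intro: mult_in)
  show ?thesis
    unfolding det_def'[OF macaulay_carrier]
    by (intro sum_in mult_in sign prod entry) (auto simp: permutes_in_image dest: permutes_in_image)
qed

lemma row_sum:
  fixes c :: "nat \<times> nat monomial \<Rightarrow> 'a::comm_ring_1"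
  assumes e: "bij_betw e {..<m} (homs N)"
    and r: "(i, \<beta>) \<in> row_index N" "ds i \<le> N"
  shows "(\<Sum>b<m. (\<Sum>\<alpha>\<in>mons i. if e b = \<beta> + \<alpha> then c (i, \<alpha>) else 0) * w (e b)) =
    (\<Sum>\<alpha>\<in>mons i. c (i, \<alpha>) * w (\<beta> + \<alpha>))"
proof -
  have mem: "\<beta> + \<alpha> \<in> homs N" if "\<alpha> \<in> mons i" for \<alpha>
    using monomials_of_degree_add[of \<beta> n "N - ds i" \<alpha> "ds i"] r that by (simp add: row_index_def)
  have "(\<Sum>b<m. (\<Sum>\<alpha>\<in>mons i. if e b = \<beta> + \<alpha> then c (i, \<alpha>) else 0) * w (e b)) =
      (\<Sum>\<gamma>\<in>homs N. (\<Sum>\<alpha>\<in>mons i. if \<gamma> = \<beta> + \<alpha> then c (i, \<alpha>) else 0) * w \<gamma>)"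
    by (rule sum.reindex_bij_betw[OF e])
  also have "\<dots> = (\<Sum>\<alpha>\<in>mons i. \<Sum>\<gamma>\<in>homs N. if \<gamma> = \<beta> + \<alpha> then c (i, \<alpha>) * w \<gamma> else 0)"
    unfolding sum_distrib_right by (subst sum.swap) (simp add: if_distrib[of "\<lambda>x. x * _"] cong: if_cong)
  also have "\<dots> = (\<Sum>\<alpha>\<in>mons i. c (i, \<alpha>) * w (\<beta> + \<alpha>))"
    using mem by (simp add: sum.delta)
  finally show ?thesis .
qed

lemma macaulay_mult_vec:
  fixes c :: "nat \<times> nat monomial \<Rightarrow> 'a::comm_ring_1"
  assumes e: "bij_betw e {..<m} (homs N)"
    and r: "\<And>a. a < m \<Longrightarrow> r a \<in> row_index N" and ds: "\<And>i. i < n \<Longrightarrow> ds i \<le> N"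
  shows "mat m m (\<lambda>(a, b). \<Sum>\<alpha>\<in>mons (fst (r a)). if e b = snd (r a) + \<alpha> then c (fst (r a), \<alpha>) else 0)
      *\<^sub>v vec m (\<lambda>b. w (e b)) =
    vec m (\<lambda>a. \<Sum>\<alpha>\<in>mons (fst (r a)). c (fst (r a), \<alpha>) * w (snd (r a) + \<alpha>))"
proof (rule eq_vecI)
  fix a assume "a < dim_vec (vec m (\<lambda>a. \<Sum>\<alpha>\<in>mons (fst (r a)). c (fst (r a), \<alpha>) * w (snd (r a) + \<alpha>)))"
  then have a: "a < m" by simp
  obtain i \<beta> where ra: "r a = (i, \<beta>)" by force
  then have "(i, \<beta>) \<in> row_index N" "ds i \<le> N" using r[OF a] ds by (auto simp: row_index_def)
  from row_sum[OF e this, of c w] ra a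
  show "(mat m m (\<lambda>(a, b). \<Sum>\<alpha>\<in>mons (fst (r a)). if e b = snd (r a) + \<alpha> then c (fst (r a), \<alpha>) else 0)
      *\<^sub>v vec m (\<lambda>b. w (e b))) $ a =
    vec m (\<lambda>a. \<Sum>\<alpha>\<in>mons (fst (r a)). c (fst (r a), \<alpha>) * w (snd (r a) + \<alpha>)) $ a"
    by (simp add: scalar_prod_def atLeast0LessThan cong: if_cong)
qed simp

text \<open>At a common zero \<open>x\<close> the vector of all monomial values lies in the kernel
  of the matrix; its entry for the pure power of a nonzero coordinate shows that it is not
  zero.\<close>

lemma vanishing_macaulay:
  assumes e: "bij_betw e {..<m} (homs N)"
    and r: "\<And>a. a < m \<Longrightarrow> r a \<in> row_index N" and ds: "\<And>i. i < n \<Longrightarrow> ds i \<le> N"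
  shows "vanishing (det (macaulay_matrix r e m))"
  unfolding vanishing_def
proof (intro allI impI)
  fix c assume "has_zero c"
  then obtain x j where x: "j < n" "x j \<noteq> 0" "\<And>i. i < n \<Longrightarrow> form c i x = 0"
    unfolding has_zero_def by blast
  let ?M = "mat m m (\<lambda>(a, b). \<Sum>\<alpha>\<in>mons (fst (r a)). if e b = snd (r a) + \<alpha> then c (fst (r a), \<alpha>) else 0)"
  let ?v = "vec m (\<lambda>b. mono_eval x (e b))"
  have "(\<Sum>\<alpha>\<in>mons i. c (i, \<alpha>) * mono_eval x (\<beta> + \<alpha>)) = mono_eval x \<beta> * form c i x" for i \<beta>
    by (simp add: form_def mono_eval_add sum_distrib_left mult_ac)
  then have "vec m (\<lambda>a. \<Sum>\<alpha>\<in>mons (fst (r a)). c (fst (r a), \<alpha>) * mono_eval x (snd (r a) + \<alpha>)) = 0\<^sub>v m"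
    using r x(3) by (intro eq_vecI) (force simp: row_index_def)+
  then have "?M *\<^sub>v ?v = 0\<^sub>v m"
    using macaulay_mult_vec[OF e r ds, where c = c and w = "mono_eval x"] by simp
  moreover have "?v \<noteq> 0\<^sub>v m"
  proof
    assume v0: "?v = 0\<^sub>v m"
    have "single j N \<in> homs N" using x by simp
    then obtain b where b: "b < m" "e b = single j N"
      using e unfolding bij_betw_def by (metis imageE lessThan_iff)
    have "?v $ b = 0" using v0 b by simp
    then show False using b x(2) by simp
  qed
  ultimately have "det ?M = 0"
    by (subst det_0_iff_vec_prod_zero) (auto intro!: exI[of _ ?v])
  then show "ieval c (det (macaulay_matrix r e m)) = 0"
    by (simp add: insertion_macaulay)
qed

lemma enumerate_finite: "finite A \<Longrightarrow> \<exists>e. bij_betw e {..<card A} A"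
  using ex_bij_betw_nat_finite[of A] by (simp add: atLeast0LessThan)

text \<open>The rows of all multiples of the forms have trivial common kernel at \<open>c\<close>.
  Selecting at most as many rows as there are columns gives a square matrix that is invertible at
  \<open>c\<close>.\<close>

lemma nonvanishing_at:
  assumes c: "\<not> has_zero c"
  shows "\<exists>P. P \<in> polys_in indets \<and> vanishing P \<and> ieval c P \<noteq> 0"
proof -
  obtain N where N: "\<And>i. i < n \<Longrightarrow> ds i \<le> N"
    and triv: "\<And>v. \<forall>(i, \<beta>)\<in>row_index N. annihilates c v i \<beta> \<Longrightarrow> \<forall>\<gamma>\<in>homs N. v \<gamma> = 0"
    using annihilator_trivial[OF c] by blast
  let ?F = "homs N"
  define g where "g = (\<lambda>(i, \<beta>) \<gamma>. \<Sum>\<alpha>\<in>mons i. if \<gamma> = \<beta> + \<alpha> then c (i, \<alpha>) else 0)"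
  define m where "m = card ?F"
  obtain e where e: "bij_betw e {..<m} ?F"
    unfolding m_def using enumerate_finite finite_monomials_of_degree by blast
  have g_sum: "(\<Sum>\<gamma>\<in>?F. g (i, \<beta>) \<gamma> * v \<gamma>) = (\<Sum>\<alpha>\<in>mons i. c (i, \<alpha>) * v (\<beta> + \<alpha>))"
    if "(i, \<beta>) \<in> row_index N" for i \<beta> v
  proof -
    have "ds i \<le> N" using that N by (simp add: row_index_def)
    from row_sum[OF e that this, of c v] show ?thesis
      by (simp add: g_def sum.reindex_bij_betw[OF e, symmetric])
  qed
  have "\<exists>W\<subseteq>row_index N. card W \<le> card ?F \<and>
      (\<forall>v. (\<forall>w\<in>W. (\<Sum>\<gamma>\<in>?F. g w \<gamma> * v \<gamma>) = 0) \<longrightarrow> (\<forall>\<gamma>\<in>?F. v \<gamma> = 0))"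
  proof (rule select_conditions)
    fix v assume "\<forall>w\<in>row_index N. (\<Sum>\<gamma>\<in>?F. g w \<gamma> * v \<gamma>) = 0"
    then have "\<forall>(i, \<beta>)\<in>row_index N. annihilates c v i \<beta>"
      using g_sum by (auto simp: annihilates_def)
    then show "\<forall>\<gamma>\<in>?F. v \<gamma> = 0" by (rule triv)
  qed simp_all
  then obtain W where W: "W \<subseteq> row_index N" "card W \<le> m"
    and W_triv: "\<And>v. \<forall>w\<in>W. (\<Sum>\<gamma>\<in>?F. g w \<gamma> * v \<gamma>) = 0 \<Longrightarrow> \<forall>\<gamma>\<in>?F. v \<gamma> = 0"
    unfolding m_def by blast
  have finW: "finite W" using W(1) by (rule finite_subset) simp
  have "single 0 N \<in> ?F" using n_pos by simp
  then have "W \<noteq> {}" using W_triv[of "\<lambda>_. 1"] by auto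
  obtain f where f: "bij_betw f {..<card W} W" using enumerate_finite[OF finW] by blast
  \<comment> \<open>The matrix has to be square: rows beyond \<open>card W\<close> repeat
    \<open>f 0\<close>, which leaves the common kernel of the rows unchanged.\<close>
  define r where "r a = (if a < card W then f a else f 0)" for a
  have "0 < card W" using finW \<open>W \<noteq> {}\<close> by (simp add: card_gt_0_iff)
  then have rW: "r a \<in> W" for a using f by (auto simp: r_def bij_betw_def)
  have W_sub: "w \<in> r ` {..<m}" if "w \<in> W" for w
  proof -
    have "w \<in> f ` {..<card W}" using f that by (simp add: bij_betw_def)
    then obtain a where "a < card W" "w = f a" by blast
    then show ?thesis using W(2) by (intro image_eqI[of _ _ a]) (auto simp: r_def)
  qed
  have r: "r a \<in> row_index N" for a using rW W(1) by blast
  let ?D = "det (macaulay_matrix r e m)"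
  let ?M = "mat m m (\<lambda>(a, b). \<Sum>\<alpha>\<in>mons (fst (r a)). if e b = snd (r a) + \<alpha> then c (fst (r a), \<alpha>) else 0)"
  have "det ?M \<noteq> 0"
  proof
    assume "det ?M = 0"
    then obtain v where v: "v \<in> carrier_vec m" "v \<noteq> 0\<^sub>v m" "?M *\<^sub>v v = 0\<^sub>v m"
      by (subst (asm) det_0_iff_vec_prod_zero) auto
    define w where "w \<gamma> = v $ (the_inv_into {..<m} e \<gamma>)" for \<gamma>
    have we: "w (e b) = v $ b" if "b < m" for b
      using that e by (simp add: w_def bij_betw_def the_inv_into_f_f)
    have "v = vec m (\<lambda>b. w (e b))" using v(1) we by (intro eq_vecI) auto
    then have *: "vec m (\<lambda>a. \<Sum>\<alpha>\<in>mons (fst (r a)). c (fst (r a), \<alpha>) * w (snd (r a) + \<alpha>)) = 0\<^sub>v m"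
      using v(3) macaulay_mult_vec[OF e r N, where c = c and w = w] by simp
    have "(\<Sum>\<gamma>\<in>?F. g u \<gamma> * w \<gamma>) = 0" if uW: "u \<in> W" for u
    proof -
      obtain a where a: "a < m" "u = r a" using W_sub[OF uW] by blast
      have "vec m (\<lambda>a. \<Sum>\<alpha>\<in>mons (fst (r a)). c (fst (r a), \<alpha>) * w (snd (r a) + \<alpha>)) $ a = 0"
        using a unfolding * by simp
      then show ?thesis using a g_sum[of "fst u" "snd u" w] r[of a] by simp
    qed
    then have w0: "\<forall>\<gamma>\<in>?F. w \<gamma> = 0" using W_triv by blast
    have "v $ b = 0" if "b < m" for b
      using w0 we[OF that] bij_betwE[OF e] that by auto
    then have "v = 0\<^sub>v m" using v(1) by (intro eq_vecI) auto
    then show False using v(2) by simp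
  qed
  then have "ieval c ?D \<noteq> 0" by (simp add: insertion_macaulay)
  moreover have "?D \<in> polys_in indets"
    using r by (intro macaulay_in row_index_fst)
  moreover have "vanishing ?D" by (rule vanishing_macaulay[OF e r N])
  ultimately show ?thesis by blast
qed

definition powers :: "nat \<times> nat monomial \<Rightarrow> 'a::zero_neq_one" where
  "powers = (\<lambda>(i, \<alpha>). if \<alpha> = single i (ds i) then 1 else 0)"

text \<open>A monomial of degree \<open>\<Sum> ds i\<close> is divisible by some \<open>x\<^sub>i ^ ds i\<close>; choosing the rows
  accordingly makes the Macaulay matrix of the system \<open>x\<^sub>i ^ ds i\<close> the identity.\<close>

lemma unit_at_powers:
  "\<exists>P. P \<in> polys_in indets \<and> vanishing P \<and> ieval (powers :: _ \<Rightarrow> int) P = 1"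
proof -
  define N where "N = (\<Sum>i<n. ds i)"
  let ?F = "homs N"
  have N: "ds i \<le> N" if "i < n" for i
    using that member_le_sum[of i "{..<n}" ds] by (simp add: N_def)
  define m where "m = card ?F"
  obtain e where e: "bij_betw e {..<m} ?F"
    unfolding m_def using enumerate_finite finite_monomials_of_degree by blast
  have "\<exists>w. w \<in> row_index N \<and> \<gamma> = snd w + single (fst w) (ds (fst w))"
    if \<gamma>: "\<gamma> \<in> ?F" for \<gamma>
  proof -
    have "\<exists>i<n. ds i \<le> lookup \<gamma> i"
    proof (rule ccontr)
      assume "\<not> ?thesis"
      then have "(\<Sum>i<n. lookup \<gamma> i) < (\<Sum>i<n. ds i)"
        using n_pos by (intro sum_strict_mono) (auto simp: not_le lessThan_empty_iff)
      then show False using \<gamma> by (simp add: monomials_of_degree_iff N_def)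
    qed
    then obtain i where i: "i < n" "ds i \<le> lookup \<gamma> i" by blast
    define \<beta> where "\<beta> = \<gamma> - single i (ds i)"
    have eq: "\<gamma> = \<beta> + single i (ds i)"
      using i by (intro poly_mapping_eqI) (auto simp: \<beta>_def lookup_add lookup_minus lookup_single when_def)
    then have "\<beta> \<in> homs (N - ds i)"
      using monomial_quotient[of "single i (ds i)" "ds i" \<beta> N] \<gamma> i by simp
    then show ?thesis using eq i by (intro exI[of _ "(i, \<beta>)"]) (simp add: row_index_def)
  qed
  then have "\<forall>\<gamma>. \<exists>w. \<gamma> \<in> ?F \<longrightarrow> w \<in> row_index N \<and> \<gamma> = snd w + single (fst w) (ds (fst w))"
    by blast
  from choice[OF this] obtain q where q: "\<And>\<gamma>. \<gamma> \<in> ?F \<Longrightarrow> q \<gamma> \<in> row_index N"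
    "\<And>\<gamma>. \<gamma> \<in> ?F \<Longrightarrow> \<gamma> = snd (q \<gamma>) + single (fst (q \<gamma>)) (ds (fst (q \<gamma>)))" by blast
  define r where "r a = q (e a)" for a
  have eF: "e a \<in> ?F" if "a < m" for a using bij_betwE[OF e] that by auto
  have r: "r a \<in> row_index N" if "a < m" for a using q(1)[OF eF[OF that]] by (simp add: r_def)
  let ?D = "det (macaulay_matrix r e m)"
  have "mat m m (\<lambda>(a, b). \<Sum>\<alpha>\<in>mons (fst (r a)). if e b = snd (r a) + \<alpha> then powers (fst (r a), \<alpha>) else 0)
      = (1\<^sub>m m :: int mat)"
  proof (rule eq_matI)
    fix a b assume "a < dim_row (1\<^sub>m m :: int mat)" "b < dim_col (1\<^sub>m m :: int mat)"
    then have ab: "a < m" "b < m" by auto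
    let ?i = "fst (r a)" and ?\<beta> = "snd (r a)"
    let ?s = "single ?i (ds ?i)"
    have i: "?i < n" using r[OF ab(1)] by (auto simp: row_index_def)
    have ea: "e a = ?\<beta> + ?s" using q(2)[OF eF[OF ab(1)]] by (simp add: r_def)
    have "(\<Sum>\<alpha>\<in>mons ?i. if e b = ?\<beta> + \<alpha> then powers (?i, \<alpha>) else (0::int)) =
        (\<Sum>\<alpha>\<in>mons ?i. if \<alpha> = ?s then (if e b = ?\<beta> + ?s then 1 else 0) else 0)"
      by (intro sum.cong) (auto simp: powers_def)
    also have "\<dots> = (if e b = e a then 1 else 0)" using i by (simp add: sum.delta ea)
    also have "\<dots> = (if a = b then 1 else 0)"
      using e ab by (auto simp: bij_betw_def dest: inj_onD)
    finally show "mat m m (\<lambda>(a, b). \<Sum>\<alpha>\<in>mons (fst (r a)).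
        if e b = snd (r a) + \<alpha> then powers (fst (r a), \<alpha>) else 0) $$ (a, b) = (1\<^sub>m m :: int mat) $$ (a, b)"
      using ab by simp
  qed simp_all
  then have "ieval (powers :: _ \<Rightarrow> int) ?D = 1"
    by (simp only: insertion_macaulay det_one)
  moreover have "?D \<in> polys_in indets"
    using r by (intro macaulay_in row_index_fst)
  moreover have "vanishing ?D" by (rule vanishing_macaulay[OF e r N])
  ultimately show ?thesis by blast
qed

lemma generator_exists:
  obtains R where "R \<in> polys_in indets" "irreducible R"
    "\<And>c. ieval c R = 0 \<longleftrightarrow> has_zero c"
    "ieval (powers :: _ \<Rightarrow> int) R = 1"
    "\<And>P. P \<in> polys_in indets \<Longrightarrow> vanishing P \<Longrightarrow> R dvd P"
proof -
  obtain S where S: "S \<in> polys_in indets" "vanishing S" "ieval (powers :: _ \<Rightarrow> int) S = 1"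
    using unit_at_powers by blast
  then have "S \<noteq> 0" by (metis ins_int.hom_zero zero_neq_one)
  from vanishing_principal[OF S(1,2) this] obtain R0 where R0: "R0 \<in> polys_in indets"
    "vanishing R0" "R0 \<noteq> 0" "\<And>P. P \<in> polys_in indets \<Longrightarrow> vanishing P \<Longrightarrow> R0 dvd P" by blast
  let ?u = "ieval (powers :: _ \<Rightarrow> int) R0"
  obtain k where k: "S = R0 * k" using R0(4)[OF S(1,2)] by (metis dvdE)
  \<comment> \<open>The integer value of \<open>R0\<close> divides the value 1 of \<open>S\<close>;
    replacing \<open>R0\<close> by its negative corrects the sign.\<close>
  then have u: "?u = 1 \<or> ?u = - 1"
    using S(3) by (metis ins_int.hom_mult zmult_eq_1_iff)
  interpret dom_subring "polys_in indets :: coeff_poly set" by (rule dom_subring_polys_in)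
  have "\<exists>R. R \<in> polys_in indets \<and> vanishing R \<and> R \<noteq> 0 \<and>
    ieval (powers :: _ \<Rightarrow> int) R = 1 \<and>
    (\<forall>P. P \<in> polys_in indets \<longrightarrow> vanishing P \<longrightarrow> R dvd P)"
    using u
  proof
    assume "?u = 1"
    then show ?thesis using R0 by blast
  next
    assume "?u = - 1"
    then have "ieval (powers :: _ \<Rightarrow> int) (- R0) = 1"
      unfolding ins_int.hom_uminus by simp
    moreover have "vanishing (- R0)" using R0(2) by (simp add: vanishing_def ins_int.hom_uminus)
    ultimately show ?thesis using R0 uminus_in by (intro exI[of _ "- R0"]) auto
  qed
  then obtain R where R: "R \<in> polys_in indets" "vanishing R" "R \<noteq> 0"
    "ieval (powers :: _ \<Rightarrow> int) R = 1"
    "\<And>P. P \<in> polys_in indets \<Longrightarrow> vanishing P \<Longrightarrow> R dvd P" by blast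
  have "has_zero c" if "ieval c R = 0" for c
  proof (rule ccontr)
    assume "\<not> has_zero c"
    then obtain P where P: "P \<in> polys_in indets" "vanishing P" "ieval c P \<noteq> 0"
      using nonvanishing_at by blast
    then obtain k where "P = R * k" using R(5) by (metis dvdE)
    then show False using P(3) that by (simp add: ins_int.hom_mult)
  qed
  moreover have "ieval c R = 0" if "has_zero c" for c
    using R(2) that by (simp add: vanishing_def)
  moreover have "irreducible R" by (rule generator_irreducible[OF R(1-3,5)])
  ultimately show ?thesis using that[OF R(1) _ _ R(4,5)] by blast
qed

end

section \<open>Existence and uniqueness of the resultant\<close>

context form_system
begin

definition coeffs_of :: "(nat \<Rightarrow> (nat, 'a::zero) mpoly) \<Rightarrow> nat \<times> nat monomial \<Rightarrow> 'a" where
  "coeffs_of f v = lookup (f (fst v)) (snd v)"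

lemma coeff_eval_coeffs_of: "coeff_eval R f = ieval (coeffs_of f) R"
  by (simp add: coeff_eval_conv_insertion coeffs_of_def[abs_def])

lemma mpoly_eval_homogeneous:
  "homogeneous n (ds i) (f i) \<Longrightarrow> mpoly_eval x (f i) = form (coeffs_of f) i x"
  unfolding mpoly_eval_conv_insertion form_def homogeneous_def coeffs_of_def fst_conv snd_conv
  by (rule comm_ring_hom.insertion_superset[OF comm_ring_hom_id finite_monomials_of_degree])

lemma form_cong: "i < n \<Longrightarrow> (\<And>v. v \<in> indets \<Longrightarrow> c v = c' v) \<Longrightarrow> form c i x = form c' i x"
  unfolding form_def by (intro sum.cong refl) (simp add: indetsI)

lemma has_zero_cong: "(\<And>v. v \<in> indets \<Longrightarrow> c v = c' v) \<Longrightarrow> has_zero c = has_zero c'"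
  unfolding has_zero_def using form_cong[of _ c c'] by metis

lemma insertion_cong_indets:
  "R \<in> polys_in indets \<Longrightarrow> (\<And>v. v \<in> indets \<Longrightarrow> c v = c' v) \<Longrightarrow>
    ieval c R = ieval c' R"
  by (intro insertion_of_int_cong) (auto simp: polys_in_def)

lemma lookup_form_poly: "\<alpha> \<in> mons i \<Longrightarrow> lookup (form_poly c i) \<alpha> = c (i, \<alpha>)"
  by (simp add: form_poly_def lookup_sum lookup_single when_def sum.delta)

lemma homogeneous_form_poly: "homogeneous n (ds i) (form_poly c i)"
  unfolding homogeneous_def
  by (auto simp: in_keys_iff form_poly_def lookup_sum lookup_single when_def sum.delta split: if_splits)

lemma coeffs_of_powers: "coeffs_of (\<lambda>i. mpoly_var i ^ ds i :: (nat, 'a::comm_ring_1) mpoly) = powers"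
proof
  fix v :: "nat \<times> nat monomial"
  have "mpoly_var i ^ k = (single (single i k) 1 :: (nat, 'a) mpoly)" for i k
    using mono_eval_var[of "single i k", where 'a = 'a] by simp
  then show "coeffs_of (\<lambda>i. mpoly_var i ^ ds i :: (nat, 'a) mpoly) v = powers v"
    by (auto simp: coeffs_of_def powers_def lookup_single when_def split: prod.splits)
qed

text \<open>Only coefficients at \<open>indets\<close> enter, and every family of them is realised
  by \<open>form_poly\<close>, so homogeneous systems and coefficient families may be
  exchanged.\<close>

lemma is_resultant_iff:
  "is_resultant n ds R \<longleftrightarrow> R \<in> polys_in indets \<and>
    (\<forall>c. ieval c R = 0 \<longleftrightarrow> has_zero c) \<and>
    ieval (powers :: _ \<Rightarrow> complex) R = 1 \<and> irreducible R"
proof -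
  have "(\<forall>f :: nat \<Rightarrow> (nat, complex) mpoly. (\<forall>i<n. homogeneous n (ds i) (f i)) \<longrightarrow>
        (coeff_eval R f = 0 \<longleftrightarrow>
         (\<exists>x :: nat \<Rightarrow> complex. (\<exists>j<n. x j \<noteq> 0) \<and> (\<forall>i<n. mpoly_eval x (f i) = 0)))) \<longleftrightarrow>
      (\<forall>c. ieval c R = 0 \<longleftrightarrow> has_zero c)" (is "?L \<longleftrightarrow> ?R")
    if R: "R \<in> polys_in indets"
  proof -
    have *: "(\<exists>x :: nat \<Rightarrow> complex. (\<exists>j<n. x j \<noteq> 0) \<and> (\<forall>i<n. mpoly_eval x (f i) = 0)) \<longleftrightarrow>
        has_zero (coeffs_of f)" if "\<forall>i<n. homogeneous n (ds i) (f i)" for f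
      unfolding has_zero_def using that mpoly_eval_homogeneous by metis
    show ?thesis
    proof
      assume L: ?L
      show ?R
      proof
        fix c
        have eq: "coeffs_of (form_poly c) v = c v" if "v \<in> indets" for v
          using that lookup_form_poly by (auto simp: indets_def coeffs_of_def)
        have "ieval (coeffs_of (form_poly c)) R = 0 \<longleftrightarrow> has_zero (coeffs_of (form_poly c))"
          using L *[of "form_poly c"] homogeneous_form_poly by (simp add: coeff_eval_coeffs_of)
        then show "ieval c R = 0 \<longleftrightarrow> has_zero c"
          using insertion_cong_indets[OF R eq] has_zero_cong[OF eq] by simp
      qed
    next
      assume ?R
      then show ?L using * by (simp add: coeff_eval_coeffs_of)
    qed
  qed
  moreover have "mpoly_vars R \<subseteq> (SIGMA i:{..<n}. homs (ds i)) \<longleftrightarrow> R \<in> polys_in indets"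
    by (simp add: polys_in_def indets_def)
  ultimately show ?thesis
    unfolding is_resultant_def by (auto simp: coeff_eval_coeffs_of coeffs_of_powers)
qed

lemma resultant_properties:
  obtains R where "is_resultant n ds R" "(THE R. is_resultant n ds R) = R"
    "R \<in> polys_in indets" "\<And>c. ieval c R = 0 \<longleftrightarrow> has_zero c"
    "ieval (powers :: _ \<Rightarrow> complex) R = 1"
    "\<And>P. P \<in> polys_in indets \<Longrightarrow> vanishing P \<Longrightarrow> R dvd P"
proof -
  obtain R where R: "R \<in> polys_in indets" "irreducible R"
    "\<And>c. ieval c R = 0 \<longleftrightarrow> has_zero c"
    "ieval (powers :: _ \<Rightarrow> int) R = 1"
    "\<And>P. P \<in> polys_in indets \<Longrightarrow> vanishing P \<Longrightarrow> R dvd P"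
    using generator_exists by metis
  have "complex_of_int (ieval (powers :: _ \<Rightarrow> int) R) = ieval powers R"
    unfolding hom_insertion_of_int[OF comm_ring_hom_of_int]
    by (intro arg_cong[where f = "\<lambda>c. ieval c R"]) (auto simp: powers_def)
  then have pow: "ieval (powers :: _ \<Rightarrow> complex) R = 1" using R(4) by simp
  have res: "is_resultant n ds R" using R pow by (simp add: is_resultant_iff)
  have "R' = R" if R': "is_resultant n ds R'" for R'
  proof -
    have "vanishing R'" "R' \<in> polys_in indets" "irreducible R'"
      and pow': "ieval (powers :: _ \<Rightarrow> complex) R' = 1"
      using R' by (auto simp: is_resultant_iff vanishing_def)
    then obtain k where k: "R' = R * k" using R(5) by (metis dvdE)
    \<comment> \<open>Irreducibility of \<open>R'\<close> makes \<open>k\<close> a unit, that is 1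
      or -1, and the common value 1 at \<open>powers\<close> fixes the sign.\<close>
    then have "R dvd 1 \<or> k dvd 1" using \<open>irreducible R'\<close> by (simp add: irreducible_def)
    moreover have "\<not> R dvd 1" using R(2) by (simp add: irreducible_def)
    ultimately have "k = 1 \<or> k = - 1" using unit_mpoly_int by blast
    moreover have "ieval (powers :: _ \<Rightarrow> complex) k = 1"
      using pow pow' by (simp add: k ins_int.hom_mult)
    ultimately show ?thesis using k by (auto simp: ins_int.hom_uminus)
  qed
  with res have "(THE R. is_resultant n ds R) = R" by (rule the_equality)
  then show ?thesis using that res R pow by blast
qed

end

section \<open>Linear terms of the resultant along lines\<close>

lemma poly_single_root:
  fixes q :: "complex poly"
  assumes "q \<noteq> 0" "\<And>z. poly q z = 0 \<Longrightarrow> z = r"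
  shows "\<exists>a k. q = smult a ([:- r, 1:] ^ k)"
  using assms
proof (induction "degree q" arbitrary: q rule: less_induct)
  case less
  show ?case
  proof (cases "degree q = 0")
    case True
    then obtain a where "q = [:a:]" by (rule degree_eq_zeroE)
    then show ?thesis by (intro exI[of _ a] exI[of _ 0]) (simp add: one_pCons)
  next
    case False
    then obtain z where "poly q z = 0"
      using fundamental_theorem_of_algebra[of q] constant_degree[of q] by auto
    then have "poly q r = 0" using less.prems by blast
    then obtain q' where q': "q = [:- r, 1:] * q'" by (metis dvdE poly_eq_0_iff_dvd)
    with less.prems(1) have nz: "q' \<noteq> 0" by (metis mult_zero_right)
    then have "degree q = 1 + degree q'" unfolding q' by (subst degree_mult_eq) auto
    then have less_deg: "degree q' < degree q" by simp
    have "z = r" if "poly q' z = 0" for z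
      by (rule less.prems(2)) (simp add: q' that)
    from less.hyps[OF less_deg nz this] obtain a k where "q' = smult a ([:- r, 1:] ^ k)" by blast
    then show ?thesis by (intro exI[of _ a] exI[of _ "Suc k"]) (simp add: q')
  qed
qed

lemma coeff_1_mult: "coeff (p * q) 1 = coeff p 0 * coeff q 1 + coeff p 1 * coeff q (0::nat)"
  by (simp add: coeff_mult)

lemma coeff_1_power_1_1: "coeff ([:1, 1 :: 'a::comm_ring_1:] ^ k) 1 = of_nat k"
proof (induction k)
  case (Suc k)
  have "coeff ([:1, 1 :: 'a:] ^ k) 0 = 1" by (simp add: coeff_0_power)
  then show ?case using Suc unfolding power_Suc coeff_1_mult by simp
qed simp

lemma coeff_1_prod:
  "finite A \<Longrightarrow> coeff (\<Prod>i\<in>A. [:1, l i :: 'a::comm_ring_1:]) 1 = (\<Sum>i\<in>A. l i)"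
proof (induction A rule: finite_induct)
  case (insert i A)
  have "coeff (\<Prod>i\<in>A. [:1, l i:]) 0 = 1" by (simp add: poly_prod flip: poly_0_coeff_0)
  then show ?case using insert unfolding prod.insert[OF insert(1,2)] coeff_1_mult by simp
qed simp

definition along :: "('v \<Rightarrow> complex) \<Rightarrow> ('v \<Rightarrow> complex) \<Rightarrow> ('v, int) mpoly \<Rightarrow> complex poly" where
  "along c a = ieval (\<lambda>v. [:c v, a v:])"

lemma poly_along: "poly (along c a P) t = ieval (\<lambda>v. c v + t * a v) P"
  by (simp add: along_def hom_insertion_of_int[OF comm_ring_hom_poly])

lemma coeff_0_along: "coeff (along c a P) 0 = ieval c P"
  using poly_along[of c a P 0] by (simp add: poly_0_coeff_0)

text \<open>The coefficient of \<open>t\<close> is the derivative of \<open>P\<close> at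
  \<open>c\<close> in direction \<open>a\<close>: it obeys the Leibniz rule and is linear in
  \<open>a\<close>.\<close>

lemma coeff_1_along:
  assumes "P \<in> polys_in X" "finite X"
  shows "coeff (along c a P) 1 = (\<Sum>v\<in>X. a v * coeff (along c (\<lambda>w. if w = v then 1 else 0) P) 1)"
  using assms(1)
proof (induction P rule: polys_in_induct)
  case (const k)
  show ?case by (simp add: along_def of_int_poly)
next
  case (var v)
  then show ?case using assms(2) by (simp add: along_def if_distrib[of "(*) _"] cong: if_cong)
next
  case (add p q)
  then show ?case by (simp add: along_def ins_int.hom_add distrib_left sum.distrib)
next
  case (mult p q)
  have *: "coeff (along c b (p * q)) 1 = ieval c p * coeff (along c b q) 1 +
      coeff (along c b p) 1 * ieval c q" for b
    using coeff_1_mult[of "along c b p" "along c b q"] coeff_0_along[of c b p] coeff_0_along[of c b q]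
    by (simp add: along_def ins_int.hom_mult)
  show ?case
    unfolding * mult.IH
    by (simp add: distrib_left sum.distrib sum_distrib_left sum_distrib_right mult_ac)
qed

section \<open>First-order behaviour of the resultant at the system of pure powers\<close>

locale equal_degree_system = form_system n "\<lambda>_. e" for n e +
  fixes R :: coeff_poly
  assumes R_in: "R \<in> polys_in indets"
    and R_zero: "\<And>c. ieval c R = 0 \<longleftrightarrow> has_zero c"
    and R_powers: "ieval (powers :: _ \<Rightarrow> complex) R = 1"
    and R_dvd: "\<And>P. P \<in> polys_in indets \<Longrightarrow> vanishing P \<Longrightarrow> R dvd P"
begin

abbreviation unit_vec_at :: "nat \<times> nat monomial \<Rightarrow> nat \<times> nat monomial \<Rightarrow> complex" where
  "unit_vec_at v \<equiv> \<lambda>w. if w = v then 1 else 0"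

abbreviation diag :: "nat \<Rightarrow> nat \<times> nat monomial" where
  "diag i \<equiv> (i, single i e)"

lemma e_pos: "e \<ge> 1"
  using ds_pos[of 0] n_pos by simp

lemma diag_in: "i < n \<Longrightarrow> diag i \<in> indets"
  by (auto intro!: indetsI)

lemma powers_diag: "powers (diag i) = 1"
  by (simp add: powers_def)

lemma form_powers:
  assumes "i < n"
  shows "form powers i x = x i ^ e"
proof -
  have "form powers i x = (\<Sum>\<alpha>\<in>mons i. if \<alpha> = single i e then mono_eval x \<alpha> else 0)"
    unfolding form_def by (intro sum.cong) (auto simp: powers_def)
  then show ?thesis using assms by (simp add: sum.delta)
qed

lemma form_perturbed:
  assumes "i < n" "(k, \<beta>) \<in> indets"
  shows "form (\<lambda>v. powers v + u * unit_vec_at (k, \<beta>) v) i x =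
    x i ^ e + (if i = k then u * mono_eval x \<beta> else 0)"
proof -
  have "form (\<lambda>v. powers v + u * unit_vec_at (k, \<beta>) v) i x =
      form powers i x + (\<Sum>\<alpha>\<in>mons i. if \<alpha> = \<beta> then (if i = k then u * mono_eval x \<beta> else 0) else 0)"
    unfolding form_def sum.distrib[symmetric] by (intro sum.cong) (auto simp: algebra_simps)
  then show ?thesis using assms by (simp add: form_powers sum.delta indets_def)
qed

text \<open>Adding a multiple of \<open>x\<^sup>\<beta>\<close> with \<open>\<beta> \<noteq> e e\<^sub>k\<close> to one of the forms \<open>x\<^sub>i ^ e\<close> creates no
  common zero, so the resultant has no root along this line and is constant.\<close>

lemma along_off_diagonal:
  assumes v: "v \<in> indets" "\<And>i. v \<noteq> diag i"
  shows "coeff (along powers (unit_vec_at v) R) 1 = 0"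
proof -
  obtain k \<beta> where v_eq: "v = (k, \<beta>)" by force
  then have k: "k < n" "\<beta> \<in> mons k" "\<beta> \<noteq> single k e" using v by (auto simp: indets_def)
  let ?q = "along powers (unit_vec_at v) R"
  have "poly ?q u \<noteq> 0" for u
  proof
    assume "poly ?q u = 0"
    then have "has_zero (\<lambda>w. powers w + u * unit_vec_at v w)" by (simp add: poly_along R_zero)
    then obtain x j where x: "j < n" "x j \<noteq> 0"
      "\<And>i. i < n \<Longrightarrow> form (\<lambda>w. powers w + u * unit_vec_at v w) i x = 0"
      unfolding has_zero_def by blast
    have eq: "x i ^ e + (if i = k then u * mono_eval x \<beta> else 0) = 0" if "i < n" for i
      using x(3)[OF that] form_perturbed[OF that v(1)[unfolded v_eq], of u x] by (simp add: v_eq)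
    have x0: "x i = 0" if "i < n" "i \<noteq> k" for i
      using eq[OF that(1)] that(2) e_pos by (simp add: power_0_left)
    \<comment> \<open>All coordinates other than \<open>k\<close> are zero already, so a second
      variable in \<beta> removes the perturbation and leaves \<open>x k ^ e = 0\<close>.\<close>
    have "\<exists>w\<in>keys \<beta>. w \<noteq> k"
    proof (rule ccontr)
      assume "\<not> ?thesis"
      then have *: "keys \<beta> \<subseteq> {k}" by auto
      have "(\<Sum>w\<in>keys \<beta>. lookup \<beta> w) = lookup \<beta> k"
        using sum_keys_lookup[of "{k}" \<beta>] * by simp
      then have "\<beta> = single k e" using * k(2)
        by (intro poly_mapping_eqI)
           (auto simp: monomials_of_degree_def lookup_single when_def not_in_keys_iff_lookup_eq_zero[symmetric])
      then show False using k(3) by simp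
    qed
    then obtain w where w: "w \<in> keys \<beta>" "w \<noteq> k" by blast
    then have "w < n" using k(2) by (auto simp: monomials_of_degree_def)
    then have "x w = 0" using x0 w by blast
    then have "mono_eval x \<beta> = 0" using w(1) by (auto simp: mono_eval_def in_keys_iff)
    then have "x k = 0" using eq[OF k(1)] e_pos by simp
    then show False using x0 x(1,2) by metis
  qed
  then have "degree ?q = 0"
    using fundamental_theorem_of_algebra[of ?q] constant_degree[of ?q] by auto
  then show ?thesis by (simp add: coeff_eq_0)
qed

text \<open>The line only scales one pure power by \<open>1 + u\<close>, so a nonzero common zero
  appears at \<open>u = - 1\<close> alone; the value 1 at \<open>u = 0\<close> normalises the
  remaining power.\<close>

lemma along_diagonal:
  assumes i: "i < n"
  shows "\<exists>k. along powers (unit_vec_at (diag i)) R = [:1, 1:] ^ k"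
proof -
  let ?q = "along powers (unit_vec_at (diag i)) R"
  have q0: "coeff ?q 0 = 1" by (simp add: coeff_0_along R_powers)
  have "u = - 1" if "poly ?q u = 0" for u
  proof (rule ccontr)
    assume u: "u \<noteq> - 1"
    from that have "has_zero (\<lambda>w. powers w + u * unit_vec_at (diag i) w)" by (simp add: poly_along R_zero)
    then obtain x j where x: "j < n" "x j \<noteq> 0"
      "\<And>i'. i' < n \<Longrightarrow> form (\<lambda>w. powers w + u * unit_vec_at (diag i) w) i' x = 0"
      unfolding has_zero_def by blast
    have "x j ^ e + (if j = i then u * x j ^ e else 0) = 0"
      using x(3)[OF x(1)] form_perturbed[OF x(1) diag_in[OF i], of u x] by (auto split: if_splits)
    then have "(if j = i then 1 + u else 1) * x j ^ e = 0"
      by (cases "j = i") (simp_all add: distrib_right del: mult_eq_0_iff)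
    moreover have "(if j = i then 1 + u else 1) \<noteq> 0" using u by (auto simp: add_eq_0_iff)
    ultimately have "x j ^ e = 0" by (metis mult_eq_0_iff)
    then show False using x(2) by simp
  qed
  moreover have "?q \<noteq> 0" using q0 by auto
  ultimately obtain a k where ak: "?q = smult a ([:- (- 1), 1:] ^ k)"
    using poly_single_root by blast
  then have "a = 1" using q0 by (simp add: coeff_0_power)
  then show ?thesis using ak by auto
qed

text \<open>Plays the role of the degree of the resultant in the coefficients of the
  \<open>i\<close>-th form, read off at \<open>powers\<close>.\<close>

definition deg_in :: "nat \<Rightarrow> nat" where
  "deg_in i = (SOME k. along powers (unit_vec_at (diag i)) R = [:1, 1:] ^ k)"

lemma deg_in: "i < n \<Longrightarrow> along powers (unit_vec_at (diag i)) R = [:1, 1:] ^ deg_in i"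
  unfolding deg_in_def using along_diagonal by (rule someI_ex)

lemma coeff_1_along_powers:
  "coeff (along powers a R) 1 = (\<Sum>i<n. of_nat (deg_in i) * a (diag i))"
proof -
  have "coeff (along powers a R) 1 = (\<Sum>v\<in>indets. a v * coeff (along powers (unit_vec_at v) R) 1)"
    by (rule coeff_1_along[OF R_in finite_indets])
  also have "\<dots> = (\<Sum>v\<in>diag ` {..<n}. a v * coeff (along powers (unit_vec_at v) R) 1)"
    using diag_in along_off_diagonal
    by (intro sum.mono_neutral_right) (auto simp: indets_def)
  also have "\<dots> = (\<Sum>i<n. a (diag i) * coeff (along powers (unit_vec_at (diag i)) R) 1)"
    by (subst sum.reindex) (auto simp: inj_on_def)
  also have "\<dots> = (\<Sum>i<n. of_nat (deg_in i) * a (diag i))"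
    by (intro sum.cong refl) (simp only: deg_in coeff_1_power_1_1 lessThan_iff mult.commute)
  finally show ?thesis .
qed

text \<open>Permuting the variables together with the equations maps the resultant to a multiple of
  itself, so its degrees in the individual forms coincide.\<close>

definition swap_index :: "nat \<Rightarrow> nat \<Rightarrow> nat \<times> nat monomial \<Rightarrow> nat \<times> nat monomial" where
  "swap_index i j = (\<lambda>(k, \<alpha>). (Transposition.transpose i j k, Poly_Mapping.map_key (Transposition.transpose i j) \<alpha>))"

lemma lookup_map_key_transpose:
  "lookup (Poly_Mapping.map_key (Transposition.transpose i j) \<alpha>) k =
    lookup \<alpha> (Transposition.transpose i j k)"
  by (simp add: map_key.rep_eq)

lemma map_key_transpose_twice:
  "Poly_Mapping.map_key (Transposition.transpose i j) (Poly_Mapping.map_key (Transposition.transpose i j) \<alpha>) = \<alpha>"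
  by (rule poly_mapping_eqI) (simp add: lookup_map_key_transpose)

lemma map_key_transpose_in:
  assumes "i < n" "j < n" "\<alpha> \<in> homs d"
  shows "Poly_Mapping.map_key (Transposition.transpose i j) \<alpha> \<in> homs d"
proof -
  let ?s = "Transposition.transpose i j"
  have perm: "?s permutes {..<n}" using assms by (intro permutes_swap_id) auto
  have "(\<Sum>v<n. lookup \<alpha> (?s v)) = (\<Sum>v<n. lookup \<alpha> v)"
    using sum.permute[OF perm, of "lookup \<alpha>"] by (simp add: comp_def)
  moreover have "v < n" if "?s v \<in> keys \<alpha>" for v
    using that assms permutes_in_image[OF perm, of v] by (auto simp: monomials_of_degree_iff)
  ultimately show ?thesis using assms(3)
    by (auto simp: monomials_of_degree_iff lookup_map_key_transpose in_keys_iff)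
qed

lemma mono_eval_map_key_transpose:
  assumes "i < n" "j < n" "\<alpha> \<in> homs d"
  shows "mono_eval x (Poly_Mapping.map_key (Transposition.transpose i j) \<alpha>) =
    mono_eval (\<lambda>v. x (Transposition.transpose i j v)) \<alpha>"
proof -
  let ?s = "Transposition.transpose i j"
  have perm: "?s permutes {..<n}" using assms by (intro permutes_swap_id) auto
  have "mono_eval x (Poly_Mapping.map_key ?s \<alpha>) = (\<Prod>v<n. x v ^ lookup \<alpha> (?s v))"
    using map_key_transpose_in[OF assms]
    by (subst mono_eval_superset[of "{..<n}"]) (auto simp: monomials_of_degree_iff lookup_map_key_transpose)
  also have "\<dots> = (\<Prod>v<n. x (?s v) ^ lookup \<alpha> v)"
    using prod.permute[OF perm, of "\<lambda>v. x v ^ lookup \<alpha> (?s v)"] by (simp add: comp_def)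
  also have "\<dots> = mono_eval (\<lambda>v. x (?s v)) \<alpha>"
    using assms(3) by (subst mono_eval_superset[of "{..<n}"]) (auto simp: monomials_of_degree_iff)
  finally show ?thesis .
qed

lemma has_zero_swap:
  assumes ij: "i < n" "j < n" and c: "has_zero c"
  shows "has_zero (\<lambda>v. c (swap_index i j v))"
proof -
  let ?s = "Transposition.transpose i j"
  have s_less: "?s k < n" if "k < n" for k using ij that by (auto simp: Transposition.transpose_def)
  obtain x l where x: "l < n" "x l \<noteq> 0" "\<And>i. i < n \<Longrightarrow> form c i x = 0"
    using c unfolding has_zero_def by blast
  have "form (\<lambda>v. c (swap_index i j v)) k (\<lambda>v. x (?s v)) = 0" if k: "k < n" for k
  proof -
    have "form (\<lambda>v. c (swap_index i j v)) k (\<lambda>v. x (?s v)) =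
        (\<Sum>\<alpha>\<in>mons k. c (?s k, Poly_Mapping.map_key ?s \<alpha>) * mono_eval x (Poly_Mapping.map_key ?s \<alpha>))"
      unfolding form_def by (intro sum.cong) (simp_all add: swap_index_def mono_eval_map_key_transpose[OF ij])
    also have "\<dots> = (\<Sum>\<alpha>\<in>mons (?s k). c (?s k, \<alpha>) * mono_eval x \<alpha>)"
      by (rule sum.reindex_bij_witness[of _ "Poly_Mapping.map_key ?s" "Poly_Mapping.map_key ?s"])
         (auto simp: map_key_transpose_twice map_key_transpose_in[OF ij])
    finally show ?thesis using x(3)[OF s_less[OF k]] by (simp add: form_def)
  qed
  moreover have "x (?s (?s l)) \<noteq> 0" using x by simp
  ultimately show ?thesis unfolding has_zero_def using s_less[OF x(1)] by (intro exI[of _ "\<lambda>v. x (?s v)"]) blast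
qed

lemma deg_in_le:
  assumes ij: "i < n" "j < n"
  shows "deg_in i \<le> deg_in j"
proof -
  let ?s = "Transposition.transpose i j"
  \<comment> \<open>\<open>R\<close> with its indeterminates permuted. It vanishes on the same kind
    of systems, hence is a multiple of \<open>R\<close>.\<close>
  define R' :: coeff_poly where "R' = ieval (\<lambda>v. mpoly_var (swap_index i j v)) R"
  have ins: "ieval c R' = ieval (\<lambda>v. c (swap_index i j v)) R"
    for c :: "_ \<Rightarrow> 'b::comm_ring_1"
    unfolding R'_def by (subst hom_insertion_of_int[OF ins_int.comm_ring_hom_axioms]) simp
  have swap_in: "swap_index i j v \<in> indets" if "v \<in> indets" for v
    using that ij map_key_transpose_in[OF ij]
    by (auto simp: indets_def swap_index_def Transposition.transpose_def)
  have "mpoly_var (swap_index i j v) \<in> (polys_in indets :: coeff_poly set)" if "v \<in> mpoly_vars R" for v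
  proof -
    have "v \<in> indets" using that R_in by (auto simp: polys_in_def)
    then show ?thesis by (intro var_in_polys_in swap_in)
  qed
  moreover have "of_int a \<in> (polys_in indets :: coeff_poly set)" for a
    using const_in_polys_in[of a indets] by (simp add: mconst.hom_of_int[symmetric] mpoly_const_def)
  ultimately have "R' \<in> polys_in indets"
    unfolding R'_def by (intro insertion_in_dom_subring[OF dom_subring_polys_in comm_ring_hom_of_int])
  moreover have "vanishing R'"
    unfolding vanishing_def using has_zero_swap[OF ij] by (simp add: ins R_zero)
  ultimately obtain k where k: "R' = R * k" using R_dvd by (metis dvdE)
  have swap_eq: "swap_index i j v = diag i \<longleftrightarrow> v = diag j" for v
  proof -
    obtain l \<alpha> where v: "v = (l, \<alpha>)" by force
    have "Poly_Mapping.map_key ?s \<alpha> = single i e \<longleftrightarrow> \<alpha> = single j e"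
      unfolding poly_mapping_eq_iff fun_eq_iff lookup_map_key_transpose lookup_single when_def
      by (metis transpose_involutory transpose_apply_first transpose_apply_second)
    moreover have "?s l = i \<longleftrightarrow> l = j" by (auto simp: Transposition.transpose_def)
    ultimately show ?thesis by (simp add: v swap_index_def)
  qed
  have pow: "powers (swap_index i j v) = (powers v :: complex)" for v
  proof -
    obtain l \<alpha> where v: "v = (l, \<alpha>)" by force
    have "Poly_Mapping.map_key ?s \<alpha> = single (?s l) e \<longleftrightarrow> \<alpha> = single l e"
      unfolding poly_mapping_eq_iff fun_eq_iff lookup_map_key_transpose lookup_single when_def
      by (metis transpose_involutory)
    then show ?thesis by (simp add: v swap_index_def powers_def)
  qed
  have "along powers (unit_vec_at (diag i)) R' = along powers (unit_vec_at (diag j)) R"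
    unfolding along_def ins by (simp add: pow swap_eq)
  \<comment> \<open>The relation \<open>R' = R * k\<close> is restricted to the diagonal line of
    \<open>i\<close>, on which \<open>R'\<close> equals \<open>R\<close> on the diagonal line of
    \<open>j\<close>; degrees can then be compared.\<close>
  then have "[:1, 1:] ^ deg_in j = [:1, 1:] ^ deg_in i * along powers (unit_vec_at (diag i)) k"
    using deg_in[OF ij(1)] deg_in[OF ij(2)] by (simp add: k along_def ins_int.hom_mult)
  moreover have "[:1, 1 :: complex:] ^ deg_in j \<noteq> 0" by simp
  ultimately have "degree ([:1, 1 :: complex:] ^ deg_in i) \<le> degree ([:1, 1 :: complex:] ^ deg_in j)"
    using dvd_imp_degree_le[of "[:1, 1 :: complex:] ^ deg_in i"] by (metis dvd_triv_left)
  then show ?thesis by (simp add: degree_linear_power)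
qed

lemma deg_in_eq: "i < n \<Longrightarrow> deg_in i = deg_in 0"
  using deg_in_le[of i 0] deg_in_le[of 0 i] n_pos by simp

lemma has_zero_scale: "s \<noteq> 0 \<Longrightarrow> has_zero (\<lambda>v. s * c v) \<longleftrightarrow> has_zero c"
proof -
  assume s: "s \<noteq> 0"
  have "form (\<lambda>v. s * c v) i x = s * form c i x" for i x
    by (simp add: form_def sum_distrib_left mult.assoc)
  then show ?thesis using s by (simp add: has_zero_def)
qed

text \<open>Homogeneity of the resultant on the plane spanned by \<open>powers\<close> and \<open>a\<close>: on each line
  through the origin it has no other root than \<open>0\<close>, so it is a monomial, and the exponent
  cannot jump because two nonzero coefficients would have a common nonzero value.\<close>

lemma homogeneous_plane:
  "\<exists>D. \<forall>s t. ieval (\<lambda>v. s * (powers v + t * a v)) R = s ^ D * poly (along powers a R) t"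
proof -
  \<comment> \<open>A polynomial in two variables: the outer one is the scale \<open>s\<close>, and
    the coefficients \<open>F k\<close> are polynomials in \<open>t\<close>.\<close>
  define W where "W = ieval (\<lambda>v. [:0, [:powers v, a v:] :: complex poly:]) R"
  define F where "F k = coeff W k" for k
  have W: "ieval (\<lambda>v. s * (powers v + t * a v)) R = (\<Sum>k\<le>degree W. poly (F k) t * s ^ k)" for s t
  proof -
    have "ieval (\<lambda>v. s * (powers v + t * a v)) R = poly (poly W [:s:]) t"
      unfolding W_def hom_insertion_of_int[OF comm_ring_hom_poly] by (simp add: algebra_simps)
    also have "\<dots> = (\<Sum>k\<le>degree W. poly (F k) t * s ^ k)"
      by (simp add: poly_altdef[of W] poly_sum F_def poly_power)
    finally show ?thesis .
  qed
  have along: "poly (along powers a R) t = (\<Sum>k\<le>degree W. poly (F k) t)" for t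
    using W[of 1 t] by (simp add: poly_along)
  have one: "\<exists>k\<^sub>0\<le>degree W. \<forall>k. k \<noteq> k\<^sub>0 \<longrightarrow> poly (F k) t = 0" if t: "poly (along powers a R) t \<noteq> 0" for t
  proof -
    define q where "q = (\<Sum>k\<le>degree W. monom (poly (F k) t) k)"
    have q: "poly q s = ieval (\<lambda>v. s * (powers v + t * a v)) R" for s
      by (simp add: q_def W poly_sum poly_monom)
    have "\<not> has_zero (\<lambda>v. powers v + t * a v)" using t by (simp add: poly_along R_zero)
    then have "poly q s \<noteq> 0" if "s \<noteq> 0" for s
      using that by (simp add: q R_zero has_zero_scale)
    moreover from this[of 1] have "q \<noteq> 0" by auto
    ultimately obtain b k0 where "q = smult b ([:- 0, 1:] ^ k0)" using poly_single_root[of q 0] by blast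
    then have qm: "q = monom b k0" by (simp add: monom_altdef)
    have cq: "coeff q k = (if k \<le> degree W then poly (F k) t else 0)" for k
      by (simp add: q_def coeff_sum coeff_monom sum.delta)
    have "b \<noteq> 0" using \<open>q \<noteq> 0\<close> qm by auto
    then have "k0 \<le> degree W" using cq[of k0] qm by (auto split: if_splits)
    moreover have "poly (F k) t = 0" if "k \<noteq> k0" for k
      using cq[of k] qm that by (cases "k \<le> degree W") (auto simp: F_def coeff_eq_0)
    ultimately show ?thesis by blast
  qed
  have along0: "along powers a R \<noteq> 0"
    using coeff_0_along[of powers a R] R_powers by auto
  have "\<exists>D\<le>degree W. \<forall>k. k \<noteq> D \<longrightarrow> F k = 0"
  proof (cases "\<exists>k. F k \<noteq> 0")
    case True
    then obtain D where D: "F D \<noteq> 0" by blast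
    then have "D \<le> degree W" by (metis F_def coeff_eq_0 not_le)
    moreover have "F k = 0" if "k \<noteq> D" for k
    proof (rule ccontr)
      assume "F k \<noteq> 0"
      \<comment> \<open>The factor \<open>along powers a R\<close> keeps \<open>t\<close> away from
        the exceptional points at which \<open>one\<close> says nothing.\<close>
      then have "along powers a R * F D * F k \<noteq> 0" using D along0 by simp
      then obtain t where "poly (along powers a R * F D * F k) t \<noteq> 0"
        using poly_all_0_iff_0 by blast
      then have "poly (along powers a R) t \<noteq> 0" "poly (F D) t \<noteq> 0" "poly (F k) t \<noteq> 0" by auto
      then show False using one[of t] that by metis
    qed
    ultimately show ?thesis by blast
  qed auto
  then obtain D where D: "D \<le> degree W" "\<And>k. k \<noteq> D \<Longrightarrow> F k = 0" by blast
  have "(\<Sum>k\<le>degree W. poly (F k) t * s ^ k) = poly (F D) t * s ^ D" for s t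
    using D by (subst sum.remove[of _ D]) (auto intro: sum.neutral)
  then have "ieval (\<lambda>v. s * (powers v + t * a v)) R = poly (F D) t * s ^ D" for s t
    by (simp add: W)
  moreover from this[of 1] have "poly (along powers a R) t = poly (F D) t" for t
    by (simp add: poly_along)
  ultimately show ?thesis by (intro exI[of _ D]) (simp add: mult.commute)
qed

end

section \<open>Product and sum of the roots of the characteristic polynomial\<close>

context equal_degree_system
begin

text \<open>Euler's relation at \<open>powers\<close>: in direction \<open>powers\<close> the
  resultant is \<open>(1 + t) ^ D\<close>, and its linear term is the sum of the \<open>n\<close>
  equal partial degrees.\<close>

lemma total_degree_eq:
  assumes "\<And>s t. ieval (\<lambda>v. s * (powers v + t * a v)) R = s ^ D * poly (along powers a R) t"
  shows "D = n * deg_in 0"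
proof -
  have "poly (along powers powers R) t = poly ([:1, 1:] ^ D) t" for t
  proof -
    have "poly (along powers powers R) t = ieval (\<lambda>v. (1 + t) * (powers v + 0 * a v)) R"
      by (simp add: poly_along algebra_simps)
    also have "\<dots> = (1 + t) ^ D"
      unfolding assms by (simp add: poly_along R_powers)
    finally show ?thesis by (simp add: poly_power)
  qed
  then have "along powers powers R = [:1, 1:] ^ D" by (intro poly_eq_poly_eq_iff[THEN iffD1] ext)
  then have "complex_of_nat D = (\<Sum>i<n. of_nat (deg_in i) * powers (diag i))"
    using coeff_1_along_powers[of powers] coeff_1_power_1_1[of D, where 'a = complex] by metis
  also have "\<dots> = (\<Sum>i<n. of_nat (deg_in 0))"
    by (intro sum.cong refl) (metis deg_in_eq lessThan_iff powers_diag mult_1_right)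
  also have "\<dots> = of_nat (n * deg_in 0)" by simp
  finally show ?thesis by (simp only: of_nat_eq_iff)
qed

text \<open>Comparing \<open>\<phi>(- 1 / t)\<close> with \<open>R(x ^ e + t a)\<close> by homogeneity: the reversal of
  \<open>\<phi>(z) = R(a - z x ^ e)\<close> is \<open>\<Prod> (1 + t l\<^sub>i)\<close>.\<close>

lemma characteristic_roots:
  fixes \<phi> :: "complex poly"
  assumes \<phi>: "\<And>z. poly \<phi> z = ieval (\<lambda>v. a v - z * powers v) R"
    and roots: "\<phi> = smult c (\<Prod>i\<in>I. [:- l i, 1:])" and c: "c \<noteq> 0" and I: "finite I"
  shows "ieval a R = (\<Prod>i\<in>I. l i)"
    and "(\<Sum>i<n. of_nat (deg_in i) * a (diag i)) = (\<Sum>i\<in>I. l i)"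
    and "card I = n * deg_in 0"
proof -
  let ?p = "along powers a R"
  let ?d = "card I"
  let ?c' = "c * (- 1) ^ ?d"
  let ?P = "\<Prod>i\<in>I. [:1, l i:]"
  obtain D where D: "\<And>s t. ieval (\<lambda>v. s * (powers v + t * a v)) R = s ^ D * poly ?p t"
    using homogeneous_plane by blast
  have p0: "coeff ?p 0 = 1" by (simp add: coeff_0_along R_powers)
  have P0: "coeff ?P 0 = 1" by (simp add: poly_prod flip: poly_0_coeff_0)
  \<comment> \<open>The difference of the two sides of the reversal identity after clearing
    denominators; the sign in \<open>?c'\<close> comes from evaluating at
    \<open>- 1 / t\<close>.\<close>
  define q where "q = monom 1 ?d * ?p - monom 1 D * smult ?c' ?P"
  have "poly q t = 0" if t: "t \<noteq> 0" for t
  proof -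
    have "inverse t ^ D * poly ?p t = ieval (\<lambda>v. inverse t * (powers v + t * a v)) R"
      by (simp add: D)
    also have "(\<lambda>v. inverse t * (powers v + t * a v)) = (\<lambda>v. a v - (- inverse t) * powers v)"
      using t by (auto simp: fun_eq_iff distrib_left mult.assoc[symmetric])
    also have "ieval \<dots> R = poly \<phi> (- inverse t)" by (simp only: \<phi>)
    also have "\<dots> = c * (\<Prod>i\<in>I. - inverse t * (1 + t * l i))"
    proof -
      have "poly [:- l i, 1:] (- inverse t) = - inverse t * (1 + t * l i)" for i
        using t by (simp add: distrib_left mult.assoc[symmetric])
      then show ?thesis unfolding roots by (simp only: poly_smult poly_prod)
    qed
    also have "\<dots> = c * ((- inverse t) ^ ?d * poly ?P t)"
      by (simp only: prod.distrib prod_constant poly_prod) simp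
    also have "(- inverse t) ^ ?d = (- 1) ^ ?d * inverse t ^ ?d" by (rule power_minus)
    finally have "t ^ D * t ^ ?d * (inverse t ^ D * poly ?p t) =
        t ^ D * t ^ ?d * (c * ((- 1) ^ ?d * inverse t ^ ?d * poly ?P t))" by simp
    then have "(t * inverse t) ^ D * (t ^ ?d * poly ?p t) = (t * inverse t) ^ ?d * (t ^ D * (?c' * poly ?P t))"
      by (simp only: power_mult_distrib mult_ac)
    then show ?thesis using t by (simp add: q_def poly_monom)
  qed
  \<comment> \<open>The identity holds only for \<open>t \<noteq> 0\<close>; the extra factor
    \<open>t\<close> covers the remaining point.\<close>
  then have "poly ([:0, 1:] * q) t = 0" for t by (cases "t = 0") auto
  then have "[:0, 1:] * q = 0" using poly_all_0_iff_0 by blast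
  then have "q = 0" by (simp only: mult_eq_0_iff) simp
  then have eq: "monom 1 ?d * ?p = monom 1 D * smult ?c' ?P" by (simp add: q_def)
  \<comment> \<open>Both cofactors have nonzero constant term, so the two powers of \<open>t\<close>
    in front must agree.\<close>
  have "D \<le> ?d"
    using arg_cong[OF eq, of "\<lambda>r. coeff r ?d"] p0 by (auto simp: coeff_monom_mult split: if_splits)
  moreover have "?d \<le> D"
    using arg_cong[OF eq, of "\<lambda>r. coeff r D"] P0 c by (auto simp: coeff_monom_mult split: if_splits)
  ultimately have Dd: "D = ?d" by simp
  then have "monom 1 ?d * ?p = monom 1 ?d * smult ?c' ?P" using eq by (simp only:)
  moreover have "monom 1 ?d \<noteq> (0 :: complex poly)" by (simp add: monom_eq_0_iff)
  ultimately have "?p = smult ?c' ?P" by (metis mult_left_cancel)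
  moreover from this have c': "?c' = 1" using p0 P0 by simp
  ultimately have p: "?p = ?P" by (metis smult_1_left)
  show "card I = n * deg_in 0" using total_degree_eq[OF D] Dd by simp
  show "(\<Sum>i<n. of_nat (deg_in i) * a (diag i)) = (\<Sum>i\<in>I. l i)"
    using coeff_1_prod[OF I, of l] coeff_1_along_powers[of a] p by metis
  have "ieval a R = poly \<phi> 0" by (simp add: \<phi>)
  also have "\<dots> = c * (\<Prod>i\<in>I. - 1 * l i)" unfolding roots by (simp add: poly_prod)
  also have "\<dots> = ?c' * (\<Prod>i\<in>I. l i)" by (simp only: prod.distrib prod_constant) simp
  finally show "ieval a R = (\<Prod>i\<in>I. l i)" by (simp add: c')
qed

end

section \<open>Tensors\<close>

lemma sum_list_single_replicate:
  "sum_list (map (\<lambda>j. single j 1) (replicate k i)) = (single i k :: nat monomial)"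
  by (induction k) (simp_all flip: single_add)

lemma sum_list_single_eq_single:
  assumes "sum_list (map (\<lambda>j. single j 1) js) = (single i k :: nat monomial)"
  shows "js = replicate (length js) i"
proof -
  have "lookup (sum_list (map (\<lambda>j. single j 1) js) :: nat monomial) j > 0"
    if "j \<in> set js" for j
    using that by (induction js) (auto simp: lookup_add)
  then have "j = i" if "j \<in> set js" for j
    using that unfolding assms by (metis lookup_single_not_eq less_numeral_extra(3))
  then show ?thesis by (metis replicate_length_same)
qed

lemma replicate_in_tensor_indices: "i < n \<Longrightarrow> replicate k i \<in> tensor_indices n k"
  by (auto simp: tensor_indices_def)

lemma identity_tensor_Cons:
  "identity_tensor (i # js) = (if js = replicate (length js) i then 1 else 0)"
proof -
  have "(\<forall>j\<in>set (i # js). \<forall>k\<in>set (i # js). j = k) \<longleftrightarrow> js = replicate (length js) i"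
    by (metis (no_types, lifting) in_set_replicate list.set_intros replicate_Suc length_Cons replicate_length_same)
  then show ?thesis by (simp add: identity_tensor_def)
qed

text \<open>The identity tensor has the pure powers as its forms, so subtracting \<open>z\<close>
  times it moves the system along \<open>powers\<close>.\<close>

lemma lookup_identity_forms:
  assumes "i < n"
  shows "(\<Sum>js\<in>tensor_indices n k. if sum_list (map (\<lambda>j. single j 1) js) = \<alpha>
      then identity_tensor (i # js) else 0) = (if \<alpha> = single i k then 1 else 0)"
proof -
  have "(\<Sum>js\<in>tensor_indices n k. if sum_list (map (\<lambda>j. single j 1) js) = \<alpha>
      then identity_tensor (i # js) else 0) =
    (\<Sum>js\<in>tensor_indices n k. if js = replicate k i then
       (if \<alpha> = single i k then 1 else 0) else 0)"
  proof (intro sum.cong refl)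
    fix js assume js: "js \<in> tensor_indices n k"
    show "(if sum_list (map (\<lambda>j. single j 1) js) = \<alpha> then identity_tensor (i # js) else 0) =
      (if js = replicate k i then (if \<alpha> = single i k then 1 else 0) else 0)"
    proof (cases "js = replicate k i")
      case True
      show ?thesis unfolding True sum_list_single_replicate by (auto simp: identity_tensor_Cons)
    next
      case False
      then show ?thesis using js by (simp add: identity_tensor_Cons tensor_indices_def)
    qed
  qed
  also have "\<dots> = (if \<alpha> = single i k then 1 else 0)"
    using replicate_in_tensor_indices[OF assms] by (simp add: sum.delta)
  finally show ?thesis .
qed

text \<open>Only a constant index list produces a pure power, so this coefficient is one diagonal
  entry; this is how the trace appears.\<close>

lemma lookup_tensor_forms_diag:
  assumes "i < n" "m \<ge> 1"
  shows "lookup (tensor_forms n m A i) (single i (m - 1)) = A (replicate m i)"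
proof -
  let ?e = "m - 1"
  have m: "replicate m i = i # replicate ?e i" using assms(2) by (cases m) auto
  have "lookup (tensor_forms n m A i) (single i ?e) =
    (\<Sum>js\<in>tensor_indices n ?e. if js = replicate ?e i then A (i # js) else 0)"
    unfolding lookup_tensor_forms
  proof (intro sum.cong refl if_cong)
    fix js assume "js \<in> tensor_indices n ?e"
    then have "length js = ?e" by (simp add: tensor_indices_def)
    then show "(sum_list (map (\<lambda>j. single j 1) js) = single i ?e) \<longleftrightarrow> js = replicate ?e i"
      using sum_list_single_eq_single[of js i ?e] sum_list_single_replicate[of ?e i] by metis
  qed
  also have "\<dots> = A (replicate m i)"
    using replicate_in_tensor_indices[OF assms(1)] by (simp add: sum.delta m)
  finally show ?thesis .
qed

theorem tensor_eigenvalues_det_trace: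
  fixes A :: "nat list \<Rightarrow> real" and l :: "nat \<Rightarrow> real"
  assumes m: "m \<ge> 2" and n: "n \<ge> 1" and "d = n * (m - 1) ^ (n - 1)"
    and eig: "tensor_eigenvalues n m A = image_mset (\<lambda>i. complex_of_real (l i)) (mset_set {1..d})"
  shows "tensor_det n m A = (\<Prod>i=1..d. l i)"
    and "real ((m - 1) ^ (n - 1)) * tensor_trace n m A = (\<Sum>i=1..d. l i)"
proof -
  define e where "e = m - 1"
  have e: "e \<ge> 1" and d: "d = n * e ^ (n - 1)" using m assms(3) by (simp_all add: e_def)
  interpret form_system n "\<lambda>_. e" by unfold_locales (use e n in auto)
  obtain R where "is_resultant n (\<lambda>_. e) R" and R: "(THE R. is_resultant n (\<lambda>_. e) R) = R"
    "R \<in> polys_in indets" "\<And>c. ieval c R = 0 \<longleftrightarrow> has_zero c"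
    "ieval (powers :: _ \<Rightarrow> complex) R = 1"
    "\<And>P. P \<in> polys_in indets \<Longrightarrow> vanishing P \<Longrightarrow> R dvd P"
    using resultant_properties by metis
  interpret equal_degree_system n e R by unfold_locales (use R in auto)
  define a where "a v = complex_of_real (lookup (tensor_forms n m A (fst v)) (snd v))" for v
  define \<phi> where "\<phi> = tensor_charpoly n m (\<lambda>is. complex_of_real (A is))"
  have det: "tensor_det n m B = ieval (coeffs_of (tensor_forms n m B)) R"
    for B :: "nat list \<Rightarrow> 'a::comm_ring_1"
    unfolding tensor_det_def resultant_def e_def[symmetric] R(1) by (rule coeff_eval_coeffs_of)
  have \<phi>: "poly \<phi> z = ieval (\<lambda>v. a v - z * powers v) R" for z
    unfolding \<phi>_def poly_tensor_charpoly det
  proof (rule insertion_cong_indets[OF R_in])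
    fix v assume "v \<in> indets"
    then obtain i \<alpha> where v: "v = (i, \<alpha>)" "i < n" by (auto simp: indets_def)
    have "coeffs_of (tensor_forms n m (\<lambda>is. complex_of_real (A is) - z * identity_tensor is)) v =
      (\<Sum>js\<in>tensor_indices n e. if sum_list (map (\<lambda>j. single j 1) js) = \<alpha>
          then complex_of_real (A (i # js)) else 0) -
      z * (\<Sum>js\<in>tensor_indices n e. if sum_list (map (\<lambda>j. single j 1) js) = \<alpha>
          then identity_tensor (i # js) else 0)"
      unfolding sum_distrib_left sum_subtractf[symmetric] coeffs_of_def v(1) fst_conv snd_conv
        lookup_tensor_forms e_def
      by (intro sum.cong) auto
    also have "\<dots> = a v - z * powers v"
    proof -
      have "powers v = (if \<alpha> = single i e then 1 else 0 :: complex)"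
        by (simp add: powers_def v(1))
      moreover have "a v = (\<Sum>js\<in>tensor_indices n e.
          if sum_list (map (\<lambda>j. single j 1) js) = \<alpha> then complex_of_real (A (i # js)) else 0)"
        unfolding a_def v(1) fst_conv snd_conv lookup_tensor_forms e_def
        by (simp add: if_distrib[of complex_of_real] cong: if_cong)
      ultimately show ?thesis unfolding lookup_identity_forms[OF v(2)] by (simp only:)
    qed
    finally show "coeffs_of (tensor_forms n m (\<lambda>is. complex_of_real (A is) - z * identity_tensor is)) v =
      a v - z * powers v" .
  qed
  have roots: "proots \<phi> = image_mset (\<lambda>i. complex_of_real (l i)) (mset_set {1..d})"
    using eig by (simp add: tensor_eigenvalues_def \<phi>_def)
  have "d \<ge> 1" using e n by (simp add: d)
  \<comment> \<open>\<open>proots 0\<close> is the empty multiset, whereas at least one root is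
    given.\<close>
  then have "\<phi> \<noteq> 0" using roots by (auto simp: mset_set_empty_iff)
  then have lc: "lead_coeff \<phi> \<noteq> 0" by simp
  have "\<phi> = smult (lead_coeff \<phi>) (\<Prod>x\<in>#proots \<phi>. [:- x, 1:])"
    by (rule complex_poly_decompose_multiset[symmetric])
  also have "(\<Prod>x\<in>#proots \<phi>. [:- x, 1:]) = (\<Prod>i\<in>{1..d}. [:- complex_of_real (l i), 1:])"
    unfolding roots by (simp add: prod_unfold_prod_mset image_mset.compositionality comp_def)
  finally have \<phi>_eq: "\<phi> = smult (lead_coeff \<phi>) (\<Prod>i\<in>{1..d}. [:- complex_of_real (l i), 1:])" .
  note cr = characteristic_roots[OF \<phi> \<phi>_eq lc finite_atLeastAtMost]
  have "complex_of_real (tensor_det n m A) = ieval a R"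
  proof -
    have hom: "comm_ring_hom complex_of_real" by unfold_locales auto
    show ?thesis
      unfolding det hom_insertion_of_int[OF hom] by (simp add: coeffs_of_def a_def[abs_def])
  qed
  also have "\<dots> = complex_of_real (\<Prod>i=1..d. l i)" using cr(1) by simp
  finally show "tensor_det n m A = (\<Prod>i=1..d. l i)" by (simp only: of_real_eq_iff)
  have "n * e ^ (n - 1) = n * deg_in 0" using cr(3) by (simp add: d)
  \<comment> \<open>The degree in each form is obtained by cancelling \<open>n\<close> from the
    number of eigenvalues.\<close>
  then have deg: "deg_in 0 = e ^ (n - 1)" using n by simp
  have "complex_of_real (\<Sum>i=1..d. l i) = (\<Sum>i<n. of_nat (deg_in i) * a (diag i))"
    using cr(2) by simp
  also have "\<dots> = (\<Sum>i<n. of_nat (e ^ (n - 1)) * complex_of_real (A (replicate m i)))"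
  proof (intro sum.cong refl)
    fix i assume "i \<in> {..<n}"
    then have "i < n" by simp
    then have "deg_in i = e ^ (n - 1)" using deg_in_eq deg by metis
    moreover have "a (diag i) = complex_of_real (A (replicate m i))"
      unfolding a_def fst_conv snd_conv e_def using lookup_tensor_forms_diag[OF \<open>i < n\<close>, of m A] m by simp
    ultimately show "of_nat (deg_in i) * a (diag i) =
        of_nat (e ^ (n - 1)) * complex_of_real (A (replicate m i))" by simp
  qed
  also have "\<dots> = complex_of_real (real (e ^ (n - 1)) * tensor_trace n m A)"
    by (simp add: tensor_trace_def sum_distrib_left)
  finally show "real ((m - 1) ^ (n - 1)) * tensor_trace n m A = (\<Sum>i=1..d. l i)"
    by (simp only: of_real_eq_iff e_def)
qed

section \<open>Means of initial and final segments\<close>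

text \<open>The value at the cut, \<open>f k\<close> or \<open>f (d - k + 1)\<close>, bounds one
  segment from below and the other from above; cross-multiplying compares the averages.\<close>

lemma segment_averages:
  fixes f :: "nat \<Rightarrow> real"
  assumes anti: "\<And>i j. 1 \<le> i \<Longrightarrow> i \<le> j \<Longrightarrow> j \<le> d \<Longrightarrow> f j \<le> f i" and k: "1 \<le> k" "k \<le> d"
  shows "(\<Sum>i=1..d. f i) / d \<le> (\<Sum>i=1..k. f i) / k"
    and "(\<Sum>i=d-k+1..d. f i) / k \<le> (\<Sum>i=1..d. f i) / d"
proof -
  have split: "(\<Sum>i=1..d. f i) = (\<Sum>i=1..j. f i) + (\<Sum>i=j+1..d. f i)" if "j \<le> d" for j
    using sum.ub_add_nat[of 1 j f "d - j"] that by simp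
  have "real k * f k \<le> (\<Sum>i=1..k. f i)"
    using sum_bounded_below[of "{1..k}" "f k" f] anti k by simp
  moreover have "(\<Sum>i=k+1..d. f i) \<le> real (d - k) * f k"
    using sum_bounded_above[of "{k+1..d}" f "f k"] anti k by simp
  ultimately have "real k * (\<Sum>i=k+1..d. f i) \<le> real (d - k) * (\<Sum>i=1..k. f i)"
    using mult_left_mono[of "real k * f k" "\<Sum>i=1..k. f i" "real (d - k)"]
      mult_left_mono[of "\<Sum>i=k+1..d. f i" "real (d - k) * f k" "real k"]
    by (simp add: mult_ac)
  then show "(\<Sum>i=1..d. f i) / d \<le> (\<Sum>i=1..k. f i) / k"
    unfolding split[OF k(2)] using k by (simp add: field_simps of_nat_diff)
  let ?j = "d - k"
  have "real ?j * f (?j + 1) \<le> (\<Sum>i=1..?j. f i)"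
    using sum_bounded_below[of "{1..?j}" "f (?j + 1)" f] anti k by simp
  moreover have "(\<Sum>i=?j+1..d. f i) \<le> real k * f (?j + 1)"
    using sum_bounded_above[of "{?j+1..d}" f "f (?j + 1)"] anti k by simp
  ultimately have "real ?j * (\<Sum>i=?j+1..d. f i) \<le> real k * (\<Sum>i=1..?j. f i)"
    using mult_left_mono[of "real ?j * f (?j + 1)" "\<Sum>i=1..?j. f i" "real k"]
      mult_left_mono[of "\<Sum>i=?j+1..d. f i" "real k * f (?j + 1)" "real ?j"]
    by (simp add: mult_ac)
  then show "(\<Sum>i=d-k+1..d. f i) / k \<le> (\<Sum>i=1..d. f i) / d"
    unfolding split[OF diff_le_self, of k] using k by (simp add: field_simps of_nat_diff)
qed

text \<open>Geometric means become averages of logarithms, to which \<open>segment_averages\<close>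
  applies as well.\<close>

lemma root_prod_eq_exp:
  fixes f :: "nat \<Rightarrow> real"
  assumes "finite S" "S \<noteq> {}" "\<And>i. i \<in> S \<Longrightarrow> f i > 0"
  shows "root (card S) (\<Prod>i\<in>S. f i) = exp ((\<Sum>i\<in>S. ln (f i)) / card S)"
proof -
  have "(\<Prod>i\<in>S. f i) > 0" using assms by (intro prod_pos) auto
  moreover have "card S > 0" using assms by (simp add: card_gt_0_iff)
  moreover have "ln (\<Prod>i\<in>S. f i) = (\<Sum>i\<in>S. ln (f i))"
    using assms(1) by (rule ln_prod) (metis assms(3) less_irrefl)
  ultimately show ?thesis by (simp add: root_powr_inverse powr_def)
qed

text \<open>The inequality \<open>ln x \<le> x - 1\<close> is summed over the ratios of the values
  to their mean; the right-hand sides add up to zero.\<close>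

lemma geometric_arithmetic_mean:
  fixes f :: "nat \<Rightarrow> real"
  assumes S: "finite S" "S \<noteq> {}" and pos: "\<And>i. i \<in> S \<Longrightarrow> f i > 0"
  shows "root (card S) (\<Prod>i\<in>S. f i) \<le> (\<Sum>i\<in>S. f i) / card S"
proof -
  let ?k = "real (card S)"
  let ?\<mu> = "(\<Sum>i\<in>S. f i) / ?k"
  have k: "?k > 0" using S by (simp add: card_gt_0_iff)
  then have \<mu>: "?\<mu> > 0" using S pos by (simp add: sum_pos)
  have "(\<Sum>i\<in>S. ln (f i) - ln ?\<mu>) \<le> (\<Sum>i\<in>S. f i / ?\<mu> - 1)"
  proof (rule sum_mono)
    fix i assume "i \<in> S"
    then show "ln (f i) - ln ?\<mu> \<le> f i / ?\<mu> - 1"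
      using pos[of i] \<mu> ln_le_minus_one[of "f i / ?\<mu>"] ln_divide_pos[of "f i" ?\<mu>] divide_pos_pos
      by metis
  qed
  also have "\<dots> = (\<Sum>i\<in>S. f i) / ?\<mu> - ?k" by (simp add: sum_subtractf sum_divide_distrib)
  also have "\<dots> = 0" using \<mu> k by (simp add: field_simps)
  finally have "(\<Sum>i\<in>S. ln (f i)) \<le> ?k * ln ?\<mu>" by (simp add: sum_subtractf)
  then have "(\<Sum>i\<in>S. ln (f i)) / ?k \<le> ln ?\<mu>" using k by (simp add: field_simps)
  then have "exp ((\<Sum>i\<in>S. ln (f i)) / ?k) \<le> ?\<mu>" using \<mu> by (metis exp_le_cancel_iff exp_ln)
  then show ?thesis using root_prod_eq_exp[OF S pos] by simp
qed

theorem theorem3p2: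
  fixes A :: "nat list \<Rightarrow> real" and lam :: "nat \<Rightarrow> real" and n m d k :: nat
  assumes "m \<ge> 2" and "even m" and "n \<ge> 1"
    and "symmetric_tensor n m A"
    and "d = n * (m - 1) ^ (n - 1)"
    and "tensor_eigenvalues n m A = image_mset (\<lambda>i. complex_of_real (lam i)) (mset_set {1..d})"
    and "\<forall>i\<in>{1..d}. \<forall>j\<in>{1..d}. i \<le> j \<longrightarrow> lam i \<ge> lam j"
    and "\<forall>i\<in>{1..d}. lam i > 0"
    and "1 \<le> k" and "k \<le> d"
  shows "root k (\<Prod>i=d-k+1..d. lam i) \<le> root d (tensor_det n m A)
       \<and> root d (tensor_det n m A) \<le> root k (\<Prod>i=1..k. lam i)
       \<and> root k (\<Prod>i=1..k. lam i) \<le> (\<Sum>i=1..k. lam i) / real k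
       \<and> root k (\<Prod>i=d-k+1..d. lam i) \<le> (\<Sum>i=d-k+1..d. lam i) / real k
       \<and> (\<Sum>i=d-k+1..d. lam i) / real k \<le> real ((m - 1) ^ (n - 1)) * tensor_trace n m A / real d
       \<and> real ((m - 1) ^ (n - 1)) * tensor_trace n m A / real d \<le> (\<Sum>i=1..k. lam i) / real k"
proof -
  note det_trace = tensor_eigenvalues_det_trace[OF assms(1,3,5,6)]
  have pos: "lam i > 0" if "1 \<le> i" "i \<le> d" for i using assms(8) that by simp
  have anti: "lam j \<le> lam i" if "1 \<le> i" "i \<le> j" "j \<le> d" for i j using assms(7) that by simp
  \<comment> \<open>Segment averages of \<open>ln (lam i)\<close> give the two bounds on the
    determinant; those of \<open>lam i\<close> give the two bounds on the trace.\<close>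
  have anti_ln: "ln (lam j) \<le> ln (lam i)" if "1 \<le> i" "i \<le> j" "j \<le> d" for i j
    using anti[OF that] pos[of i] pos[of j] that by simp
  note k = assms(9,10)
  have root_eq: "root k (\<Prod>i=1..k. lam i) = exp ((\<Sum>i=1..k. ln (lam i)) / k)"
    "root d (\<Prod>i=1..d. lam i) = exp ((\<Sum>i=1..d. ln (lam i)) / d)"
    "root k (\<Prod>i=d-k+1..d. lam i) = exp ((\<Sum>i=d-k+1..d. ln (lam i)) / k)"
    using root_prod_eq_exp[of "{1..k}" lam] root_prod_eq_exp[of "{1..d}" lam]
      root_prod_eq_exp[of "{d-k+1..d}" lam] k pos by auto
  have "root k (\<Prod>i=1..k. lam i) \<le> (\<Sum>i=1..k. lam i) / k"
    "root k (\<Prod>i=d-k+1..d. lam i) \<le> (\<Sum>i=d-k+1..d. lam i) / k"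
    using geometric_arithmetic_mean[of "{1..k}" lam] geometric_arithmetic_mean[of "{d-k+1..d}" lam]
      k pos by auto
  then show ?thesis
    unfolding det_trace root_eq
    using segment_averages[OF anti_ln k] segment_averages[OF anti k] by simp
qed

end
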